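(* Let $G$ be a locally compact (Hausdorff) topological group. Then $G$ is numerally approximable if and only if $G\cong\mathbb{R}\times C$ (as topological groups) for some compact connected abelian group $C$.
   Context: For a locally compact group $G$, $\mathcal{SUB}(G)$ is the set of all closed subgroups of $G$ with the Chabauty topology, in which each closed subgroup $H$ has a neighborhood base consisting of the sets $\mathcal U(H;K,W)=\{L\in\mathcal{SUB}(G)\mid L\cap K\subseteq WH \text{ and } H\cap K\subseteq WL\}$, where $K$ ranges over compact subsets of $G$ and $W$ over identity neighborhoods of $G$. $\mathcal R_1(G)\subseteq\mathcal{SUB}(G)$ is the set of all closed subgroups of $G$ isomorphic, as topological groups, to $\mathbb{R}$. $G$ is numerally approximable if $G\in\overline{\mathcal R_1(G)}$ (closure in $\mathcal{SUB}(G)$). *)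

theory Defs
  imports "HOL-Analysis.Analysis" "HOL-Algebra.Coset"
begin

locale topological_group = group G for G (structure) +
  fixes T :: "'a topology"
  assumes topspace_eq_carrier: "topspace T = carrier G"
    and continuous_mult: "continuous_map (prod_topology T T) T (\<lambda>(x, y). x \<otimes> y)"
    and continuous_inv: "continuous_map T T (\<lambda>x. inv x)"

definition topological_group_isomorphic ::
  "('a, 'm) monoid_scheme \<Rightarrow> 'a topology \<Rightarrow> ('b, 'n) monoid_scheme \<Rightarrow> 'b topology \<Rightarrow> bool"
where
  "topological_group_isomorphic G T H S \<longleftrightarrow> (\<exists>f \<in> iso G H. homeomorphic_map T S f)"

definition real_group :: "real monoid" where
  "real_group = \<lparr>carrier = UNIV, mult = (+), one = 0\<rparr>"

definition closed_subgroups :: "('a, 'm) monoid_scheme \<Rightarrow> 'a topology \<Rightarrow> 'a set set" where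
  "closed_subgroups G T = {H. subgroup H G \<and> closedin T H}"

definition identity_neighborhood :: "('a, 'm) monoid_scheme \<Rightarrow> 'a topology \<Rightarrow> 'a set \<Rightarrow> bool" where
  "identity_neighborhood G T W \<longleftrightarrow>
     W \<subseteq> topspace T \<and> (\<exists>V. openin T V \<and> \<one>\<^bsub>G\<^esub> \<in> V \<and> V \<subseteq> W)"

definition chabauty_nbhd ::
  "('a, 'm) monoid_scheme \<Rightarrow> 'a topology \<Rightarrow> 'a set \<Rightarrow> 'a set \<Rightarrow> 'a set \<Rightarrow> 'a set set"
where
  "chabauty_nbhd G T H K W =
     {L \<in> closed_subgroups G T. L \<inter> K \<subseteq> W <#>\<^bsub>G\<^esub> H \<and> H \<inter> K \<subseteq> W <#>\<^bsub>G\<^esub> L}"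

definition chabauty_open :: "('a, 'm) monoid_scheme \<Rightarrow> 'a topology \<Rightarrow> 'a set set \<Rightarrow> bool" where
  "chabauty_open G T A \<longleftrightarrow>
     A \<subseteq> closed_subgroups G T \<and>
     (\<forall>H\<in>A. \<exists>K W. compactin T K \<and> identity_neighborhood G T W \<and> chabauty_nbhd G T H K W \<subseteq> A)"

definition chabauty :: "('a, 'm) monoid_scheme \<Rightarrow> 'a topology \<Rightarrow> 'a set topology" where
  "chabauty G T = topology (chabauty_open G T)"

definition real_subgroups :: "('a, 'm) monoid_scheme \<Rightarrow> 'a topology \<Rightarrow> 'a set set" where
  "real_subgroups G T =
     {H \<in> closed_subgroups G T.
        topological_group_isomorphic (G\<lparr>carrier := H\<rparr>) (subtopology T H) real_group euclidean}"

definition compact_connected_abelian_group :: "('a, 'm) monoid_scheme \<Rightarrow> 'a topology \<Rightarrow> bool" where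
  "compact_connected_abelian_group C S \<longleftrightarrow>
     topological_group C S \<and> Hausdorff_space S \<and> compact_space S \<and> connected_space S \<and>
     comm_group C"

definition numerally_approximable :: "('a, 'm) monoid_scheme \<Rightarrow> 'a topology \<Rightarrow> bool" where
  "numerally_approximable G T \<longleftrightarrow> carrier G \<in> chabauty G T closure_of real_subgroups G T"

(* The remaining facts check that the topology chabauty G T is well defined and that, for
   locally compact Hausdorff G, the sets chabauty_nbhd G T H K W form a neighborhood base at H. *)

lemma identity_neighborhood_Int:
  assumes "identity_neighborhood G T W" "identity_neighborhood G T W'"
  shows "identity_neighborhood G T (W \<inter> W')"
proof -
  obtain V V' where "openin T V" "\<one>\<^bsub>G\<^esub> \<in> V" "V \<subseteq> W" "openin T V'" "\<one>\<^bsub>G\<^esub> \<in> V'" "V' \<subseteq> W'"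
    using assms unfolding identity_neighborhood_def by blast
  then have "openin T (V \<inter> V') \<and> \<one>\<^bsub>G\<^esub> \<in> V \<inter> V' \<and> V \<inter> V' \<subseteq> W \<inter> W'"
    by blast
  then show ?thesis
    using assms unfolding identity_neighborhood_def by blast
qed

lemma chabauty_nbhd_mono:
  assumes "K \<subseteq> K'" "W' \<subseteq> W"
  shows "chabauty_nbhd G T H K' W' \<subseteq> chabauty_nbhd G T H K W"
proof -
  have "W' <#>\<^bsub>G\<^esub> L \<subseteq> W <#>\<^bsub>G\<^esub> L" for L
    using assms(2) unfolding set_mult_def by blast
  then show ?thesis
    using assms(1) unfolding chabauty_nbhd_def by blast
qed

lemma istopology_chabauty_open: "istopology (chabauty_open G T)"
  unfolding istopology_def
proof (intro conjI allI impI)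
  fix A B assume A: "chabauty_open G T A" and B: "chabauty_open G T B"
  show "chabauty_open G T (A \<inter> B)"
    unfolding chabauty_open_def
  proof (intro conjI ballI)
    show "A \<inter> B \<subseteq> closed_subgroups G T"
      using A unfolding chabauty_open_def by blast
    fix H assume "H \<in> A \<inter> B"
    then obtain K W K' W' where
      "compactin T K" "identity_neighborhood G T W" "chabauty_nbhd G T H K W \<subseteq> A"
      "compactin T K'" "identity_neighborhood G T W'" "chabauty_nbhd G T H K' W' \<subseteq> B"
      using A B unfolding chabauty_open_def by (metis IntE)
    moreover have "chabauty_nbhd G T H (K \<union> K') (W \<inter> W') \<subseteq> chabauty_nbhd G T H K W"
      "chabauty_nbhd G T H (K \<union> K') (W \<inter> W') \<subseteq> chabauty_nbhd G T H K' W'"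
      by (intro chabauty_nbhd_mono; blast)+
    ultimately show "\<exists>K W. compactin T K \<and> identity_neighborhood G T W \<and>
        chabauty_nbhd G T H K W \<subseteq> A \<inter> B"
      by (intro exI[of _ "K \<union> K'"] exI[of _ "W \<inter> W'"])
        (auto intro: compactin_Un identity_neighborhood_Int)
  qed
next
  fix \<A> assume *: "\<forall>A\<in>\<A>. chabauty_open G T A"
  show "chabauty_open G T (\<Union>\<A>)"
    unfolding chabauty_open_def
  proof (intro conjI ballI)
    show "\<Union>\<A> \<subseteq> closed_subgroups G T"
      using * unfolding chabauty_open_def by blast
    fix H assume "H \<in> \<Union>\<A>"
    then obtain A where "A \<in> \<A>" "H \<in> A" by blast
    moreover then obtain K W where
      "compactin T K" "identity_neighborhood G T W" "chabauty_nbhd G T H K W \<subseteq> A"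
      using * unfolding chabauty_open_def by blast
    ultimately show "\<exists>K W. compactin T K \<and> identity_neighborhood G T W \<and>
        chabauty_nbhd G T H K W \<subseteq> \<Union>\<A>"
      by blast
  qed
qed

lemma openin_chabauty: "openin (chabauty G T) A \<longleftrightarrow> chabauty_open G T A"
  by (simp add: chabauty_def istopology_chabauty_open)

context topological_group
begin

lemma compact_square_root_neighborhood:
  assumes "locally_compact_space T" and "Hausdorff_space T" and W: "identity_neighborhood G T W"
  obtains V where "compactin T V" "identity_neighborhood G T V"
    "\<And>x y. x \<in> V \<Longrightarrow> y \<in> V \<Longrightarrow> x \<otimes> y \<in> W"
proof -
  obtain U where U: "openin T U" "\<one> \<in> U" "U \<subseteq> W"
    using W unfolding identity_neighborhood_def by blast
  let ?P = "{p \<in> topspace (prod_topology T T). (\<lambda>(x, y). x \<otimes> y) p \<in> U}"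
  have "openin (prod_topology T T) ?P"
    using continuous_mult U(1) by (rule openin_continuous_map_preimage)
  moreover have "(\<one>, \<one>) \<in> ?P"
    using U(2) by (simp add: topspace_eq_carrier)
  ultimately obtain X Y where XY: "openin T X" "openin T Y" "\<one> \<in> X" "\<one> \<in> Y" "X \<times> Y \<subseteq> ?P"
    unfolding openin_prod_topology_alt by meson
  have "neighbourhood_base_of (compactin T) T"
    using assms(1,2) locally_compact_space_neighbourhood_base by blast
  moreover have "openin T (X \<inter> Y)" "\<one> \<in> X \<inter> Y"
    using XY by auto
  ultimately obtain O' V where V: "openin T O'" "compactin T V" "\<one> \<in> O'" "O' \<subseteq> V" "V \<subseteq> X \<inter> Y"
    unfolding neighbourhood_base_of by meson
  show thesis
  proof
    show "compactin T V" by (fact V)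
    show "identity_neighborhood G T V"
      using V compactin_subset_topspace unfolding identity_neighborhood_def by metis
    fix x y assume "x \<in> V" "y \<in> V"
    then have "(x, y) \<in> X \<times> Y" using V by blast
    then show "x \<otimes> y \<in> W" using XY U by auto
  qed
qed

lemma chabauty_nbhd_triangle:
  assumes "locally_compact_space T" and "Hausdorff_space T"
    and K: "compactin T K" and W: "identity_neighborhood G T W" and L: "L \<in> closed_subgroups G T"
  obtains K' V where "compactin T K'" "identity_neighborhood G T V"
    "\<And>M. M \<in> chabauty_nbhd G T L K' V \<Longrightarrow> chabauty_nbhd G T M K' V \<subseteq> chabauty_nbhd G T L K W"
proof -
  obtain V where V: "compactin T V" "identity_neighborhood G T V"
    and VV: "\<And>x y. x \<in> V \<Longrightarrow> y \<in> V \<Longrightarrow> x \<otimes> y \<in> W"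
    using compact_square_root_neighborhood[OF assms(1,2) W] by blast
  have Vc: "V \<subseteq> carrier G" and Kc: "K \<subseteq> carrier G"
    using V K compactin_subset_topspace topspace_eq_carrier by blast+
  define f where "f = (\<lambda>p. inv (fst p) \<otimes> snd p)"
  have "continuous_map (prod_topology T T) T ((\<lambda>(x, y). x \<otimes> y) \<circ> (\<lambda>p. (inv (fst p), snd p)))"
    by (intro continuous_map_compose[OF _ continuous_mult] continuous_map_pairedI
        continuous_map_compose[OF continuous_map_fst continuous_inv, unfolded o_def]
        continuous_map_snd)
  then have "continuous_map (prod_topology T T) T f"
    by (simp add: f_def o_def)
  then have "compactin T (f ` (V \<times> K))"
    using V(1) K by (intro image_compactin) (auto simp: compactin_Times)
  then have K': "compactin T (K \<union> f ` (V \<times> K))"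
    using K by (rule compactin_Un[rotated])
  have key: "A \<inter> K \<subseteq> W <#> B"
    if A: "A \<inter> (K \<union> f ` (V \<times> K)) \<subseteq> V <#> M" and B: "M \<inter> (K \<union> f ` (V \<times> K)) \<subseteq> V <#> B"
      and M: "M \<subseteq> carrier G" and Bc: "B \<subseteq> carrier G" for A B M
  proof
    fix a assume a: "a \<in> A \<inter> K"
    then obtain v m where vm: "v \<in> V" "m \<in> M" "a = v \<otimes> m"
      using A unfolding set_mult_def by blast
    then have "m = f (v, a)"
      using M Vc by (simp add: f_def inv_solve_left' subset_iff m_assoc[symmetric])
    then have "m \<in> f ` (V \<times> K)" using vm a by blast
    then obtain u b where ub: "u \<in> V" "b \<in> B" "m = u \<otimes> b"
      using B vm unfolding set_mult_def by blast
    then have "a = (v \<otimes> u) \<otimes> b"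
      using vm Vc Bc by (simp add: m_assoc subset_iff)
    then show "a \<in> W <#> B"
      using VV vm(1) ub unfolding set_mult_def by blast
  qed
  show thesis
  proof
    show "compactin T (K \<union> f ` (V \<times> K))" "identity_neighborhood G T V" by fact+
    have car: "\<And>H. H \<in> closed_subgroups G T \<Longrightarrow> H \<subseteq> carrier G"
      by (simp add: closed_subgroups_def subgroup.subset)
    fix M assume M: "M \<in> chabauty_nbhd G T L (K \<union> f ` (V \<times> K)) V"
    show "chabauty_nbhd G T M (K \<union> f ` (V \<times> K)) V \<subseteq> chabauty_nbhd G T L K W"
    proof
      fix N assume N: "N \<in> chabauty_nbhd G T M (K \<union> f ` (V \<times> K)) V"
      have "M \<subseteq> carrier G" "N \<subseteq> carrier G" "L \<subseteq> carrier G"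
        using M N L car by (simp_all add: chabauty_nbhd_def)
      then have "N \<inter> K \<subseteq> W <#> L" "L \<inter> K \<subseteq> W <#> N"
        using M N key[of N M L] key[of L M N] by (simp_all add: chabauty_nbhd_def)
      then show "N \<in> chabauty_nbhd G T L K W"
        using N by (simp add: chabauty_nbhd_def)
    qed
  qed
qed

lemma chabauty_nbhd_is_neighborhood:
  assumes lc: "locally_compact_space T" "Hausdorff_space T"
    and K: "compactin T K" and W: "identity_neighborhood G T W" and H: "H \<in> closed_subgroups G T"
  shows "\<exists>A. openin (chabauty G T) A \<and> H \<in> A \<and> A \<subseteq> chabauty_nbhd G T H K W"
proof -
  define A where "A = {L \<in> closed_subgroups G T. \<exists>K' W'. compactin T K' \<and>
    identity_neighborhood G T W' \<and> chabauty_nbhd G T L K' W' \<subseteq> chabauty_nbhd G T H K W}"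
  have self: "L \<in> chabauty_nbhd G T L K' W'"
    if L: "L \<in> closed_subgroups G T" and W': "identity_neighborhood G T W'" for L K' W'
  proof -
    have "l \<in> W' <#> L" if "l \<in> L" for l
    proof -
      have "\<one> \<in> W'" "l = \<one> \<otimes> l"
        using that L W' subgroup.mem_carrier
        by (fastforce simp: identity_neighborhood_def closed_subgroups_def)+
      then show ?thesis using that unfolding set_mult_def by blast
    qed
    then show ?thesis using L unfolding chabauty_nbhd_def by blast
  qed
  have "chabauty_open G T A"
    unfolding chabauty_open_def
  proof (intro conjI ballI)
    show "A \<subseteq> closed_subgroups G T" by (auto simp: A_def)
    fix L assume "L \<in> A"
    then obtain K' W' where L: "L \<in> closed_subgroups G T" "compactin T K'"
      "identity_neighborhood G T W'" "chabauty_nbhd G T L K' W' \<subseteq> chabauty_nbhd G T H K W"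
      by (auto simp: A_def)
    obtain K'' V where V: "compactin T K''" "identity_neighborhood G T V"
      "\<And>M. M \<in> chabauty_nbhd G T L K'' V \<Longrightarrow>
        chabauty_nbhd G T M K'' V \<subseteq> chabauty_nbhd G T L K' W'"
      using chabauty_nbhd_triangle[OF lc L(2,3,1)] by blast
    have "chabauty_nbhd G T L K'' V \<subseteq> A"
    proof
      fix M assume M: "M \<in> chabauty_nbhd G T L K'' V"
      then have "M \<in> closed_subgroups G T" by (simp add: chabauty_nbhd_def)
      moreover have "chabauty_nbhd G T M K'' V \<subseteq> chabauty_nbhd G T H K W"
        using V(3)[OF M] L(4) by blast
      ultimately show "M \<in> A" using V(1,2) unfolding A_def by blast
    qed
    then show "\<exists>K W. compactin T K \<and> identity_neighborhood G T W \<and> chabauty_nbhd G T L K W \<subseteq> A"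
      using V by blast
  qed
  moreover have "H \<in> A" using H K W by (auto simp: A_def)
  moreover have "A \<subseteq> chabauty_nbhd G T H K W"
    using self by (auto simp: A_def)
  ultimately show ?thesis by (auto simp: openin_chabauty)
qed

end

end

theory Submission
  imports Defs
begin

text \<open>
  If \<open>G\<close> is approximable by copies of \<open>\<real>\<close>, then it is abelian and connected, and \<open>G = V L\<close> for
  a compact neighbourhood \<open>V\<close> and a closed \<open>L \<cong> \<real>\<close>. The \<open>L\<close>-coordinate is a homomorphism up to
  a bounded error, hence at bounded distance from a homomorphism \<open>f : G \<rightarrow> \<real>\<close>, which is the
  identity on \<open>L\<close> and continuous because it is bounded on \<open>V\<close>. So \<open>G \<cong> \<real> \<times> ker f\<close>,
  and \<open>ker f\<close> is compact.

  Conversely, the graphs of \<open>t \<mapsto> \<gamma> (s t)\<close> for large \<open>s\<close> approximate \<open>\<real> \<times> C\<close> if the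
  one-parameter subgroup \<open>\<gamma>\<close> of \<open>C\<close> is almost dense. Such a \<open>\<gamma>\<close> comes from a homomorphism
  \<open>\<alpha>\<close> from the character group of \<open>C\<close>, which is torsion-free as \<open>C\<close> is connected, to the
  divisible group \<open>\<real>\<close>: \<open>\<gamma> t\<close> is the element on which each character \<open>\<psi>\<close> takes the value
  \<open>cis (\<alpha> \<psi> * t)\<close>. Both its existence and its almost density are instances of Kronecker
  approximation for characters of an abstract abelian group, proved with an invariant mean. That
  characters separate the points of \<open>C\<close> follows from a variational argument, which finds the
  characters as the limits of the maximisers of an energy.
\<close>

section \<open>Invariant means on abelian groups\<close>

text \<open>All integrals are invariant means on the abstract group. Such a mean is finitely
  additive and ignorant of the topology, so there is no complete space of square-integrable
  functions in which an energy could attain its maximum. Almost maximisers are taken instead, and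
  the convolution with a fixed uniformly continuous kernel makes them equicontinuous, turns
  mean-square estimates into uniform ones and lets the limit be a continuous character. To detect a
  given point \<open>b\<close>, the kernel is a difference \<phi> - \<phi>(b^-1 .), with which no
  character of value 1 at \<open>b\<close> correlates.

  In general no one-parameter subgroup of \<open>C\<close> is dense: this would require an injective
  homomorphism from the character group to \<real>, and the character group may have larger
  cardinality. Almost density only asks that \<alpha> be nonzero on finitely many characters. This
  is why the Kronecker theorem is stated quantitatively: for a finite family and a precision
  \<open>e\<close>, only relations with exponents below a bound \<open>N\<close> have to be
  respected.\<close>

lemma universal_subfilter:
  fixes F :: "'i filter"
  assumes "F \<noteq> bot"
  obtains U where "U \<le> F" "U \<noteq> bot"
    "\<And>f :: 'i \<Rightarrow> complex. bounded (range f) \<Longrightarrow> \<exists>l. (f \<longlongrightarrow> l) U"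
proof -
  \<comment> \<open>\<open>X i\<close> records the values at \<open>i\<close> of all bounded
    functions at once. Unbounded functions get the value 0, so that every coordinate stays in a disc
    and Tychonoff's theorem applies to \<open>K\<close>.\<close>
  define X :: "'i \<Rightarrow> ('i \<Rightarrow> complex) \<Rightarrow> complex"
    where "X = (\<lambda>i f. if bounded (range f) then f i else 0)"
  have "\<exists>b. \<forall>i. norm (X i f) \<le> b" for f
  proof (cases "bounded (range f)")
    case False
    then show ?thesis by (intro exI[of _ 0]) (simp add: X_def)
  qed (auto simp: X_def bounded_iff)
  then obtain B where B: "norm (X i f) \<le> B f" for i f by metis
  define K where "K = Pi\<^sub>E UNIV (\<lambda>f. cball (0::complex) (B f))"
  have "compactin (product_topology (\<lambda>i. euclidean) UNIV) K"
    unfolding K_def compactin_PiE by (auto simp: compactin_euclidean_iff)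
  then have K: "compact K"
    by (simp add: euclidean_product_topology compactin_euclidean_iff)
  have "X i \<in> K" for i using B by (auto simp: K_def)
  then have "eventually (\<lambda>p. p \<in> K) (filtermap X F)" by (simp add: eventually_filtermap)
  moreover have "filtermap X F \<noteq> bot" using assms by (simp add: filtermap_bot_iff)
  ultimately obtain p where p: "inf (nhds p) (filtermap X F) \<noteq> bot"
    using K unfolding compact_filter by blast
  \<comment> \<open>Restricting \<open>F\<close> to the preimages of neighbourhoods of the cluster
    point \<open>p\<close> turns clustering into convergence: along \<open>U\<close> the coordinate
    \<open>f\<close> of \<open>X\<close> tends to \<open>p f\<close>. For bounded functions this
    serves as an ultrafilter.\<close>
  define U where "U = inf (filtercomap X (nhds p)) F"
  show thesis
  proof
    show "U \<le> F" by (simp add: U_def)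
    show "U \<noteq> bot"
    proof
      assume "U = bot"
      then have "eventually (\<lambda>_. False) U" by simp
      then obtain P Q where PQ: "eventually P (filtercomap X (nhds p))" "eventually Q F"
        "\<And>i. P i \<Longrightarrow> Q i \<Longrightarrow> False"
        unfolding U_def eventually_inf by blast
      obtain P' where P': "eventually P' (nhds p)" "\<And>i. P' (X i) \<Longrightarrow> P i"
        using PQ(1) unfolding eventually_filtercomap by blast
      have "eventually (\<lambda>q. \<exists>i. q = X i \<and> Q i) (filtermap X F)"
        unfolding eventually_filtermap using PQ(2) by (rule eventually_mono) blast
      with P'(1) have "eventually (\<lambda>_. False) (inf (nhds p) (filtermap X F))"
        unfolding eventually_inf using P'(2) PQ(3) by blast
      with p show False by (simp add: trivial_limit_def)
    qed
    fix f :: "'i \<Rightarrow> complex" assume f: "bounded (range f)"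
    have "((\<lambda>i. X i f) \<longlongrightarrow> p f) U"
    proof (rule topological_tendstoI)
      fix S assume S: "open S" "p f \<in> S"
      have "open ((\<lambda>q :: ('i \<Rightarrow> complex) \<Rightarrow> complex. q f) -` S)"
        using S(1) continuous_on_product_coordinates by (rule open_vimage)
      then have "eventually (\<lambda>q. q f \<in> S) (nhds p)"
        using S(2) by (auto simp: eventually_nhds)
      then have "eventually (\<lambda>i. X i f \<in> S) (filtercomap X (nhds p))"
        by (rule eventually_filtercomapI)
      then show "eventually (\<lambda>i. X i f \<in> S) U"
        by (rule filter_leD[rotated]) (simp add: U_def)
    qed
    then show "\<exists>l. (f \<longlongrightarrow> l) U" using f by (auto simp: X_def)
  qed
qed

section \<open>Boundedness on a set, in particular on the carrier\<close>

definition bounded_on :: "'a set \<Rightarrow> ('a \<Rightarrow> 'b::real_normed_vector) \<Rightarrow> bool" where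
  "bounded_on A f \<longleftrightarrow> (\<exists>B. \<forall>x\<in>A. norm (f x) \<le> B)"

named_theorems bounded_on_intros

lemma bounded_onI: "(\<And>x. x \<in> A \<Longrightarrow> norm (f x) \<le> B) \<Longrightarrow> bounded_on A f"
  by (auto simp: bounded_on_def)

lemma bounded_onE:
  assumes "bounded_on A f"
  obtains B where "B \<ge> 0" "\<And>x. x \<in> A \<Longrightarrow> norm (f x) \<le> B"
proof -
  obtain B where "\<And>x. x \<in> A \<Longrightarrow> norm (f x) \<le> B" using assms by (auto simp: bounded_on_def)
  then show thesis by (intro that[of "max B 0"]) (auto simp: le_max_iff_disj)
qed

lemma bounded_on_const [bounded_on_intros]: "bounded_on A (\<lambda>x. c)"
  by (auto simp: bounded_on_def)

lemma bounded_on_add [bounded_on_intros]: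
  assumes "bounded_on A f" "bounded_on A g"
  shows "bounded_on A (\<lambda>x. f x + g x)"
  using assms unfolding bounded_on_def by (meson norm_add_rule_thm)

lemma bounded_on_uminus [bounded_on_intros]: "bounded_on A f \<Longrightarrow> bounded_on A (\<lambda>x. - f x)"
  by (simp add: bounded_on_def)

lemma bounded_on_diff [bounded_on_intros]:
  assumes "bounded_on A f" "bounded_on A g"
  shows "bounded_on A (\<lambda>x. f x - g x)"
  using bounded_on_add[OF assms(1) bounded_on_uminus[OF assms(2)]] by simp

lemma bounded_on_mult [bounded_on_intros]:
  fixes f g :: "'a \<Rightarrow> 'b::real_normed_algebra"
  assumes "bounded_on A f" "bounded_on A g"
  shows "bounded_on A (\<lambda>x. f x * g x)"
proof -
  obtain B C where "\<And>x. x \<in> A \<Longrightarrow> norm (f x) \<le> B" "B \<ge> 0" "\<And>x. x \<in> A \<Longrightarrow> norm (g x) \<le> C"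
    using assms by (metis bounded_onE)
  then show ?thesis
    by (intro bounded_onI[of _ _ "B * C"] order.trans[OF norm_mult_ineq] mult_mono) auto
qed

lemma bounded_on_cnj [bounded_on_intros]: "bounded_on A f \<Longrightarrow> bounded_on A (\<lambda>x. cnj (f x))"
  by (simp add: bounded_on_def)

lemma bounded_on_of_real [bounded_on_intros]:
  "bounded_on A f \<Longrightarrow> bounded_on A (\<lambda>x. complex_of_real (f x))"
  by (simp add: bounded_on_def)

lemma bounded_on_norm [bounded_on_intros]: "bounded_on A f \<Longrightarrow> bounded_on A (\<lambda>x. norm (f x))"
  by (simp add: bounded_on_def)

lemma bounded_on_power [bounded_on_intros]:
  fixes f :: "'a \<Rightarrow> 'b::real_normed_algebra_1"
  shows "bounded_on A f \<Longrightarrow> bounded_on A (\<lambda>x. f x ^ n)"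
  by (induction n) (auto intro: bounded_on_intros)

lemma bounded_on_sum [bounded_on_intros]:
  "(\<And>i. i \<in> I \<Longrightarrow> bounded_on A (f i)) \<Longrightarrow> bounded_on A (\<lambda>x. \<Sum>i\<in>I. f i x)"
  by (induction I rule: infinite_finite_induct) (auto intro: bounded_on_intros)

lemma bounded_on_prod [bounded_on_intros]:
  fixes f :: "'i \<Rightarrow> 'a \<Rightarrow> 'b::{real_normed_algebra_1, comm_ring_1}"
  shows "(\<And>i. i \<in> I \<Longrightarrow> bounded_on A (f i)) \<Longrightarrow> bounded_on A (\<lambda>x. \<Prod>i\<in>I. f i x)"
  by (induction I rule: infinite_finite_induct) (auto intro: bounded_on_intros)

lemma bounded_on_compose:
  "bounded_on A f \<Longrightarrow> (\<And>x. x \<in> B \<Longrightarrow> t x \<in> A) \<Longrightarrow> bounded_on B (\<lambda>x. f (t x))"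
  by (auto simp: bounded_on_def)

abbreviation (in monoid) bdd_fun :: "('a \<Rightarrow> 'v::real_normed_vector) \<Rightarrow> bool" where
  "bdd_fun \<equiv> bounded_on (carrier G)"

text \<open>A finitely additive replacement for the normalised Haar integral, defined for every
  function that is bounded on the carrier, with no measurability. The bound
  \<open>norm_mean_le\<close> also makes values outside the carrier irrelevant.\<close>

locale invariant_mean = comm_group G for G (structure) +
  fixes M :: "('a \<Rightarrow> complex) \<Rightarrow> complex"
  assumes mean_add: "bdd_fun f \<Longrightarrow> bdd_fun g \<Longrightarrow>
      M (\<lambda>x. f x + g x) = M f + M g"
    and mean_scale: "bdd_fun f \<Longrightarrow> M (\<lambda>x. c * f x) = c * M f"
    and mean_const: "M (\<lambda>x. c) = c"
    and mean_cnj: "bdd_fun f \<Longrightarrow> M (\<lambda>x. cnj (f x)) = cnj (M f)"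
    and mean_translate: "a \<in> carrier G \<Longrightarrow> bdd_fun f \<Longrightarrow> M (\<lambda>x. f (a \<otimes> x)) = M f"
    and norm_mean_le: "(\<And>x. x \<in> carrier G \<Longrightarrow> norm (f x) \<le> B) \<Longrightarrow> norm (M f) \<le> B"
    and Re_mean_nonneg: "bdd_fun f \<Longrightarrow> (\<And>x. x \<in> carrier G \<Longrightarrow> Re (f x) \<ge> 0) \<Longrightarrow>
      Re (M f) \<ge> 0"

section \<open>Box averages and the existence of an invariant mean\<close>

context comm_group
begin

text \<open>For \<open>as\<close> = [a_1, ..., a_k] this averages \<open>f\<close> over the box of
  points a_1^j_1 ... a_k^j_k x with all exponents between 0 and \<open>N\<close>. Such boxes are
  Foelner sets of the abelian group.\<close>

primrec orbit_average :: "nat \<Rightarrow> 'a list \<Rightarrow> ('a \<Rightarrow> complex) \<Rightarrow> 'a \<Rightarrow> complex" where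
  "orbit_average N [] f x = f x"
| "orbit_average N (a # as) f x = (\<Sum>j<Suc N. orbit_average N as f (a [^] j \<otimes> x)) / of_nat (Suc N)"

lemma orbit_average_add:
  "orbit_average N as (\<lambda>x. f x + g x) x = orbit_average N as f x + orbit_average N as g x"
  by (induction as arbitrary: x) (simp_all add: sum.distrib add_divide_distrib del: sum.lessThan_Suc)

lemma orbit_average_scale: "orbit_average N as (\<lambda>x. c * f x) x = c * orbit_average N as f x"
  by (induction as arbitrary: x) (simp_all flip: sum_distrib_left del: sum.lessThan_Suc)

lemma orbit_average_const: "orbit_average N as (\<lambda>x. c) x = c"
  by (induction as arbitrary: x) (simp_all del: sum.lessThan_Suc of_nat_Suc)

lemma orbit_average_cnj: "orbit_average N as (\<lambda>x. cnj (f x)) x = cnj (orbit_average N as f x)"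
  by (induction as arbitrary: x) (simp_all del: sum.lessThan_Suc)

lemma orbit_average_translate:
  assumes "set as \<subseteq> carrier G" "b \<in> carrier G" "x \<in> carrier G"
  shows "orbit_average N as (\<lambda>x. f (b \<otimes> x)) x = orbit_average N as f (b \<otimes> x)"
  using assms
proof (induction as arbitrary: x)
  case (Cons a as)
  have "b \<otimes> (a [^] j \<otimes> x) = a [^] j \<otimes> (b \<otimes> x)" for j :: nat
    using Cons.prems by (simp add: m_lcomm)
  then show ?case using Cons by (simp del: sum.lessThan_Suc)
qed simp

lemma norm_orbit_average_le:
  assumes "set as \<subseteq> carrier G" "x \<in> carrier G" "\<And>x. x \<in> carrier G \<Longrightarrow> norm (f x) \<le> B"
  shows "norm (orbit_average N as f x) \<le> B"
  using assms(1,2)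
proof (induction as arbitrary: x)
  case (Cons a as)
  have "norm (\<Sum>j<Suc N. orbit_average N as f (a [^] j \<otimes> x)) \<le> (\<Sum>j<Suc N. B)"
    using Cons by (intro sum_norm_le) auto
  then show ?case by (simp add: norm_divide divide_simps mult.commute del: sum.lessThan_Suc of_nat_Suc)
qed (use assms(3) in simp)

lemma Re_orbit_average_nonneg:
  assumes "set as \<subseteq> carrier G" "x \<in> carrier G" "\<And>x. x \<in> carrier G \<Longrightarrow> Re (f x) \<ge> 0"
  shows "Re (orbit_average N as f x) \<ge> 0"
  using assms(1,2)
proof (induction as arbitrary: x)
  case (Cons a as)
  have "Re (\<Sum>j<Suc N. orbit_average N as f (a [^] j \<otimes> x)) \<ge> 0"
    unfolding Re_sum using Cons by (intro sum_nonneg) auto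
  moreover have "Re (z / of_nat n) = Re z / of_nat n" for z n
    by (metis Re_divide_of_real of_real_of_nat_eq)
  ultimately show ?case by (simp del: sum.lessThan_Suc of_nat_Suc)
qed (use assms(3) in simp)

text \<open>In the direction of \<open>b\<close> the sum over the exponents telescopes, leaving two
  boundary terms of size at most \<open>B\<close> against \<open>N + 1\<close> summands. The
  averages in the other directions commute with the translation and preserve the estimate.\<close>

lemma orbit_average_almost_invariant:
  assumes "set as \<subseteq> carrier G" "x \<in> carrier G" "\<And>x. x \<in> carrier G \<Longrightarrow> norm (f x) \<le> B" "b \<in> set as"
  shows "norm (orbit_average N as f (b \<otimes> x) - orbit_average N as f x) \<le> 2 * B / Suc N"
  using assms(1,2,4)
proof (induction as arbitrary: x)
  case (Cons a as)
  define F where "F = (\<lambda>j::nat. orbit_average N as f (a [^] j \<otimes> x))"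
  define F' where "F' = (\<lambda>j::nat. orbit_average N as f (a [^] j \<otimes> (b \<otimes> x)))"
  have b: "b \<in> carrier G" using Cons.prems by auto
  have eq: "orbit_average N (a # as) f (b \<otimes> x) - orbit_average N (a # as) f x
      = (\<Sum>j<Suc N. F' j - F j) / of_nat (Suc N)"
    by (simp add: F_def F'_def sum_subtractf diff_divide_distrib del: sum.lessThan_Suc of_nat_Suc)
  have "norm (\<Sum>j<Suc N. F' j - F j) \<le> 2 * B"
  proof (cases "b = a")
    case True
    have "F' j = F (Suc j)" for j
      using Cons.prems by (simp add: F_def F'_def True m_assoc)
    then have "(\<Sum>j<Suc N. F' j - F j) = F (Suc N) - F 0"
      by (simp add: sum_lessThan_telescope del: sum.lessThan_Suc)
    also have "norm \<dots> \<le> norm (F (Suc N)) + norm (F 0)" by (rule norm_triangle_ineq4)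
    also have "\<dots> \<le> B + B"
      unfolding F_def using Cons.prems assms(3)
      by (intro add_mono norm_orbit_average_le[where f = f]) auto
    finally show ?thesis by simp
  next
    case False
    have "norm (F' j - F j) \<le> 2 * B / Suc N" for j
    proof -
      have "a [^] j \<otimes> (b \<otimes> x) = b \<otimes> (a [^] j \<otimes> x)"
        using Cons.prems b by (simp add: m_lcomm)
      then show ?thesis
        unfolding F_def F'_def using Cons False by auto
    qed
    then have "norm (\<Sum>j<Suc N. F' j - F j) \<le> (\<Sum>j<Suc N. 2 * B / Suc N)"
      by (intro sum_norm_le)
    then show ?thesis by (simp del: sum.lessThan_Suc of_nat_Suc)
  qed
  then show ?case
    unfolding eq by (simp add: norm_divide divide_right_mono del: sum.lessThan_Suc of_nat_Suc)
qed simp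

text \<open>The mean is a limit of box averages at \<open>\<one>\<close> as the finite set of
  directions and the box size grow independently; once \<open>a\<close> lies in the set, the defect
  2 B / (N + 1) of invariance under \<open>a\<close> tends to 0. A universal subfilter makes the
  limits exist for all bounded functions simultaneously, so that they are linear in the
  function.\<close>

theorem invariant_mean_exists:
  obtains M where "invariant_mean G M"
proof -
  define as where "as = (\<lambda>F :: 'a set. SOME l. set l = F)"
  define A where "A = (\<lambda>f (F, N). orbit_average N (as F) f \<one>)"
  define \<F> where "\<F> = finite_subsets_at_top (carrier G) \<times>\<^sub>F (sequentially :: nat filter)"
  have "\<F> \<noteq> bot" by (simp add: \<F>_def prod_filter_eq_bot)
  then obtain U where U: "U \<le> \<F>" "U \<noteq> bot"
    "\<And>f :: 'a set \<times> nat \<Rightarrow> complex. bounded (range f) \<Longrightarrow> \<exists>l. (f \<longlongrightarrow> l) U"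
    using universal_subfilter[of \<F>] by blast
  have set_as: "set (as F) = F" if "finite F" for F
    unfolding as_def by (rule someI_ex) (use that finite_list in blast)
  have ev: "eventually (\<lambda>(F, N). set (as F) \<subseteq> carrier G) U"
  proof (rule filter_leD[OF U(1)])
    have "eventually (\<lambda>F. set (as F) \<subseteq> carrier G) (finite_subsets_at_top (carrier G))"
      by (rule eventually_finite_subsets_at_top_weakI) (simp add: set_as)
    then have "eventually (\<lambda>p. set (as (fst p)) \<subseteq> carrier G) \<F>"
      unfolding \<F>_def by (rule eventually_compose_filterlim) (rule filterlim_fst)
    then show "eventually (\<lambda>(F, N). set (as F) \<subseteq> carrier G) \<F>" by (simp add: case_prod_unfold)
  qed
  define M where "M = (\<lambda>f. Lim U (A f))"
  have conv: "(A f \<longlongrightarrow> M f) U" if f: "bdd_fun f" for f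
  proof -
    obtain B where B: "\<And>x. x \<in> carrier G \<Longrightarrow> norm (f x) \<le> B" "B \<ge> 0"
      using f by (metis bounded_onE)
    \<comment> \<open>The estimate by \<open>B\<close> needs directions inside the carrier, which is
      only eventually the case; the value 0 elsewhere makes \<open>A'\<close> bounded everywhere, as
      \<open>U(3)\<close> demands.\<close>
    define A' where "A' = (\<lambda>(F, N). if set (as F) \<subseteq> carrier G then A f (F, N) else 0)"
    have "norm (A' p) \<le> B" for p
      using B by (auto simp: A'_def A_def split: prod.splits intro!: norm_orbit_average_le)
    then have "bounded (range A')" by (auto simp: bounded_iff)
    then obtain l where "(A' \<longlongrightarrow> l) U" using U(3) by blast
    moreover have "eventually (\<lambda>p. A' p = A f p) U"
      using ev by (rule eventually_mono) (auto simp: A'_def)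
    ultimately have "(A f \<longlongrightarrow> l) U" by (simp add: tendsto_cong)
    then show ?thesis unfolding M_def using U(2) by (metis tendsto_Lim)
  qed
  have lim: "M f = l" if "(A f \<longlongrightarrow> l) U" for f l
    unfolding M_def using that U(2) by (metis tendsto_Lim)
  have norm_le: "norm (M f) \<le> B" if B: "\<And>x. x \<in> carrier G \<Longrightarrow> norm (f x) \<le> B" for f B
  proof (rule tendsto_upperbound[OF tendsto_norm[OF conv] _ U(2)])
    show "bdd_fun f" using B by (rule bounded_onI)
    show "eventually (\<lambda>p. norm (A f p) \<le> B) U"
      using ev by (rule eventually_mono) (auto simp: A_def intro!: norm_orbit_average_le B)
  qed
  have "invariant_mean G M"
  proof unfold_locales
    fix f g :: "'a \<Rightarrow> complex" and c :: complex and a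
    assume f: "bdd_fun f"
    show "M (\<lambda>x. c * f x) = c * M f"
      by (rule lim) (use tendsto_mult[OF tendsto_const conv[OF f], of c] in
        \<open>simp add: A_def orbit_average_scale case_prod_unfold\<close>)
    show "M (\<lambda>x. cnj (f x)) = cnj (M f)"
      by (rule lim) (use tendsto_cnj[OF conv[OF f]] in
        \<open>simp add: A_def orbit_average_cnj case_prod_unfold\<close>)
    show "M (\<lambda>x. f x + g x) = M f + M g" if g: "bdd_fun g"
      by (rule lim) (use tendsto_add[OF conv[OF f] conv[OF g]] in
        \<open>simp add: A_def orbit_average_add case_prod_unfold\<close>)
    show "Re (M f) \<ge> 0" if "\<And>x. x \<in> carrier G \<Longrightarrow> Re (f x) \<ge> 0"
    proof (rule tendsto_lowerbound[OF tendsto_Re[OF conv[OF f]] _ U(2)])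
      show "eventually (\<lambda>p. Re (A f p) \<ge> 0) U"
        using ev by (rule eventually_mono) (auto simp: A_def intro!: Re_orbit_average_nonneg that)
    qed
    assume a: "a \<in> carrier G"
    obtain B where B: "\<And>x. x \<in> carrier G \<Longrightarrow> norm (f x) \<le> B" "B \<ge> 0"
      using f by (metis bounded_onE)
    have "((\<lambda>p. 2 * B / Suc (snd p)) \<longlongrightarrow> 0) U"
    proof -
      have "((\<lambda>N. 2 * B / Suc N) \<longlonglongrightarrow> 0)"
        by (rule LIMSEQ_Suc) (rule lim_const_over_n)
      then have "((\<lambda>p. 2 * B / Suc (snd p)) \<longlongrightarrow> 0) \<F>"
        unfolding \<F>_def by (rule filterlim_compose) (rule filterlim_snd)
      then show ?thesis using U(1) by (rule tendsto_mono[rotated])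
    qed
    moreover have "eventually (\<lambda>p. norm (A (\<lambda>x. f (a \<otimes> x)) p - A f p) \<le> 2 * B / Suc (snd p)) U"
    proof -
      have "eventually (\<lambda>F. finite F \<and> a \<in> F \<and> F \<subseteq> carrier G) (finite_subsets_at_top (carrier G))"
        unfolding eventually_finite_subsets_at_top using a by (intro exI[of _ "{a}"]) auto
      then have "eventually (\<lambda>p. finite (fst p) \<and> a \<in> fst p \<and> fst p \<subseteq> carrier G) \<F>"
        unfolding \<F>_def by (rule eventually_compose_filterlim) (rule filterlim_fst)
      then have "eventually (\<lambda>p. finite (fst p) \<and> a \<in> fst p \<and> fst p \<subseteq> carrier G) U"
        using U(1) by (rule filter_leD[rotated])
      then show ?thesis
      proof (rule eventually_mono)
        fix p :: "'a set \<times> nat" assume p: "finite (fst p) \<and> a \<in> fst p \<and> fst p \<subseteq> carrier G"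
        then have "set (as (fst p)) \<subseteq> carrier G" "a \<in> set (as (fst p))" using set_as by auto
        then show "norm (A (\<lambda>x. f (a \<otimes> x)) p - A f p) \<le> 2 * B / Suc (snd p)"
          using a orbit_average_almost_invariant[where f = f and B = B and x = \<one> and b = a
              and as = "as (fst p)" and N = "snd p", OF _ _ B(1)]
          by (simp add: A_def case_prod_unfold orbit_average_translate r_one del: of_nat_Suc)
      qed
    qed
    ultimately have "((\<lambda>p. A (\<lambda>x. f (a \<otimes> x)) p - A f p) \<longlongrightarrow> 0) U"
      by (rule Lim_null_comparison[rotated])
    then show "M (\<lambda>x. f (a \<otimes> x)) = M f"
      using tendsto_add[OF _ conv[OF f], of _ 0] by (intro lim) fastforce
  next
    show "M (\<lambda>x. c) = c" for c
      by (rule lim) (simp add: A_def orbit_average_const case_prod_unfold)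
  qed (rule norm_le)
  then show thesis by (rule that)
qed

end

section \<open>Kronecker approximation by characters\<close>

text \<open>Continuity is left out because Kronecker approximation concerns abstract groups; for the
  compact group it is added in \<open>dual\<close>.\<close>

definition character :: "('a, 'm) monoid_scheme \<Rightarrow> ('a \<Rightarrow> complex) \<Rightarrow> bool" where
  "character G \<phi> \<longleftrightarrow> (\<forall>x\<in>carrier G. norm (\<phi> x) = 1) \<and>
     (\<forall>x\<in>carrier G. \<forall>y\<in>carrier G. \<phi> (x \<otimes>\<^bsub>G\<^esub> y) = \<phi> x * \<phi> y)"

lemma norm_character: "character G \<phi> \<Longrightarrow> x \<in> carrier G \<Longrightarrow> norm (\<phi> x) = 1"
  and character_mult: "character G \<phi> \<Longrightarrow> x \<in> carrier G \<Longrightarrow> y \<in> carrier G \<Longrightarrow>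
    \<phi> (x \<otimes>\<^bsub>G\<^esub> y) = \<phi> x * \<phi> y"
  by (auto simp: character_def)

lemma character_one: "character G (\<lambda>x. 1)"
  by (simp add: character_def)

lemma character_times:
  "character G \<phi> \<Longrightarrow> character G \<psi> \<Longrightarrow> character G (\<lambda>x. \<phi> x * \<psi> x)"
  by (simp add: character_def norm_mult)

lemma character_cnj: "character G \<phi> \<Longrightarrow> character G (\<lambda>x. cnj (\<phi> x))"
  by (simp add: character_def)

lemma character_power: "character G \<phi> \<Longrightarrow> character G (\<lambda>x. \<phi> x ^ n)"
  by (simp add: character_def norm_power power_mult_distrib)

lemma character_prod:
  "(\<And>i. i \<in> I \<Longrightarrow> character G (\<phi> i)) \<Longrightarrow> character G (\<lambda>x. \<Prod>i\<in>I. \<phi> i x)"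
  by (simp add: character_def prod.distrib flip: prod_norm)

lemma bounded_on_character: "character G \<phi> \<Longrightarrow> bounded_on (carrier G) \<phi>"
  by (auto simp: character_def intro: bounded_onI[of _ _ 1])

lemma mult_cnj_eq_1: "norm (z::complex) = 1 \<Longrightarrow> z * cnj z = 1"
  by (simp add: complex_norm_square[symmetric])

lemma (in group) character_at_one: "character G \<phi> \<Longrightarrow> \<phi> \<one> = 1"
  using character_mult[of G \<phi> \<one> \<one>] norm_character[of G \<phi> \<one>]
  by (metis l_one mult_cancel_right1 norm_zero one_closed zero_neq_one)

lemma (in group) character_inv: 
  assumes "character G \<phi>" "x \<in> carrier G"
  shows "\<phi> (inv x) = cnj (\<phi> x)"
proof -
  have "\<phi> (inv x) * (\<phi> x * cnj (\<phi> x)) = \<phi> (inv x \<otimes> x) * cnj (\<phi> x)"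
    using assms by (simp only: character_mult inv_closed mult.assoc)
  then show ?thesis
    using assms character_at_one[OF assms(1)]
    by (simp only: mult_cnj_eq_1 norm_character l_inv mult_1_left mult_1_right)
qed

section \<open>Means of complex functions, real functions and characters\<close>

context invariant_mean
begin

lemma mean_cong:
  assumes "bdd_fun f" "\<And>x. x \<in> carrier G \<Longrightarrow> f x = g x"
  shows "M f = M g"
proof -
  have g: "bdd_fun g" using assms unfolding bounded_on_def by metis
  have "M f - M g = M (\<lambda>x. f x + (-1) * g x)"
    using mean_scale[OF g, of "- 1"] assms(1) g
    by (subst mean_add) (auto intro!: bounded_on_intros)
  also have "norm \<dots> \<le> 0" using assms(2) by (intro norm_mean_le) simp
  finally show ?thesis by simp
qed

lemma mean_diff:
  assumes "bdd_fun f" "bdd_fun g"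
  shows "M (\<lambda>x. f x - g x) = M f - M g"
proof -
  have "M (\<lambda>x. - g x) = - M g" using mean_scale[OF assms(2), where c = "- 1"] by simp
  then show ?thesis using mean_add[OF assms(1) bounded_on_uminus[OF assms(2)]] by simp
qed

lemma mean_sum:
  assumes "\<And>i. i \<in> I \<Longrightarrow> bdd_fun (f i)"
  shows "M (\<lambda>x. \<Sum>i\<in>I. f i x) = (\<Sum>i\<in>I. M (f i))"
  using assms
  by (induction I rule: infinite_finite_induct) (auto simp: mean_const mean_add bounded_on_sum)

definition rmean :: "('a \<Rightarrow> real) \<Rightarrow> real" where
  "rmean f = Re (M (\<lambda>x. complex_of_real (f x)))"

lemma mean_of_real:
  assumes "bdd_fun f"
  shows "M (\<lambda>x. complex_of_real (f x)) = of_real (rmean f)"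
  using mean_cnj[OF bounded_on_of_real[OF assms]] by (simp add: rmean_def complex_eq_iff)

lemma rmean_add: "bdd_fun f \<Longrightarrow> bdd_fun g \<Longrightarrow>
    rmean (\<lambda>x. f x + g x) = rmean f + rmean g"
  by (simp add: rmean_def mean_add bounded_on_intros)

lemma rmean_diff: "bdd_fun f \<Longrightarrow> bdd_fun g \<Longrightarrow>
    rmean (\<lambda>x. f x - g x) = rmean f - rmean g"
  by (simp add: rmean_def mean_diff bounded_on_intros)

lemma rmean_scale: "bdd_fun f \<Longrightarrow> rmean (\<lambda>x. c * f x) = c * rmean f"
  by (simp add: rmean_def mean_scale bounded_on_intros)

lemma rmean_const: "rmean (\<lambda>x. c) = c"
  by (simp add: rmean_def mean_const)

lemma rmean_sum: "(\<And>i. i \<in> I \<Longrightarrow> bdd_fun (f i)) \<Longrightarrow>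
    rmean (\<lambda>x. \<Sum>i\<in>I. f i x) = (\<Sum>i\<in>I. rmean (f i))"
  by (simp add: rmean_def mean_sum bounded_on_intros)

lemma rmean_nonneg:
  "bdd_fun f \<Longrightarrow> (\<And>x. x \<in> carrier G \<Longrightarrow> f x \<ge> 0) \<Longrightarrow> rmean f \<ge> 0"
  unfolding rmean_def by (rule Re_mean_nonneg) (auto intro: bounded_on_intros)

lemma rmean_mono:
  assumes "bdd_fun f" "bdd_fun g"
    "\<And>x. x \<in> carrier G \<Longrightarrow> f x \<le> g x"
  shows "rmean f \<le> rmean g"
  using rmean_nonneg[of "\<lambda>x. g x - f x"] assms by (simp add: rmean_diff bounded_on_intros)

lemma rmean_cong:
  "bdd_fun f \<Longrightarrow> (\<And>x. x \<in> carrier G \<Longrightarrow> f x = g x) \<Longrightarrow> rmean f = rmean g"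
  unfolding rmean_def by (metis (mono_tags, lifting) bounded_on_of_real mean_cong)

lemma rmean_translate: "a \<in> carrier G \<Longrightarrow> bdd_fun f \<Longrightarrow>
    rmean (\<lambda>x. f (a \<otimes> x)) = rmean f"
  using mean_translate[of a "\<lambda>x. complex_of_real (f x)"] by (simp add: rmean_def bounded_on_intros)

text \<open>Orthogonality of characters: translation by an \<open>a\<close> with
  \<open>\<phi> a\<close> \<noteq> 1 multiplies the mean by \<open>\<phi> a\<close>, so the mean
  vanishes.\<close>

lemma mean_character:
  assumes "character G \<phi>"
  shows "M \<phi> = (if \<forall>x\<in>carrier G. \<phi> x = 1 then 1 else 0)"
proof (cases "\<forall>x\<in>carrier G. \<phi> x = 1")
  case True
  then show ?thesis
    using mean_cong[of \<phi> "\<lambda>x. 1"] assms by (simp add: mean_const bounded_on_character)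
next
  case False
  then obtain a where a: "a \<in> carrier G" "\<phi> a \<noteq> 1" by blast
  have b: "bdd_fun \<phi>" using assms by (rule bounded_on_character)
  have "M \<phi> = M (\<lambda>x. \<phi> (a \<otimes> x))" using a b by (simp add: mean_translate)
  also have "\<dots> = M (\<lambda>x. \<phi> a * \<phi> x)"
    using a b assms by (intro mean_cong bounded_on_compose[OF b]) (auto simp: character_mult)
  also have "\<dots> = \<phi> a * M \<phi>" using b by (rule mean_scale)
  finally show ?thesis using a False by simp
qed

text \<open>The proof weighs the deviation from the target by a product of Fejer kernels centred at it;
  the relations between the characters make all means of the occurring monomials 0 or 1.\<close>

theorem kronecker_approximation:
  fixes \<phi> :: "'i \<Rightarrow> 'a \<Rightarrow> complex" and z :: "'i \<Rightarrow> complex" and e :: real and N :: nat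
  assumes J: "finite J" and \<phi>: "\<And>j. j \<in> J \<Longrightarrow> character G (\<phi> j)"
    and z: "\<And>j. j \<in> J \<Longrightarrow> norm (z j) = 1"
    and N: "N > 0" "N * e\<^sup>2 > 4 * card J" and e: "e > 0"
    and rel: "\<And>k l. k \<in> J \<rightarrow> {..<N} \<Longrightarrow> l \<in> J \<rightarrow> {..<N} \<Longrightarrow>
        \<forall>x\<in>carrier G. (\<Prod>j\<in>J. \<phi> j x ^ k j * cnj (\<phi> j x) ^ l j) = 1 \<Longrightarrow>
        (\<Prod>j\<in>J. z j ^ k j * cnj (z j) ^ l j) = 1"
  shows "\<exists>x\<in>carrier G. \<forall>j\<in>J. norm (\<phi> j x - z j) < e"
proof (rule ccontr)
  assume "\<not> ?thesis"
  then have far: "\<exists>j\<in>J. norm (\<phi> j x - z j) \<ge> e" if "x \<in> carrier G" for x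
    using that by force
  \<comment> \<open>Dividing by the targets moves them all to 1, where each of the unnormalised
    Fejer kernels in \<open>F\<close> has its peak N^2.\<close>
  define w where "w = (\<lambda>j x. cnj (z j) * \<phi> j x)"
  define m where "m = (\<lambda>j (k, l) x. w j x ^ k * cnj (w j x) ^ l)"
  define F where "F = (\<lambda>I x. \<Prod>i\<in>I. (norm (\<Sum>k<N. w i x ^ k))\<^sup>2)"
  define S where "S = {..<N} \<times> {..<N}"
  have norm_w: "norm (w j x) = 1" if "j \<in> J" "x \<in> carrier G" for j x
    using that z norm_character[OF \<phi>] by (simp add: w_def norm_mult)
  have b_w: "bdd_fun (w j)" if "j \<in> J" for j
    using norm_w[OF that] by (intro bounded_onI[of _ _ 1]) simp
  have b_m: "bdd_fun (m j p)" if "j \<in> J" for j p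
    using b_w[OF that] by (cases p) (auto simp: m_def intro!: bounded_on_intros)
  have b_F: "bdd_fun (F I)" if "I \<subseteq> J" for I
    unfolding F_def using that by (intro bounded_on_intros b_w) auto
  have expand_norm: "of_real ((norm (\<Sum>k<N. w j x ^ k))\<^sup>2) = (\<Sum>p\<in>S. m j p x)" for j x
    unfolding complex_norm_square S_def m_def
    by (simp add: sum_product sum.cartesian_product case_prod_unfold)
  have expand: "of_real (F I x) = (\<Sum>p\<in>Pi\<^sub>E I (\<lambda>_. S). \<Prod>i\<in>I. m i (p i) x)" if "I \<subseteq> J" for I x
    unfolding F_def of_real_prod expand_norm
    using that J by (intro prod_sum_PiE) (auto simp: S_def finite_subset)
  \<comment> \<open>If the character \<psi> of the monomial is trivial, \<open>rel\<close> gives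
    \<open>c\<close> = 1 and the mean is 1; otherwise orthogonality gives 0. That no mean is
    negative permits terms to be dropped from the sums below.\<close>
  have mean_m: "M (\<lambda>x. \<Prod>j\<in>J. m j (p j) x) \<in> {0, 1}" if p: "p \<in> J \<rightarrow> S" for p
  proof -
    define \<psi> where "\<psi> = (\<lambda>x. \<Prod>j\<in>J. \<phi> j x ^ fst (p j) * cnj (\<phi> j x) ^ snd (p j))"
    define c where "c = (\<Prod>j\<in>J. z j ^ fst (p j) * cnj (z j) ^ snd (p j))"
    have \<psi>: "character G \<psi>"
      unfolding \<psi>_def by (intro character_prod character_times character_power character_cnj \<phi>)
    have "(\<Prod>j\<in>J. m j (p j) x) = cnj c * \<psi> x" for x
      unfolding c_def \<psi>_def cnj_prod prod.distrib[symmetric]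
      by (simp add: m_def w_def case_prod_unfold power_mult_distrib mult_ac)
    then have eq: "M (\<lambda>x. \<Prod>j\<in>J. m j (p j) x) = cnj c * M \<psi>"
      using \<psi> by (simp add: mean_scale bounded_on_character)
    show ?thesis
    proof (cases "\<forall>x\<in>carrier G. \<psi> x = 1")
      case True
      have "c = 1"
        unfolding c_def
        using rel[of "\<lambda>j. fst (p j)" "\<lambda>j. snd (p j)"] p True by (fastforce simp: S_def \<psi>_def Pi_iff)
      then show ?thesis using True by (simp add: eq mean_character[OF \<psi>])
    next
      case False
      then show ?thesis by (simp add: eq mean_character[OF \<psi>] del: bex_simps) blast
    qed
  qed
  have mean_m_nonneg: "Re (M (\<lambda>x. \<Prod>j\<in>J. m j (p j) x)) \<ge> 0" if "p \<in> J \<rightarrow> S" for p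
    using mean_m[OF that] by auto
  \<comment> \<open>The lower bound 1 is the contribution of the constant monomial, with all
    exponents 0.\<close>
  have mean_F_pos: "rmean (F J) \<ge> 1"
  proof -
    let ?p0 = "\<lambda>j\<in>J. (0, 0)"
    have fin: "finite (Pi\<^sub>E J (\<lambda>_. S))" using J by (intro finite_PiE) (auto simp: S_def)
    have p0: "?p0 \<in> Pi\<^sub>E J (\<lambda>_. S)" using N(1) by (auto simp: S_def)
    have "rmean (F J) = (\<Sum>p\<in>Pi\<^sub>E J (\<lambda>_. S). Re (M (\<lambda>x. \<Prod>j\<in>J. m j (p j) x)))"
      unfolding rmean_def using b_m by (simp add: expand mean_sum bounded_on_intros)
    also have "\<dots> \<ge> Re (M (\<lambda>x. \<Prod>j\<in>J. m j (?p0 j) x))"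
      using sum_mono2[OF fin, of "{?p0}" "\<lambda>p. Re (M (\<lambda>x. \<Prod>j\<in>J. m j (p j) x))"]
        p0 mean_m_nonneg by (simp add: PiE_iff Pi_iff)
    also have "Re (M (\<lambda>x. \<Prod>j\<in>J. m j (?p0 j) x)) = 1"
      by (simp add: m_def mean_const)
    finally show ?thesis .
  qed
  \<comment> \<open>Of the N^2 monomials in the kernel of \<open>j\<close>, the \<open>N\<close>
    diagonal ones are identically 1 on the carrier; only these are kept.\<close>
  have mean_F_ge: "rmean (F J) \<ge> N * rmean (F (J - {j}))" if j: "j \<in> J" for j
  proof -
    let ?t = "\<lambda>q. Re (M (\<lambda>x. of_real (F (J - {j}) x) * m j q x))"
    have b: "bdd_fun (\<lambda>x. of_real (F (J - {j}) x) * m j q x)" for q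
      using j by (intro bounded_on_intros b_m b_F) auto
    have nonneg: "?t q \<ge> 0" if q: "q \<in> S" for q
    proof -
      have "of_real (F (J - {j}) x) * m j q x
          = (\<Sum>p\<in>Pi\<^sub>E (J - {j}) (\<lambda>_. S). \<Prod>i\<in>J. m i ((p(j := q)) i) x)" for x
      proof -
        have "(\<Prod>i\<in>J. m i ((p(j := q)) i) x) = m j q x * (\<Prod>i\<in>J - {j}. m i (p i) x)" for p
          using j J by (subst prod.remove[of _ j]) (auto intro!: prod.cong arg_cong2[of _ _ _ _ "(*)"])
        then show ?thesis by (simp add: expand sum_distrib_left mult.commute)
      qed
      then have "?t q = (\<Sum>p\<in>Pi\<^sub>E (J - {j}) (\<lambda>_. S). Re (M (\<lambda>x. \<Prod>i\<in>J. m i ((p(j := q)) i) x)))"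
        using b_m by (simp add: mean_sum bounded_on_intros)
      also have "\<dots> \<ge> 0"
      proof (rule sum_nonneg)
        fix p assume "p \<in> Pi\<^sub>E (J - {j}) (\<lambda>_. S)"
        then have "p(j := q) \<in> J \<rightarrow> S" using q by (simp add: PiE_iff Pi_iff)
        then show "Re (M (\<lambda>x. \<Prod>i\<in>J. m i ((p(j := q)) i) x)) \<ge> 0" by (rule mean_m_nonneg)
      qed
      finally show ?thesis .
    qed
    have diag: "?t (k, k) = rmean (F (J - {j}))" for k
    proof -
      have "m j (k, k) x = 1" if "x \<in> carrier G" for x
        using norm_w[OF j that] by (simp add: m_def mult_cnj_eq_1 flip: power_mult_distrib)
      then show ?thesis unfolding rmean_def using b by (intro arg_cong[of _ _ Re] mean_cong) auto
    qed
    have "F J x = F (J - {j}) x * (norm (\<Sum>k<N. w j x ^ k))\<^sup>2" for x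
      unfolding F_def using j J by (subst prod.remove[of _ j]) (simp_all add: mult.commute)
    then have "of_real (F J x) = (\<Sum>q\<in>S. of_real (F (J - {j}) x) * m j q x)" for x
      by (simp add: expand_norm sum_distrib_left del: of_real_power)
    then have "rmean (F J) = (\<Sum>q\<in>S. ?t q)"
      unfolding rmean_def using b by (simp add: mean_sum)
    also have "\<dots> \<ge> (\<Sum>q\<in>(\<lambda>k. (k, k)) ` {..<N}. ?t q)"
      using nonneg by (intro sum_mono2) (auto simp: S_def)
    also have "(\<Sum>q\<in>(\<lambda>k. (k, k)) ` {..<N}. ?t q) = N * rmean (F (J - {j}))"
      by (subst sum.reindex) (auto simp: inj_on_def diag)
    finally show ?thesis .
  qed
  \<comment> \<open>The factor 1 - w collapses the geometric sum to 1 - w^N, which has norm at most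
    2; its square is the 4 in the hypothesis on \<open>N\<close>.\<close>
  have bound: "F J x * (norm (1 - w j x))\<^sup>2 \<le> 4 * F (J - {j}) x"
    if "j \<in> J" "x \<in> carrier G" for j x
  proof -
    have "F J x * (norm (1 - w j x))\<^sup>2 = F (J - {j}) x * (norm ((1 - w j x) * (\<Sum>k<N. w j x ^ k)))\<^sup>2"
      unfolding F_def using that J
      by (subst prod.remove[of _ j]) (simp_all add: norm_mult power_mult_distrib mult_ac)
    also have "(1 - w j x) * (\<Sum>k<N. w j x ^ k) = 1 - w j x ^ N"
      by (simp add: one_diff_power_eq)
    also have "F (J - {j}) x * (norm (1 - w j x ^ N))\<^sup>2 \<le> F (J - {j}) x * 2\<^sup>2"
    proof (intro mult_left_mono power_mono)
      show "norm (1 - w j x ^ N) \<le> 2"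
        using norm_triangle_ineq4[of 1 "w j x ^ N"] norm_w[OF that] by (simp add: norm_power)
    qed (auto simp: F_def prod_nonneg)
    finally show ?thesis by simp
  qed
  \<comment> \<open>At every point the far index \<open>j\<close> bounds e^2 F(J) by 4 F(J - {j}),
    while in the mean removing a kernel costs at least a factor \<open>N\<close>. Together this
    gives N e^2 \<le> 4 card J.\<close>
  have "e\<^sup>2 * rmean (F J) = rmean (\<lambda>x. e\<^sup>2 * F J x)" by (simp add: rmean_scale b_F)
  also have "\<dots> \<le> rmean (\<lambda>x. \<Sum>j\<in>J. 4 * F (J - {j}) x)"
  proof (rule rmean_mono)
    fix x assume x: "x \<in> carrier G"
    obtain j where j: "j \<in> J" "norm (\<phi> j x - z j) \<ge> e" using far[OF x] by blast
    have "\<phi> j x - z j = - z j * (1 - w j x)"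
      using z[OF j(1)] by (simp add: w_def algebra_simps mult_cnj_eq_1 flip: mult.assoc)
    then have "norm (1 - w j x) \<ge> e" using j z[OF j(1)] by (simp add: norm_mult)
    then have "e\<^sup>2 * F J x \<le> F J x * (norm (1 - w j x))\<^sup>2"
      using e by (subst mult.commute, intro mult_left_mono power_mono) (auto simp: F_def prod_nonneg)
    also have "\<dots> \<le> 4 * F (J - {j}) x" using bound j(1) x by blast
    also have "\<dots> \<le> (\<Sum>j\<in>J. 4 * F (J - {j}) x)"
      using J j(1) by (intro member_le_sum) (auto simp: F_def prod_nonneg)
    finally show "e\<^sup>2 * F J x \<le> (\<Sum>j\<in>J. 4 * F (J - {j}) x)" .
  qed (intro bounded_on_intros b_F; simp)+
  also have "\<dots> = (\<Sum>j\<in>J. 4 * rmean (F (J - {j})))"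
    by (subst rmean_sum) (auto simp: rmean_scale b_F intro!: bounded_on_intros b_F)
  also have "\<dots> \<le> (\<Sum>j\<in>J. 4 * (rmean (F J) / N))"
    using mean_F_ge N(1) by (intro sum_mono) (simp add: field_simps)
  finally have "N * e\<^sup>2 * rmean (F J) \<le> 4 * card J * rmean (F J)"
    using N(1) by (simp add: field_simps)
  then show False using mean_F_pos N(2) by (simp add: mult_le_cancel_right)
qed

section \<open>Continuous characters of compact abelian groups\<close>

lemma bounded_on_translate:
  "bdd_fun f \<Longrightarrow> a \<in> carrier G \<Longrightarrow> bdd_fun (\<lambda>x. f (a \<otimes> x))"
  by (rule bounded_on_compose) auto

text \<open>Multiplying \<open>f\<close> by the phase \<open>d\<close> that makes the mean real and
  nonnegative reduces the claim to the positivity of the mean of |f| - Re (d f).\<close>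

lemma norm_mean_le_rmean:
  assumes f: "bdd_fun f"
  shows "norm (M f) \<le> rmean (\<lambda>x. norm (f x))"
proof (cases "M f = 0")
  case False
  define d where "d = cnj (sgn (M f))"
  have "norm d = 1" using False by (simp add: d_def norm_sgn)
  have "M (\<lambda>x. d * f x) = d * M f" using f by (rule mean_scale)
  also have "\<dots> = of_real (norm (M f))"
    using False by (simp add: d_def sgn_eq complex_norm_square[symmetric] power2_eq_square mult.commute)
  finally have *: "Re (M (\<lambda>x. d * f x)) = norm (M f)" by simp
  have "Re (M (\<lambda>x. of_real (norm (f x)) - d * f x)) \<ge> 0"
  proof (rule Re_mean_nonneg)
    fix x
    have "Re (d * f x) \<le> norm (d * f x)" by (rule complex_Re_le_cmod)
    then show "Re (of_real (norm (f x)) - d * f x) \<ge> 0" using \<open>norm d = 1\<close> by (simp add: norm_mult)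
  qed (intro bounded_on_intros f)
  also have "M (\<lambda>x. of_real (norm (f x)) - d * f x)
      = M (\<lambda>x. of_real (norm (f x))) - M (\<lambda>x. d * f x)"
    by (intro mean_diff bounded_on_intros f)
  finally show ?thesis using * by (simp add: rmean_def)
qed (use f in \<open>auto intro!: rmean_nonneg bounded_on_intros\<close>)

text \<open>The matrix coefficient of the translation action at the vector \<open>F\<close>, a
  function of positive type. If \<open>F\<close> has Fourier coefficients F_\<phi>, it is formally
  the sum of the functions |F_\<phi>|^2 \<phi>.\<close>

definition coefficient :: "('a \<Rightarrow> complex) \<Rightarrow> 'a \<Rightarrow> complex" where
  "coefficient F x = M (\<lambda>z. F (x \<otimes> z) * cnj (F z))"

definition convolution :: "('a \<Rightarrow> complex) \<Rightarrow> ('a \<Rightarrow> complex) \<Rightarrow> 'a \<Rightarrow> complex" where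
  "convolution \<kappa> h x = M (\<lambda>y. \<kappa> (x \<otimes> inv y) * h y)"

definition energy :: "('a \<Rightarrow> complex) \<Rightarrow> real" where
  "energy k = rmean (\<lambda>x. (norm (k x))\<^sup>2)"

lemma energy_nonneg: "bdd_fun k \<Longrightarrow> energy k \<ge> 0"
  unfolding energy_def by (intro rmean_nonneg bounded_on_intros) auto

lemma energy_cong:
  "bdd_fun f \<Longrightarrow> (\<And>x. x \<in> carrier G \<Longrightarrow> f x = g x) \<Longrightarrow> energy f = energy g"
  unfolding energy_def by (rule rmean_cong) (auto intro: bounded_on_intros)

lemma energy_scale: "bdd_fun k \<Longrightarrow> energy (\<lambda>x. c * k x) = (norm c)\<^sup>2 * energy k"
  by (simp add: energy_def norm_mult power_mult_distrib rmean_scale bounded_on_intros)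

lemma energy_le:
  assumes "\<And>x. x \<in> carrier G \<Longrightarrow> norm (k x) \<le> B"
  shows "energy k \<le> B\<^sup>2"
proof -
  have "energy k \<le> rmean (\<lambda>x. B\<^sup>2)"
    unfolding energy_def using assms
    by (intro rmean_mono bounded_on_intros bounded_onI[of _ _ B] power_mono) auto
  then show ?thesis by (simp add: rmean_const)
qed

lemma coefficient_at_one: 
  assumes "bdd_fun F"
  shows "coefficient F \<one> = of_real (energy F)"
proof -
  have "coefficient F \<one> = M (\<lambda>z. of_real ((norm (F z))\<^sup>2))"
    unfolding coefficient_def using assms
    by (intro mean_cong bounded_on_intros bounded_on_translate) (auto simp: complex_norm_square simp del: of_real_power)
  also have "\<dots> = of_real (energy F)"
    unfolding energy_def using assms by (intro mean_of_real bounded_on_intros)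
  finally show ?thesis .
qed

text \<open>Cauchy-Schwarz in the form |u v| \<le> (|u|^2 + |v|^2) / 2; translation invariance gives
  both squares the same mean.\<close>

lemma norm_coefficient_le:
  assumes F: "bdd_fun F" and x: "x \<in> carrier G"
  shows "norm (coefficient F x) \<le> energy F"
proof -
  note b = bounded_on_intros bounded_on_translate F x
  have "norm (coefficient F x) \<le> rmean (\<lambda>z. norm (F (x \<otimes> z) * cnj (F z)))"
    unfolding coefficient_def by (intro norm_mean_le_rmean b)
  also have "\<dots> \<le> rmean (\<lambda>z. (1/2) * ((norm (F (x \<otimes> z)))\<^sup>2 + (norm (F z))\<^sup>2))"
  proof (rule rmean_mono)
    fix z
    have "0 \<le> (norm (F (x \<otimes> z)) - norm (F z))\<^sup>2" by simp
    then show "norm (F (x \<otimes> z) * cnj (F z)) \<le> (1/2) * ((norm (F (x \<otimes> z)))\<^sup>2 + (norm (F z))\<^sup>2)"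
      by (simp add: norm_mult power2_diff field_simps)
  qed (intro b)+
  also have "\<dots> = (1/2) * (rmean (\<lambda>z. (norm (F (x \<otimes> z)))\<^sup>2) + energy F)"
    unfolding energy_def by (subst rmean_scale, intro b, subst rmean_add) (auto intro!: b)
  also have "rmean (\<lambda>z. (norm (F (x \<otimes> z)))\<^sup>2) = energy F"
    unfolding energy_def using x by (rule rmean_translate) (intro b)
  finally show ?thesis by simp
qed

lemma bounded_on_coefficient:
  "bdd_fun F \<Longrightarrow> bdd_fun (coefficient F)"
  by (rule bounded_onI[of _ _ "energy F"]) (rule norm_coefficient_le)

lemma coefficient_inv:
  assumes F: "bdd_fun F" and a: "a \<in> carrier G"
  shows "coefficient F (inv a) = cnj (coefficient F a)"
proof -
  note b = bounded_on_intros bounded_on_translate F a inv_closed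
  have "coefficient F (inv a) = M (\<lambda>z. F (inv a \<otimes> (a \<otimes> z)) * cnj (F (a \<otimes> z)))"
    unfolding coefficient_def
    by (rule mean_translate[symmetric]) (use a in \<open>auto intro!: b\<close>)
  also have "\<dots> = M (\<lambda>z. cnj (F (a \<otimes> z) * cnj (F z)))"
  proof (rule mean_cong)
    show "bdd_fun (\<lambda>z. F (inv a \<otimes> (a \<otimes> z)) * cnj (F (a \<otimes> z)))"
      by (rule bounded_on_translate[of "\<lambda>z. F (inv a \<otimes> z) * cnj (F z)"]) (use a in \<open>auto intro!: b\<close>)
  qed (use a in \<open>simp add: m_assoc[symmetric] mult.commute\<close>)
  also have "\<dots> = cnj (coefficient F a)"
    unfolding coefficient_def by (intro mean_cnj b)
  finally show ?thesis .
qed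

lemma coefficient_scale:
  assumes "bdd_fun F" "x \<in> carrier G"
  shows "coefficient (\<lambda>z. c * F z) x = of_real ((norm c)\<^sup>2) * coefficient F x"
proof -
  have "(\<lambda>z. c * F (x \<otimes> z) * cnj (c * F z)) = (\<lambda>z. of_real ((norm c)\<^sup>2) * (F (x \<otimes> z) * cnj (F z)))"
    unfolding complex_norm_square by (simp add: fun_eq_iff mult_ac)
  then show ?thesis
    unfolding coefficient_def using assms
    by (simp only: mean_scale bounded_on_intros bounded_on_translate)
qed

text \<open>On the spectrum, passing from \<open>F\<close> to F + c F(a .) multiplies the weight of
  a character \<phi> by |1 + c \<phi>(a)|^2 = 2 + 2 Re (c \<phi>(a)). The proof obtains this
  identity from translation invariance alone.\<close>

lemma coefficient_superposition:
  assumes F: "bdd_fun F" and a: "a \<in> carrier G" and x: "x \<in> carrier G"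
    and c: "norm c = 1"
  shows "coefficient (\<lambda>z. F z + c * F (a \<otimes> z)) x
    = 2 * coefficient F x + (c * coefficient F (a \<otimes> x) + cnj c * coefficient F (inv a \<otimes> x))"
proof -
  note b = bounded_on_intros bounded_on_translate F a x m_closed inv_closed
  have 1: "M (\<lambda>z. F (a \<otimes> (x \<otimes> z)) * cnj (F z)) = coefficient F (a \<otimes> x)"
    unfolding coefficient_def using a x
    by (intro mean_cong) (auto simp: m_assoc intro!: b bounded_on_translate[of "\<lambda>z. F (a \<otimes> z)"])
  have 2: "M (\<lambda>z. F (x \<otimes> z) * cnj (F (a \<otimes> z))) = coefficient F (inv a \<otimes> x)"
  proof -
    have "coefficient F (inv a \<otimes> x) = M (\<lambda>z. F (inv a \<otimes> x \<otimes> (a \<otimes> z)) * cnj (F (a \<otimes> z)))"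
      unfolding coefficient_def
      by (rule mean_translate[symmetric]) (use a in \<open>auto intro!: b\<close>)
    also have "\<dots> = M (\<lambda>z. F (x \<otimes> z) * cnj (F (a \<otimes> z)))"
    proof (rule mean_cong)
      show "bdd_fun (\<lambda>z. F (inv a \<otimes> x \<otimes> (a \<otimes> z)) * cnj (F (a \<otimes> z)))"
        by (rule bounded_on_translate[of "\<lambda>z. F (inv a \<otimes> x \<otimes> z) * cnj (F z)"]) (use a in \<open>auto intro!: b\<close>)
      fix z assume z: "z \<in> carrier G"
      have "inv a \<otimes> x \<otimes> (a \<otimes> z) = inv a \<otimes> (a \<otimes> (x \<otimes> z))"
        using a x z by (simp add: m_assoc m_lcomm)
      also have "\<dots> = x \<otimes> z" using a x z by (simp add: m_assoc[symmetric])
      finally show "F (inv a \<otimes> x \<otimes> (a \<otimes> z)) * cnj (F (a \<otimes> z)) = F (x \<otimes> z) * cnj (F (a \<otimes> z))"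
        by simp
    qed
    finally show ?thesis by simp
  qed
  have 3: "M (\<lambda>z. F (a \<otimes> (x \<otimes> z)) * cnj (F (a \<otimes> z))) = coefficient F x"
  proof -
    have "coefficient F x = M (\<lambda>z. F (x \<otimes> (a \<otimes> z)) * cnj (F (a \<otimes> z)))"
      unfolding coefficient_def
      by (rule mean_translate[symmetric]) (use a in \<open>auto intro!: b\<close>)
    also have "\<dots> = M (\<lambda>z. F (a \<otimes> (x \<otimes> z)) * cnj (F (a \<otimes> z)))"
      using a x by (intro mean_cong bounded_on_translate[of "\<lambda>z. F (x \<otimes> z) * cnj (F z)"])
        (auto simp: m_lcomm intro!: b)
    finally show ?thesis by simp
  qed
  have cc: "c * cnj c = 1" using c by (rule mult_cnj_eq_1)
  have bt: "bdd_fun (\<lambda>z. F (a \<otimes> (x \<otimes> z)))"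
    by (rule bounded_on_translate[of "\<lambda>z. F (a \<otimes> z)"]) (intro b)+
  have prod: "(F (x \<otimes> z) + c * F (a \<otimes> (x \<otimes> z))) * cnj (F z + c * F (a \<otimes> z))
      = F (x \<otimes> z) * cnj (F z) + F (a \<otimes> (x \<otimes> z)) * cnj (F (a \<otimes> z))
      + (c * (F (a \<otimes> (x \<otimes> z)) * cnj (F z)) + cnj c * (F (x \<otimes> z) * cnj (F (a \<otimes> z))))" for z
  proof -
    have "c * u * (cnj c * v) = u * v" for u v using cc by (metis mult.commute mult.left_commute mult_1)
    then show ?thesis by (simp add: algebra_simps)
  qed
  have "coefficient (\<lambda>z. F z + c * F (a \<otimes> z)) x
      = coefficient F x + coefficient F x + (c * coefficient F (a \<otimes> x) + cnj c * coefficient F (inv a \<otimes> x))"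
    unfolding coefficient_def[of "\<lambda>z. F z + c * F (a \<otimes> z)"] prod 1[symmetric] 2[symmetric]
    unfolding coefficient_def[of F x]
    by (subst (1) 3[unfolded coefficient_def, symmetric])
      (simp add: mean_add mean_scale b bt)
  then show ?thesis by simp
qed

lemma bounded_on_kernel:
  "bdd_fun \<kappa> \<Longrightarrow> x \<in> carrier G \<Longrightarrow> bdd_fun (\<lambda>y. \<kappa> (x \<otimes> inv y))"
  by (rule bounded_on_compose) auto

lemma convolution_add:
  assumes "bdd_fun \<kappa>" "bdd_fun h" "bdd_fun h'"
    "x \<in> carrier G"
  shows "convolution \<kappa> (\<lambda>y. h y + h' y) x = convolution \<kappa> h x + convolution \<kappa> h' x"
  unfolding convolution_def distrib_left
  using assms by (intro mean_add bounded_on_intros bounded_on_kernel)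

lemma convolution_scale:
  assumes "bdd_fun \<kappa>" "bdd_fun h" "x \<in> carrier G"
  shows "convolution \<kappa> (\<lambda>y. c * h y) x = c * convolution \<kappa> h x"
  unfolding convolution_def mult.left_commute[of _ c]
  using assms by (intro mean_scale bounded_on_intros bounded_on_kernel)

lemma convolution_diff_kernel:
  assumes "bdd_fun \<kappa>" "bdd_fun \<kappa>'" "bdd_fun h"
    "x \<in> carrier G"
  shows "convolution (\<lambda>y. \<kappa> y - \<kappa>' y) h x = convolution \<kappa> h x - convolution \<kappa>' h x"
  unfolding convolution_def left_diff_distrib
  using assms by (intro mean_diff bounded_on_intros bounded_on_kernel)

lemma convolution_translate_kernel:
  assumes "bdd_fun \<kappa>" "bdd_fun h" "x \<in> carrier G" "a \<in> carrier G"
  shows "convolution (\<lambda>y. \<kappa> (a \<otimes> y)) h x = convolution \<kappa> h (a \<otimes> x)"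
  unfolding convolution_def
  using assms by (intro mean_cong bounded_on_intros bounded_on_kernel[of "\<lambda>y. \<kappa> (a \<otimes> y)"] bounded_on_translate)
    (auto simp: m_assoc)

lemma convolution_translate:
  assumes \<kappa>: "bdd_fun \<kappa>" and h: "bdd_fun h"
    and x: "x \<in> carrier G" and a: "a \<in> carrier G"
  shows "convolution \<kappa> (\<lambda>y. h (a \<otimes> y)) x = convolution \<kappa> h (a \<otimes> x)"
proof -
  have b: "bdd_fun (\<lambda>y. \<kappa> (a \<otimes> x \<otimes> inv y) * h y)"
    using assms by (intro bounded_on_intros bounded_on_kernel) auto
  have "convolution \<kappa> h (a \<otimes> x) = M (\<lambda>y. \<kappa> (a \<otimes> x \<otimes> inv (a \<otimes> y)) * h (a \<otimes> y))"
    unfolding convolution_def using a b by (rule mean_translate[symmetric])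
  also have "\<dots> = M (\<lambda>y. \<kappa> (x \<otimes> inv y) * h (a \<otimes> y))"
  proof (rule mean_cong[OF bounded_on_translate[OF b a]])
    fix y assume y: "y \<in> carrier G"
    have "a \<otimes> x \<otimes> inv (a \<otimes> y) = (a \<otimes> inv a) \<otimes> (x \<otimes> inv y)"
      using a x y by (simp only: inv_mult m_assoc m_lcomm m_closed inv_closed)
    also have "\<dots> = x \<otimes> inv y" using a x y by simp
    finally show "\<kappa> (a \<otimes> x \<otimes> inv (a \<otimes> y)) * h (a \<otimes> y) = \<kappa> (x \<otimes> inv y) * h (a \<otimes> y)" by simp
  qed
  finally show ?thesis by (simp add: convolution_def)
qed

lemma norm_convolution_le:
  assumes "\<And>y. y \<in> carrier G \<Longrightarrow> norm (\<kappa> y) \<le> B" "\<And>y. y \<in> carrier G \<Longrightarrow> norm (h y) \<le> C"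
    "x \<in> carrier G"
  shows "norm (convolution \<kappa> h x) \<le> B * C"
proof -
  have "0 \<le> B" using order.trans[OF norm_ge_zero assms(1)[OF one_closed]] .
  then show ?thesis unfolding convolution_def
    using assms by (intro norm_mean_le) (auto simp: norm_mult intro!: mult_mono)
qed

lemma bounded_on_convolution:
  "bdd_fun \<kappa> \<Longrightarrow> bdd_fun h \<Longrightarrow> bdd_fun (convolution \<kappa> h)"
  by (elim bounded_onE) (rule bounded_onI, rule norm_convolution_le)

section \<open>The variational problem and its almost maximisers\<close>

definition max_energy :: "('a \<Rightarrow> complex) \<Rightarrow> real" where
  "max_energy \<kappa> = Sup {energy (convolution \<kappa> (coefficient F)) | F. bdd_fun F \<and> energy F = 1}"

lemma energy_le_max:
  assumes \<kappa>: "bdd_fun \<kappa>" and F: "bdd_fun F" "energy F = 1"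
  shows "energy (convolution \<kappa> (coefficient F)) \<le> max_energy \<kappa>"
  unfolding max_energy_def
proof (rule cSup_upper)
  obtain B where B: "\<And>y. y \<in> carrier G \<Longrightarrow> norm (\<kappa> y) \<le> B" using \<kappa> by (metis bounded_onE)
  show "bdd_above {energy (convolution \<kappa> (coefficient F)) | F. bdd_fun F \<and> energy F = 1}"
  proof (rule bdd_aboveI)
    fix e assume "e \<in> {energy (convolution \<kappa> (coefficient F)) | F. bdd_fun F \<and> energy F = 1}"
    then obtain F where F: "bdd_fun F" "energy F = 1" "e = energy (convolution \<kappa> (coefficient F))"
      by blast
    have "norm (convolution \<kappa> (coefficient F) x) \<le> B * 1" if "x \<in> carrier G" for x
      using B norm_coefficient_le[OF F(1)] F(2) that by (intro norm_convolution_le) auto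
    then show "e \<le> B\<^sup>2" unfolding F(3) by (intro energy_le) simp
  qed
qed (use F in blast)

text \<open>Multiplying \<open>F\<close> by \<open>c\<close> multiplies \<open>coefficient F\<close>
  by |c|^2, hence the energy of the convolution by |c|^4; this explains the square of
  \<open>energy F\<close>. For energy 0 the coefficient vanishes on the carrier.\<close>

lemma energy_le_max_scaled:
  assumes \<kappa>: "bdd_fun \<kappa>" and F: "bdd_fun F"
  shows "energy (convolution \<kappa> (coefficient F)) \<le> (energy F)\<^sup>2 * max_energy \<kappa>"
proof (cases "energy F = 0")
  case True
  obtain B where B: "\<And>y. y \<in> carrier G \<Longrightarrow> norm (\<kappa> y) \<le> B" using \<kappa> by (metis bounded_onE)
  have "norm (convolution \<kappa> (coefficient F) x) \<le> B * 0" if "x \<in> carrier G" for x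
    using B norm_coefficient_le[OF F] True that by (intro norm_convolution_le) auto
  then have "energy (convolution \<kappa> (coefficient F)) \<le> 0\<^sup>2" by (intro energy_le) simp
  then show ?thesis by (simp add: True)
next
  case False
  then have pos: "energy F > 0" using energy_nonneg[OF F] by simp
  define c where "c = complex_of_real (1 / sqrt (energy F))"
  have c: "(norm c)\<^sup>2 = 1 / energy F" using pos by (simp add: c_def norm_divide power_divide)
  have cF: "bdd_fun (\<lambda>z. c * F z)" using F by (intro bounded_on_intros)
  have "energy (\<lambda>z. c * F z) = 1" using F pos by (simp add: energy_scale c)
  then have "energy (convolution \<kappa> (coefficient (\<lambda>z. c * F z))) \<le> max_energy \<kappa>"
    using \<kappa> cF by (intro energy_le_max)
  also have "energy (convolution \<kappa> (coefficient (\<lambda>z. c * F z)))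
      = energy (\<lambda>x. of_real (1 / energy F) * convolution \<kappa> (coefficient F) x)"
  proof (rule energy_cong)
    fix x assume x: "x \<in> carrier G"
    have "convolution \<kappa> (coefficient (\<lambda>z. c * F z)) x
        = convolution \<kappa> (\<lambda>y. of_real (1 / energy F) * coefficient F y) x"
      unfolding convolution_def
      by (rule mean_cong)
        (use x F c in \<open>auto simp: coefficient_scale intro!: bounded_on_intros bounded_on_kernel \<kappa> bounded_on_coefficient\<close>)
    also have "\<dots> = of_real (1 / energy F) * convolution \<kappa> (coefficient F) x"
      using \<kappa> F x by (intro convolution_scale bounded_on_coefficient)
    finally show "convolution \<kappa> (coefficient (\<lambda>z. c * F z)) x
        = of_real (1 / energy F) * convolution \<kappa> (coefficient F) x" .
  qed (intro bounded_on_convolution \<kappa> bounded_on_coefficient cF)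
  also have "\<dots> = (1 / energy F)\<^sup>2 * energy (convolution \<kappa> (coefficient F))"
    using energy_scale[OF bounded_on_convolution[OF \<kappa> bounded_on_coefficient[OF F]], of "of_real (1 / energy F)"] pos
    by (simp add: norm_divide)
  finally show ?thesis using pos by (simp add: power_divide divide_simps mult.commute)
qed

text \<open>Spectrally, \<open>convolution \<kappa> (coefficient F)\<close> has the coefficients \<open>\<kappa>\<^sub>\<phi> \<mu>\<^sub>\<phi>\<close>, where
  \<open>\<mu>\<close> is the probability distribution of the energy of \<open>F\<close> over the characters \<open>\<phi>\<close>. The energy is
  a convex function of \<open>\<mu>\<close>, so that it is almost maximal only if \<open>\<mu>\<close> almost is a point mass, that is,
  if \<open>coefficient F\<close> almost is a character. Convexity is applied to the decompositions of \<open>\<mu>\<close>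
  that come from \<open>F \<plusminus> c F(a \<cdot>)\<close>.\<close>

lemma energy_defect_real:
  assumes \<kappa>: "bdd_fun \<kappa>" and F: "bdd_fun F" "energy F = 1"
    and a: "a \<in> carrier G" and c: "norm c = 1"
  defines "k \<equiv> convolution \<kappa> (coefficient F)"
  shows "energy (\<lambda>x. (c * k (a \<otimes> x) + cnj c * k (inv a \<otimes> x)) / 2 - of_real (Re (c * coefficient F a)) * k x)
    \<le> max_energy \<kappa> - energy k"
proof -
  define b where "b = (\<lambda>x. (c * k (a \<otimes> x) + cnj c * k (inv a \<otimes> x)) / 2)"
  define s where "s = Re (c * coefficient F a)"
  have bh: "bdd_fun (coefficient F)" using F(1) by (rule bounded_on_coefficient)
  have bk: "bdd_fun k" unfolding k_def using \<kappa> bh by (rule bounded_on_convolution)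
  have bb: "bdd_fun b"
    unfolding b_def divide_inverse using a by (intro bounded_on_intros bounded_on_translate bk) auto
  have s: "- 1 \<le> s" "s \<le> 1"
  proof -
    have "\<bar>s\<bar> \<le> norm (c * coefficient F a)" unfolding s_def by (rule abs_Re_le_cmod)
    also have "\<dots> \<le> 1" using norm_coefficient_le[OF F(1) a] F(2) c by (simp add: norm_mult)
    finally show "- 1 \<le> s" "s \<le> 1" by auto
  qed
  \<comment> \<open>The vector F \<plusminus> c F(a .) has energy 2 (1 \<plusminus> s) and yields
    the convolution 2 (k \<plusminus> b); the common factor 4 cancels.\<close>
  have super: "energy (\<lambda>x. k x + of_real e * b x) \<le> (1 + e * s)\<^sup>2 * max_energy \<kappa>"
    if e: "e = 1 \<or> e = - 1" for e :: real
  proof -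
    define d where "d = of_real e * c"
    have d: "norm d = 1" using e c by (auto simp: d_def norm_mult)
    define F' where "F' = (\<lambda>z. F z + d * F (a \<otimes> z))"
    have F': "bdd_fun F'"
      unfolding F'_def by (intro bounded_on_intros bounded_on_translate F a)
    have coef: "coefficient F' x
        = 2 * coefficient F x + (d * coefficient F (a \<otimes> x) + cnj d * coefficient F (inv a \<otimes> x))"
      if "x \<in> carrier G" for x
      unfolding F'_def using F(1) a that d by (rule coefficient_superposition)
    have "complex_of_real (energy F') = 2 + (d * coefficient F a + cnj (d * coefficient F a))"
      using coef[of \<one>] a F by (simp add: coefficient_at_one F' coefficient_inv)
    also have "\<dots> = of_real (2 * (1 + e * s))"
      by (subst complex_add_cnj) (simp add: d_def s_def algebra_simps)
    finally have E: "energy F' = 2 * (1 + e * s)" by (simp only: of_real_eq_iff)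
    have conv: "convolution \<kappa> (coefficient F') x = 2 * (k x + of_real e * b x)" if x: "x \<in> carrier G" for x
    proof -
      have "convolution \<kappa> (coefficient F') x = convolution \<kappa> (\<lambda>x. 2 * coefficient F x
          + (d * coefficient F (a \<otimes> x) + cnj d * coefficient F (inv a \<otimes> x))) x"
        unfolding convolution_def using x F'
        by (intro mean_cong bounded_on_intros bounded_on_kernel \<kappa> bounded_on_coefficient)
          (simp_all add: coef)
      also have "\<dots> = 2 * k x + (d * k (a \<otimes> x) + cnj d * k (inv a \<otimes> x))"
        unfolding k_def using a x
        by (simp add: convolution_add convolution_scale convolution_translate bounded_on_intros
            bounded_on_translate \<kappa> bh)
      finally show ?thesis by (simp add: b_def d_def algebra_simps)
    qed
    have "4 * energy (\<lambda>x. k x + of_real e * b x) = energy (\<lambda>x. 2 * (k x + of_real e * b x))"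
      by (subst energy_scale) (simp_all add: bounded_on_intros bk bb)
    also have "\<dots> = energy (convolution \<kappa> (coefficient F'))"
      by (rule energy_cong) (auto simp: conv intro!: bounded_on_intros bk bb)
    also have "\<dots> \<le> (energy F')\<^sup>2 * max_energy \<kappa>" using \<kappa> F' by (rule energy_le_max_scaled)
    also have "\<dots> = 4 * ((1 + e * s)\<^sup>2 * max_energy \<kappa>)" unfolding E by (simp only: power_mult_distrib) simp
    finally show ?thesis by simp
  qed
  \<comment> \<open>The weights 1 - s and 1 + s make the mixed terms complete the square of b - s k,
    and make the two bounds of \<open>super\<close> add up to 2 (1 - s^2)
    \<open>max_energy \<kappa>\<close>.\<close>
  have parallelogram: "2 * (norm (b x - of_real s * k x))\<^sup>2 = (1 - s) * (norm (k x + of_real 1 * b x))\<^sup>2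
      + (1 + s) * (norm (k x + of_real (- 1) * b x))\<^sup>2 - 2 * (1 - s\<^sup>2) * (norm (k x))\<^sup>2" for x
    by (simp only: cmod_power2) (simp add: power2_eq_square algebra_simps)
  have "2 * energy (\<lambda>x. b x - of_real s * k x) = rmean (\<lambda>x. 2 * (norm (b x - of_real s * k x))\<^sup>2)"
    unfolding energy_def by (intro rmean_scale[symmetric] bounded_on_intros bb bk)
  also have "\<dots> = (1 - s) * energy (\<lambda>x. k x + of_real 1 * b x)
      + (1 + s) * energy (\<lambda>x. k x + of_real (- 1) * b x) - 2 * (1 - s\<^sup>2) * energy k"
    unfolding energy_def parallelogram
    by (subst rmean_diff, (intro bounded_on_intros bb bk)+, subst rmean_add, (intro bounded_on_intros bb bk)+,
        (subst rmean_scale, (intro bounded_on_intros bb bk)+)+) simp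
  also have "\<dots> \<le> (1 - s) * ((1 + 1 * s)\<^sup>2 * max_energy \<kappa>) + (1 + s) * ((1 + - 1 * s)\<^sup>2 * max_energy \<kappa>)
      - 2 * (1 - s\<^sup>2) * energy k"
    using s super[of 1] super[of "- 1"] by (intro diff_right_mono add_mono mult_left_mono) auto
  also have "\<dots> = 2 * (1 - s\<^sup>2) * (max_energy \<kappa> - energy k)"
    by (simp add: power2_eq_square algebra_simps)
  also have "\<dots> \<le> 2 * 1 * (max_energy \<kappa> - energy k)"
    unfolding k_def using energy_le_max[OF \<kappa> F] by (intro mult_right_mono mult_left_mono) auto
  finally show ?thesis by (simp add: b_def s_def)
qed

text \<open>The complex translate is recovered from the phases 1 and \<open>\<i>\<close>: the defect
  equals \<open>p 1 x - \<i> * p \<i> x\<close>. The factor 4 comes from |u - i v|^2 \<le> 2 |u|^2 +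
  2 |v|^2, applied to two real defects.\<close>

lemma energy_defect:
  assumes \<kappa>: "bdd_fun \<kappa>" and F: "bdd_fun F" "energy F = 1"
    and a: "a \<in> carrier G"
  defines "k \<equiv> convolution \<kappa> (coefficient F)"
  shows "energy (\<lambda>x. k (a \<otimes> x) - coefficient F a * k x) \<le> 4 * (max_energy \<kappa> - energy k)"
proof -
  define p where "p = (\<lambda>c x. (c * k (a \<otimes> x) + cnj c * k (inv a \<otimes> x)) / 2 - of_real (Re (c * coefficient F a)) * k x)"
  have bk: "bdd_fun k"
    unfolding k_def using \<kappa> F by (intro bounded_on_convolution bounded_on_coefficient)
  have bp: "bdd_fun (p c)" for c
    unfolding p_def divide_inverse using a by (intro bounded_on_intros bounded_on_translate bk) auto
  have p: "energy (p c) \<le> max_energy \<kappa> - energy k" if "norm c = 1" for c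
    unfolding p_def k_def using \<kappa> F a that by (rule energy_defect_real)
  have "k (a \<otimes> x) - coefficient F a * k x = p 1 x - \<i> * p \<i> x" for x
    by (simp add: p_def complex_eq_iff field_simps)
  then have "energy (\<lambda>x. k (a \<otimes> x) - coefficient F a * k x)
      = rmean (\<lambda>x. (norm (p 1 x - \<i> * p \<i> x))\<^sup>2)"
    by (simp add: energy_def)
  also have "\<dots> \<le> rmean (\<lambda>x. 2 * (norm (p 1 x))\<^sup>2 + 2 * (norm (p \<i> x))\<^sup>2)"
  proof (rule rmean_mono)
    fix x
    have "(norm (p 1 x - \<i> * p \<i> x))\<^sup>2 \<le> (norm (p 1 x) + norm (p \<i> x))\<^sup>2"
      using norm_triangle_ineq4[of "p 1 x" "\<i> * p \<i> x"] by (intro power_mono) (auto simp: norm_mult)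
    also have "\<dots> \<le> 2 * (norm (p 1 x))\<^sup>2 + 2 * (norm (p \<i> x))\<^sup>2"
      using zero_le_power2[of "norm (p 1 x) - norm (p \<i> x)"] by (simp add: power2_eq_square algebra_simps)
    finally show "(norm (p 1 x - \<i> * p \<i> x))\<^sup>2 \<le> 2 * (norm (p 1 x))\<^sup>2 + 2 * (norm (p \<i> x))\<^sup>2" .
  qed (intro bounded_on_intros bp)+
  also have "\<dots> = 2 * energy (p 1) + 2 * energy (p \<i>)"
    unfolding energy_def by (simp add: rmean_add rmean_scale bounded_on_intros bp)
  finally show ?thesis using p[of 1] p[of \<i>] by simp
qed

end

locale compact_group_mean = topological_group G T + invariant_mean G M
  for G (structure) and T and M +
  assumes compact: "compact_space T" and Hausdorff: "Hausdorff_space T"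

section \<open>Translations and uniform continuity in topological groups\<close>

context topological_group
begin

lemma continuous_translate:
  assumes "a \<in> carrier G"
  shows "continuous_map T T (\<lambda>x. a \<otimes> x)"
proof -
  have "continuous_map T T ((\<lambda>(x, y). x \<otimes> y) \<circ> (\<lambda>x. (a, x)))"
    using assms by (intro continuous_map_compose[OF _ continuous_mult] continuous_map_pairedI)
      (auto simp: topspace_eq_carrier)
  then show ?thesis by (simp add: o_def)
qed

lemma continuous_translate_right:
  assumes "a \<in> carrier G"
  shows "continuous_map T T (\<lambda>x. x \<otimes> a)"
proof -
  have "continuous_map T T ((\<lambda>(x, y). x \<otimes> y) \<circ> (\<lambda>x. (x, a)))"
    using assms by (intro continuous_map_compose[OF _ continuous_mult] continuous_map_pairedI)
      (auto simp: topspace_eq_carrier)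
  then show ?thesis by (simp add: o_def)
qed

lemma openin_translate_right:
  assumes "openin T V" "a \<in> carrier G"
  shows "openin T {x \<in> carrier G. x \<otimes> a \<in> V}"
  using openin_continuous_map_preimage[OF continuous_translate_right[OF assms(2)] assms(1)]
  by (simp add: topspace_eq_carrier)

lemma openin_translate:
  assumes "openin T V" "a \<in> carrier G"
  shows "openin T {x \<in> carrier G. a \<otimes> x \<in> V}"
  using openin_continuous_map_preimage[OF continuous_translate[OF assms(2)] assms(1)]
  by (simp add: topspace_eq_carrier)

definition uniformly_continuous :: "('a \<Rightarrow> 'v::real_normed_vector) \<Rightarrow> bool" where
  "uniformly_continuous f \<longleftrightarrow> (\<forall>e>0. \<exists>V. openin T V \<and> \<one> \<in> V \<and>
     (\<forall>x\<in>carrier G. \<forall>v\<in>V. norm (f (v \<otimes> x) - f x) \<le> e))"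

lemma uniformly_continuousE:
  assumes "uniformly_continuous f" "e > 0"
  obtains V where "openin T V" "\<one> \<in> V" "V \<subseteq> carrier G"
    "\<And>x v. x \<in> carrier G \<Longrightarrow> v \<in> V \<Longrightarrow> norm (f (v \<otimes> x) - f x) \<le> e"
proof -
  obtain V where V: "openin T V" "\<one> \<in> V"
      "\<forall>x\<in>carrier G. \<forall>v\<in>V. norm (f (v \<otimes> x) - f x) \<le> e"
    using assms unfolding uniformly_continuous_def by meson
  moreover have "V \<subseteq> carrier G" using V(1) openin_subset topspace_eq_carrier by blast
  ultimately show thesis using that by blast
qed

lemma uniformly_continuous_imp_continuous_map:
  fixes f :: "'a \<Rightarrow> 'v::real_normed_vector"
  assumes "uniformly_continuous f"
  shows "continuous_map T euclidean f"
  unfolding continuous_map_def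
proof (intro conjI allI impI)
  fix S :: "'v set" assume S: "openin euclidean S"
  show "openin T {x \<in> topspace T. f x \<in> S}"
  proof (subst openin_subopen, rule ballI)
    fix x assume "x \<in> {x \<in> topspace T. f x \<in> S}"
    then have x: "x \<in> carrier G" "f x \<in> S" by (auto simp: topspace_eq_carrier)
    obtain e where e: "e > 0" "\<And>y. norm (y - f x) \<le> e \<Longrightarrow> y \<in> S"
      using S x(2) unfolding open_openin[symmetric] open_contains_cball
      by (metis dist_commute dist_norm mem_cball subsetD)
    obtain V where V: "openin T V" "\<one> \<in> V" "V \<subseteq> carrier G"
        "\<And>x v. x \<in> carrier G \<Longrightarrow> v \<in> V \<Longrightarrow> norm (f (v \<otimes> x) - f x) \<le> e"
      using assms e(1) by (rule uniformly_continuousE) blast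
    have "openin T {y \<in> carrier G. y \<otimes> inv x \<in> V}" using V(1) x(1) by (intro openin_translate_right) auto
    moreover have "f y \<in> S" if y: "y \<in> carrier G" "y \<otimes> inv x \<in> V" for y
      using V(4)[OF x(1) y(2)] e(2) x(1) y(1) by (simp add: m_assoc)
    ultimately show "\<exists>U. openin T U \<and> x \<in> U \<and> U \<subseteq> {x \<in> topspace T. f x \<in> S}"
      using x V(2) by (intro exI[of _ "{y \<in> carrier G. y \<otimes> inv x \<in> V}"]) (auto simp: topspace_eq_carrier)
  qed
qed auto

text \<open>The tube lemma around \<open>{\<one>} \<times> topspace T\<close> provides one
  neighbourhood that serves all points.\<close>

lemma continuous_map_imp_uniformly_continuous:
  assumes "compact_space T" and f: "continuous_map T euclidean f"
  shows "uniformly_continuous f"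
  unfolding uniformly_continuous_def
proof (intro allI impI)
  fix e :: real assume e: "e > 0"
  have "continuous_map (prod_topology T T) euclidean (\<lambda>p. f (fst p \<otimes> snd p) - f (snd p))"
    using continuous_map_compose[OF continuous_mult f] continuous_map_compose[OF continuous_map_snd f]
    by (intro continuous_map_diff) (simp_all add: o_def case_prod_unfold)
  then have op: "openin (prod_topology T T)
      {p \<in> topspace (prod_topology T T). f (fst p \<otimes> snd p) - f (snd p) \<in> ball 0 e}"
    by (rule openin_continuous_map_preimage) simp
  have "{\<one>} \<times> topspace T
      \<subseteq> {p \<in> topspace (prod_topology T T). f (fst p \<otimes> snd p) - f (snd p) \<in> ball 0 e}"
    using e by (auto simp: topspace_eq_carrier)
  from tube_lemma_right[OF op _ _ this] obtain V U where V: "openin T V" "\<one> \<in> V" "topspace T \<subseteq> U"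
    and VU: "V \<times> U \<subseteq> {p \<in> topspace (prod_topology T T). f (fst p \<otimes> snd p) - f (snd p) \<in> ball 0 e}"
    using assms(1) unfolding compact_space_def by (auto simp: topspace_eq_carrier)
  have "norm (f (v \<otimes> x) - f x) \<le> e" if "x \<in> carrier G" "v \<in> V" for x v
  proof -
    have "(v, x) \<in> V \<times> U" using that V(3) by (auto simp: topspace_eq_carrier)
    then have "f (v \<otimes> x) - f x \<in> ball 0 e" using VU by auto
    then show ?thesis by (simp add: less_imp_le)
  qed
  then show "\<exists>V. openin T V \<and> \<one> \<in> V \<and> (\<forall>x\<in>carrier G. \<forall>v\<in>V. norm (f (v \<otimes> x) - f x) \<le> e)"
    using V by blast
qed

lemma finite_translates_cover:
  assumes "compact_space T" "openin T V" "\<one> \<in> V"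
  obtains F where "finite F" "F \<subseteq> carrier G" "\<And>y. y \<in> carrier G \<Longrightarrow> \<exists>x\<in>F. inv x \<otimes> y \<in> V"
proof -
  define U where "U = (\<lambda>x. {y \<in> carrier G. inv x \<otimes> y \<in> V})"
  have "compactin T (carrier G)" using assms(1) by (simp add: compact_space_def topspace_eq_carrier)
  moreover have "openin T (U x)" if "x \<in> carrier G" for x
    unfolding U_def using assms(2) that by (intro openin_translate) auto
  moreover have "carrier G \<subseteq> \<Union>(U ` carrier G)" using assms(3) by (auto simp: U_def)
  ultimately obtain \<F> where "finite \<F>" "\<F> \<subseteq> U ` carrier G" "carrier G \<subseteq> \<Union>\<F>"
    unfolding compactin_def by (metis (no_types, lifting) imageE)
  then obtain F where "F \<subseteq> carrier G" "finite F" "carrier G \<subseteq> \<Union>(U ` F)"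
    by (metis finite_subset_image)
  then show thesis by (intro that[of F]) (auto simp: U_def)
qed

end

section \<open>Characters of a compact abelian group as limits of almost maximisers\<close>

context compact_group_mean
begin

definition content :: "'a set \<Rightarrow> real" where
  "content V = rmean (\<lambda>y. if y \<in> V then 1 else 0)"

text \<open>Here the mean meets the topology: finitely many translates of \<open>V\<close> cover the
  compact group, so their number times the content is at least 1.\<close>

lemma content_pos:
  assumes "openin T V" "\<one> \<in> V"
  shows "content V > 0"
proof -
  let ?i = "\<lambda>y. if y \<in> V then 1 else 0 :: real"
  have b: "bounded_on A (\<lambda>y. ?i (t y))" for A :: "'a set" and t by (rule bounded_onI[of _ _ 1]) auto
  obtain F where F: "finite F" "F \<subseteq> carrier G" "\<And>y. y \<in> carrier G \<Longrightarrow> \<exists>x\<in>F. inv x \<otimes> y \<in> V"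
    using finite_translates_cover[OF compact assms] by blast
  have "rmean (\<lambda>y. 1) \<le> rmean (\<lambda>y. \<Sum>x\<in>F. ?i (inv x \<otimes> y))"
  proof (rule rmean_mono)
    fix y assume "y \<in> carrier G"
    then obtain x where x: "x \<in> F" "inv x \<otimes> y \<in> V" using F(3) by blast
    have "?i (inv x \<otimes> y) \<le> (\<Sum>x\<in>F. ?i (inv x \<otimes> y))"
      using x(1) F(1) by (intro member_le_sum) auto
    then show "1 \<le> (\<Sum>x\<in>F. ?i (inv x \<otimes> y))" using x by simp
  qed (intro bounded_on_intros b)+
  also have "\<dots> = (\<Sum>x\<in>F. rmean (\<lambda>y. ?i (inv x \<otimes> y)))" by (intro rmean_sum b)
  also have "\<dots> = (\<Sum>x\<in>F. content V)"
    unfolding content_def using F(2) b[of _ "\<lambda>y. y"]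
    by (intro sum.cong refl rmean_translate[of _ ?i]) auto
  finally have "1 \<le> card F * content V" by (simp add: rmean_const)
  then show ?thesis by (smt (verit) mult_nonneg_nonpos of_nat_0_le_iff)
qed

text \<open>A Markov-type inequality: \<open>r\<close> dominates \<eta> times the indicator of the
  translate of \<open>V\<close> by \<open>x\<close>, whose mean is the content of
  \<open>V\<close>.\<close>

lemma rmean_ge_content:
  assumes x: "x \<in> carrier G" and r: "bdd_fun r" "\<And>y. y \<in> carrier G \<Longrightarrow> r y \<ge> 0"
    and ge: "\<And>v. v \<in> V \<Longrightarrow> r (v \<otimes> x) \<ge> \<eta>"
  shows "rmean r \<ge> \<eta> * content V"
proof -
  let ?i = "\<lambda>y. if y \<in> V then 1 else 0 :: real"
  have b: "bounded_on A (\<lambda>y. ?i (t y))" for A :: "'a set" and t by (rule bounded_onI[of _ _ 1]) auto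
  have "\<eta> * content V = \<eta> * rmean (\<lambda>y. ?i (inv x \<otimes> y))"
    unfolding content_def using x b[of _ "\<lambda>y. y"] by (subst rmean_translate[of _ ?i]) auto
  also have "\<dots> = rmean (\<lambda>y. \<eta> * ?i (inv x \<otimes> y))" by (intro rmean_scale[symmetric] b)
  also have "\<dots> \<le> rmean r"
  proof (rule rmean_mono)
    fix y assume y: "y \<in> carrier G"
    show "\<eta> * ?i (inv x \<otimes> y) \<le> r y"
    proof (cases "inv x \<otimes> y \<in> V")
      case True
      have "inv x \<otimes> y \<otimes> x = x \<otimes> (inv x \<otimes> y)" using x y by (intro m_comm) auto
      also have "\<dots> = y" using x y by (simp flip: m_assoc)
      finally show ?thesis using ge[OF True] True by simp
    qed (use r(2)[OF y] in simp)
  qed (intro bounded_on_intros b r)+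
  finally show ?thesis .
qed

lemma energy_pos:
  assumes b: "bdd_fun f" and u: "uniformly_continuous f" and x: "x \<in> carrier G" "f x \<noteq> 0"
  shows "energy f > 0"
proof -
  define e where "e = norm (f x) / 2"
  have e: "e > 0" using x by (simp add: e_def)
  obtain V where V: "openin T V" "\<one> \<in> V" "V \<subseteq> carrier G"
      "\<And>x v. x \<in> carrier G \<Longrightarrow> v \<in> V \<Longrightarrow> norm (f (v \<otimes> x) - f x) \<le> e"
    using u e by (rule uniformly_continuousE) blast
  define \<delta> where "\<delta> = content V"
  have \<delta>: "\<delta> > 0" unfolding \<delta>_def using V(1,2) by (rule content_pos)
  have "energy f \<ge> e\<^sup>2 * \<delta>"
    unfolding energy_def \<delta>_def
  proof (rule rmean_ge_content[OF x(1)])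
    fix v assume "v \<in> V"
    then have "norm (f (v \<otimes> x) - f x) \<le> e" using V(4) x(1) by blast
    then have "norm (f (v \<otimes> x)) \<ge> e"
      using norm_triangle_ineq2[of "f x" "f (v \<otimes> x)"] by (simp add: e_def norm_minus_commute)
    then show "(norm (f (v \<otimes> x)))\<^sup>2 \<ge> e\<^sup>2" using e by (intro power_mono) auto
  qed (simp_all add: bounded_on_intros b)
  moreover have "e\<^sup>2 * \<delta> > 0" using e \<delta> by simp
  ultimately show ?thesis by simp
qed

text \<open>The modulus of continuity comes from \<kappa> alone, so the functions
  \<open>convolution \<kappa> h\<close> with \<open>h\<close> bounded by 1 are
  equicontinuous.\<close>

lemma convolution_equicontinuous:
  assumes \<kappa>: "bdd_fun \<kappa>" and h: "\<And>y. y \<in> carrier G \<Longrightarrow> norm (h y) \<le> 1"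
    and v: "v \<in> carrier G" "\<And>y. y \<in> carrier G \<Longrightarrow> norm (\<kappa> (v \<otimes> y) - \<kappa> y) \<le> e"
    and x: "x \<in> carrier G"
  shows "norm (convolution \<kappa> h (v \<otimes> x) - convolution \<kappa> h x) \<le> e"
proof -
  have bh: "bdd_fun h" using h by (rule bounded_onI)
  have "convolution \<kappa> h (v \<otimes> x) - convolution \<kappa> h x = convolution (\<lambda>y. \<kappa> (v \<otimes> y) - \<kappa> y) h x"
    using \<kappa> bh v(1) x
    by (simp add: convolution_diff_kernel convolution_translate_kernel bounded_on_translate)
  also have "norm \<dots> \<le> e * 1" using v(2) h x by (rule norm_convolution_le)
  finally show ?thesis by simp
qed

text \<open>A mean-square bound becomes uniform: if the defect \<open>r\<close> were at least 4 e in
  norm at one point, equicontinuity would keep it above 2 e on a translate of \<open>V\<close>, and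
  its energy would be at least 4 e^2 times the content of \<open>V\<close>.
  \<open>energy_defect\<close> excludes this when d is e^2 times that content, the same
  \<open>d\<close> for all \<open>F\<close>, \<open>a\<close> and \<open>x\<close>.\<close>

lemma coefficient_almost_character:
  assumes \<kappa>: "bdd_fun \<kappa>" "uniformly_continuous \<kappa>" and e: "e > 0"
  obtains d where "d > 0"
    "\<And>F a x. bdd_fun F \<Longrightarrow> energy F = 1 \<Longrightarrow>
      max_energy \<kappa> - energy (convolution \<kappa> (coefficient F)) < d \<Longrightarrow> a \<in> carrier G \<Longrightarrow> x \<in> carrier G \<Longrightarrow>
      norm (convolution \<kappa> (coefficient F) (a \<otimes> x) - coefficient F a * convolution \<kappa> (coefficient F) x) < 4 * e"
proof -
  obtain V where V: "openin T V" "\<one> \<in> V" "V \<subseteq> carrier G"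
      "\<And>x v. x \<in> carrier G \<Longrightarrow> v \<in> V \<Longrightarrow> norm (\<kappa> (v \<otimes> x) - \<kappa> x) \<le> e"
    using \<kappa>(2) e by (rule uniformly_continuousE) blast
  define \<delta> where "\<delta> = content V"
  have \<delta>: "\<delta> > 0" unfolding \<delta>_def using V(1,2) by (rule content_pos)
  show thesis
  proof
    show "e\<^sup>2 * \<delta> > 0" using e \<delta> by simp
    fix F a x assume F: "bdd_fun F" "energy F = 1"
      and d: "max_energy \<kappa> - energy (convolution \<kappa> (coefficient F)) < e\<^sup>2 * \<delta>"
      and a: "a \<in> carrier G" and x: "x \<in> carrier G"
    define k where "k = convolution \<kappa> (coefficient F)"
    define r where "r = (\<lambda>y. k (a \<otimes> y) - coefficient F a * k y)"
    have h: "norm (coefficient F y) \<le> 1" if "y \<in> carrier G" for y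
      using norm_coefficient_le[OF F(1) that] F(2) by simp
    have k: "norm (k (v \<otimes> y) - k y) \<le> e" if "v \<in> V" "y \<in> carrier G" for v y
      unfolding k_def using V(3,4) that by (intro convolution_equicontinuous \<kappa>(1) h) auto
    have bk: "bdd_fun k"
      unfolding k_def by (intro bounded_on_convolution \<kappa>(1) bounded_on_coefficient F(1))
    have br: "bdd_fun r"
      unfolding r_def by (intro bounded_on_intros bounded_on_translate bk a)
    show "norm (convolution \<kappa> (coefficient F) (a \<otimes> x) - coefficient F a * convolution \<kappa> (coefficient F) x) < 4 * e"
    proof (rule ccontr)
      assume "\<not> ?thesis"
      then have rx: "norm (r x) \<ge> 4 * e" by (simp add: r_def k_def)
      have "(2 * e)\<^sup>2 * \<delta> \<le> energy r"
        unfolding energy_def \<delta>_def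
      proof (rule rmean_ge_content[OF x])
        fix v assume v: "v \<in> V"
        then have vc: "v \<in> carrier G" using V(3) by blast
        have "r (v \<otimes> x) - r x = (k (v \<otimes> (a \<otimes> x)) - k (a \<otimes> x)) - coefficient F a * (k (v \<otimes> x) - k x)"
          using a x vc by (simp add: r_def m_lcomm algebra_simps)
        also have "norm \<dots> \<le> norm (k (v \<otimes> (a \<otimes> x)) - k (a \<otimes> x)) + norm (coefficient F a * (k (v \<otimes> x) - k x))"
          by (rule norm_triangle_ineq4)
        also have "\<dots> \<le> e + 1 * e"
          unfolding norm_mult using v a x h k by (intro add_mono mult_mono) auto
        finally have "norm (r (v \<otimes> x) - r x) \<le> 2 * e" by simp
        then have "norm (r (v \<otimes> x)) \<ge> 2 * e"
          using rx norm_triangle_ineq2[of "r x" "r (v \<otimes> x)"] by (simp add: norm_minus_commute)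
        then show "(norm (r (v \<otimes> x)))\<^sup>2 \<ge> (2 * e)\<^sup>2" using e by (intro power_mono) auto
      qed (simp_all add: bounded_on_intros br)
      also have "energy r \<le> 4 * (max_energy \<kappa> - energy k)"
        unfolding r_def k_def using \<kappa>(1) F a by (rule energy_defect)
      also have "\<dots> < 4 * (e\<^sup>2 * \<delta>)" using d by (simp add: k_def)
      finally show False by (simp add: power_mult_distrib)
    qed
  qed
qed

text \<open>The character is the limit \<psi> of the coefficients of almost maximisers.
  Equicontinuity is known for the convolutions \<open>k n\<close>, so continuity is read off from
  their limit \<open>K\<close>, which satisfies \<open>K (a \<otimes> x) = \<psi> a * K x\<close>
  and hence is a multiple of \<psi>. The shape of \<kappa> in \<open>\<kappa>_eq\<close> serves to
  exclude \<open>\<psi> b\<close> = 1.\<close>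

lemma character_from_kernel:
  assumes \<kappa>: "bdd_fun \<kappa>" "uniformly_continuous \<kappa>" and pos: "max_energy \<kappa> > 0"
    and b: "b \<in> carrier G" and \<phi>: "bdd_fun \<phi>"
    and \<kappa>_eq: "\<And>x. x \<in> carrier G \<Longrightarrow> \<kappa> x = \<phi> x - \<phi> (inv b \<otimes> x)"
  obtains \<psi> where "character G \<psi>" "continuous_map T euclidean \<psi>" "\<psi> b \<noteq> 1"
proof -
  have "\<exists>F. bdd_fun F \<and> energy F = 1 \<and>
      max_energy \<kappa> - 1 / Suc n < energy (convolution \<kappa> (coefficient F))" for n
  proof -
    let ?S = "{energy (convolution \<kappa> (coefficient F)) | F. bdd_fun F \<and> energy F = 1}"
    have "bdd_fun (\<lambda>x. 1)" "energy (\<lambda>x. 1) = 1"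
      by (simp_all add: bounded_on_intros energy_def rmean_const)
    then have "?S \<noteq> {}" by blast
    then have "\<exists>e\<in>?S. max_energy \<kappa> - 1 / Suc n < e"
      unfolding max_energy_def by (intro less_cSupD) auto
    then show ?thesis by blast
  qed
  then obtain F where F: "\<And>n. bdd_fun (F n)" "\<And>n. energy (F n) = 1"
    "\<And>n. max_energy \<kappa> - 1 / Suc n < energy (convolution \<kappa> (coefficient (F n)))" by metis
  define h where "h = (\<lambda>n. coefficient (F n))"
  define k where "k = (\<lambda>n. convolution \<kappa> (h n))"
  have bh: "bdd_fun (h n)" for n
    unfolding h_def by (rule bounded_on_coefficient[OF F(1)])
  have h1: "norm (h n x) \<le> 1" if "x \<in> carrier G" for n x
    using norm_coefficient_le[OF F(1) that] F(2) by (simp add: h_def)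
  obtain B where B: "\<And>y. y \<in> carrier G \<Longrightarrow> norm (\<kappa> y) \<le> B" using \<kappa>(1) by (metis bounded_onE)
  obtain C where C: "\<And>y. y \<in> carrier G \<Longrightarrow> norm (\<phi> y) \<le> C" using \<phi> by (metis bounded_onE)
  have kB: "norm (k n x) \<le> B" if "x \<in> carrier G" for n x
    using norm_convolution_le[OF B h1 that] by (simp add: k_def)
  obtain U where U: "U \<le> sequentially" "U \<noteq> bot"
    "\<And>f :: nat \<Rightarrow> complex. bounded (range f) \<Longrightarrow> \<exists>l. (f \<longlongrightarrow> l) U"
    using universal_subfilter[of sequentially] by auto
  have "\<exists>l. ((\<lambda>n. k n x) \<longlongrightarrow> l) U" if "x \<in> carrier G" for x
    using U(3)[of "\<lambda>n. k n x"] kB[OF that] by (auto simp: bounded_iff)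
  then obtain K where K: "\<And>x. x \<in> carrier G \<Longrightarrow> ((\<lambda>n. k n x) \<longlongrightarrow> K x) U" by metis
  have "\<exists>l. ((\<lambda>n. h n x) \<longlongrightarrow> l) U" if "x \<in> carrier G" for x
    using U(3)[of "\<lambda>n. h n x"] h1[OF that] by (auto simp: bounded_iff)
  then obtain \<psi> where \<psi>: "\<And>x. x \<in> carrier G \<Longrightarrow> ((\<lambda>n. h n x) \<longlongrightarrow> \<psi> x) U" by metis
  have lim: "(\<lambda>n. max_energy \<kappa> - 1 / Suc n) \<longlonglongrightarrow> max_energy \<kappa>"
    using tendsto_diff[OF tendsto_const LIMSEQ_Suc[OF lim_const_over_n[of 1]]] by simp
  have approx: "eventually (\<lambda>n. \<forall>a\<in>carrier G. \<forall>x\<in>carrier G. norm (k n (a \<otimes> x) - h n a * k n x) < 4 * e) U"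
    if e: "e > 0" for e
  proof -
    obtain d where d: "d > 0"
      "\<And>F a x. bdd_fun F \<Longrightarrow> energy F = 1 \<Longrightarrow>
        max_energy \<kappa> - energy (convolution \<kappa> (coefficient F)) < d \<Longrightarrow> a \<in> carrier G \<Longrightarrow> x \<in> carrier G \<Longrightarrow>
        norm (convolution \<kappa> (coefficient F) (a \<otimes> x) - coefficient F a * convolution \<kappa> (coefficient F) x) < 4 * e"
      using coefficient_almost_character[OF \<kappa> e] by blast
    have "eventually (\<lambda>n. max_energy \<kappa> - 1 / Suc n > max_energy \<kappa> - d) sequentially"
      using d(1) by (intro order_tendstoD(1)[OF lim]) simp
    then have "eventually (\<lambda>n. \<forall>a\<in>carrier G. \<forall>x\<in>carrier G. norm (k n (a \<otimes> x) - h n a * k n x) < 4 * e) sequentially"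
    proof (rule eventually_mono, intro ballI)
      fix n a x assume n: "max_energy \<kappa> - 1 / Suc n > max_energy \<kappa> - d"
        and "a \<in> carrier G" "x \<in> carrier G"
      then show "norm (k n (a \<otimes> x) - h n a * k n x) < 4 * e"
        unfolding k_def h_def using F(3)[of n] by (intro d(2) F(1,2)) auto
    qed
    then show ?thesis using U(1) by (rule filter_leD[rotated])
  qed
  have mult: "K (a \<otimes> x) = \<psi> a * K x" if a: "a \<in> carrier G" and x: "x \<in> carrier G" for a x
  proof -
    have "norm (K (a \<otimes> x) - \<psi> a * K x) \<le> 4 * e" if "e > 0" for e
    proof (rule tendsto_upperbound[OF _ _ U(2)])
      show "((\<lambda>n. norm (k n (a \<otimes> x) - h n a * k n x)) \<longlongrightarrow> norm (K (a \<otimes> x) - \<psi> a * K x)) U"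
        using a x by (intro tendsto_intros K \<psi>) auto
      show "eventually (\<lambda>n. norm (k n (a \<otimes> x) - h n a * k n x) \<le> 4 * e) U"
        using approx[OF that] a x by (auto elim!: eventually_mono simp: less_imp_le)
    qed
    note * = this
    have "norm (K (a \<otimes> x) - \<psi> a * K x) \<le> 0"
    proof (rule field_le_epsilon)
      fix e :: real assume "e > 0"
      with *[of "e / 4"] show "norm (K (a \<otimes> x) - \<psi> a * K x) \<le> 0 + e" by simp
    qed
    then show ?thesis by simp
  qed
  \<comment> \<open>If \<open>K \<one>\<close> were 0, then by \<open>approx\<close> the functions
    \<open>k n\<close> would be uniformly small, although their energies tend to a positive maximum.
    The 8 in \<open>e\<close> makes (4 e)^2 a quarter of that maximum.\<close>
  have K1: "K \<one> \<noteq> 0"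
  proof
    assume K1: "K \<one> = 0"
    define e where "e = sqrt (max_energy \<kappa>) / 8"
    have e: "e > 0" using pos by (simp add: e_def)
    have "max_energy \<kappa> \<le> (norm (K \<one>) + 4 * e)\<^sup>2"
    proof (rule tendsto_le[OF U(2)])
      show "((\<lambda>n. max_energy \<kappa> - 1 / Suc n) \<longlongrightarrow> max_energy \<kappa>) U" using lim U(1) by (rule tendsto_mono[rotated])
      show "((\<lambda>n. (norm (k n \<one>) + 4 * e)\<^sup>2) \<longlongrightarrow> (norm (K \<one>) + 4 * e)\<^sup>2) U"
        by (intro tendsto_intros K) auto
      show "eventually (\<lambda>n. max_energy \<kappa> - 1 / Suc n \<le> (norm (k n \<one>) + 4 * e)\<^sup>2) U"
        using approx[OF e]
      proof (rule eventually_mono)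
        fix n assume n: "\<forall>a\<in>carrier G. \<forall>x\<in>carrier G. norm (k n (a \<otimes> x) - h n a * k n x) < 4 * e"
        have "norm (k n a) \<le> norm (k n \<one>) + 4 * e" if a: "a \<in> carrier G" for a
        proof -
          have "norm (k n a) \<le> norm (h n a * k n \<one>) + norm (k n a - h n a * k n \<one>)"
            by (rule norm_triangle_sub)
          also have "norm (h n a * k n \<one>) \<le> 1 * norm (k n \<one>)"
            unfolding norm_mult using h1[OF a] by (intro mult_right_mono) auto
          also have "norm (k n a - h n a * k n \<one>) \<le> 4 * e"
            using bspec[OF bspec[OF n a] one_closed] a by (simp add: less_imp_le)
          finally show ?thesis by simp
        qed
        then have "energy (k n) \<le> (norm (k n \<one>) + 4 * e)\<^sup>2" by (rule energy_le)
        then show "max_energy \<kappa> - 1 / Suc n \<le> (norm (k n \<one>) + 4 * e)\<^sup>2"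
          using F(3)[of n] by (simp add: k_def h_def)
      qed
    qed
    also have "\<dots> = max_energy \<kappa> / 4" using pos by (simp add: K1 e_def power2_eq_square)
    finally show False using pos by simp
  qed
  have \<psi>_eq: "\<psi> a = K a / K \<one>" if "a \<in> carrier G" for a
    using mult[OF that one_closed] that K1 by (simp add: field_simps)
  have \<psi>_mult: "\<psi> (x \<otimes> y) = \<psi> x * \<psi> y" if "x \<in> carrier G" "y \<in> carrier G" for x y
    using that mult[of x y] by (simp add: \<psi>_eq)
  have \<psi>1: "\<psi> \<one> = 1" using K1 by (simp add: \<psi>_eq)
  have \<psi>_le: "norm (\<psi> x) \<le> 1" if x: "x \<in> carrier G" for x
    by (rule tendsto_upperbound[OF tendsto_norm[OF \<psi>[OF x]] _ U(2)]) (simp add: h1[OF x])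
  \<comment> \<open>\<open>\<psi> x\<close> and \<open>\<psi> (inv x)\<close> have norm at most 1
    and product 1.\<close>
  have "norm (\<psi> x) = 1" if x: "x \<in> carrier G" for x
  proof -
    have "norm (\<psi> x) * norm (\<psi> (inv x)) = 1"
      using \<psi>_mult[of x "inv x"] x \<psi>1 by (simp flip: norm_mult)
    moreover have "norm (\<psi> x) * norm (\<psi> (inv x)) \<le> norm (\<psi> x) * 1"
      using \<psi>_le[of "inv x"] x by (intro mult_left_mono) auto
    ultimately show ?thesis using \<psi>_le[OF x] by simp
  qed
  then have char: "character G \<psi>" using \<psi>_mult by (simp add: character_def)
  have "uniformly_continuous \<psi>"
    unfolding uniformly_continuous_def
  proof (intro allI impI)
    fix e :: real assume e: "e > 0"
    have "e * norm (K \<one>) > 0" using e K1 by simp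
    from \<kappa>(2) this obtain V where V: "openin T V" "\<one> \<in> V" "V \<subseteq> carrier G"
        "\<And>x v. x \<in> carrier G \<Longrightarrow> v \<in> V \<Longrightarrow> norm (\<kappa> (v \<otimes> x) - \<kappa> x) \<le> e * norm (K \<one>)"
      by (rule uniformly_continuousE) blast
    have "norm (\<psi> (v \<otimes> x) - \<psi> x) \<le> e" if v: "v \<in> V" and x: "x \<in> carrier G" for v x
    proof -
      have vc: "v \<in> carrier G" using v V(3) by blast
      have "norm (K (v \<otimes> x) - K x) \<le> e * norm (K \<one>)"
      proof (rule tendsto_upperbound[OF tendsto_norm[OF tendsto_diff[OF K K]] _ U(2)])
        show "eventually (\<lambda>n. norm (k n (v \<otimes> x) - k n x) \<le> e * norm (K \<one>)) U"
          unfolding k_def using V(4) v vc x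
          by (intro always_eventually allI convolution_equicontinuous \<kappa>(1) h1) auto
      qed (use vc x in auto)
      then have "norm ((K (v \<otimes> x) - K x) / K \<one>) \<le> e"
        using K1 by (simp add: norm_divide divide_simps)
      then show ?thesis using vc x by (simp add: \<psi>_eq diff_divide_distrib)
    qed
    then show "\<exists>V. openin T V \<and> \<one> \<in> V \<and> (\<forall>x\<in>carrier G. \<forall>v\<in>V. norm (\<psi> (v \<otimes> x) - \<psi> x) \<le> e)"
      using V by blast
  qed
  then have cont: "continuous_map T euclidean \<psi>" by (rule uniformly_continuous_imp_continuous_map)
  \<comment> \<open>With \<open>\<psi> b\<close> = 1 the function \<open>K\<close> would be constant
    and nonzero on the powers of \<open>b\<close>, so its sums along them would grow linearly. But
    \<kappa> is a difference along \<open>b\<close>, so the sums of \<open>k n\<close> telescope and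
    stay within 2 C.\<close>
  have "\<psi> b \<noteq> 1"
  proof
    assume "\<psi> b = 1"
    then have Kb: "K (b [^] j) = K \<one>" for j :: nat
    proof (induction j)
      case (Suc j)
      have "K (b [^] Suc j) = K (b \<otimes> b [^] j)" using b by (simp add: m_comm)
      then show ?case using mult[of b "b [^] j"] b Suc \<open>\<psi> b = 1\<close> by simp
    qed simp
    have sum_le: "norm (\<Sum>j<N. k n (b [^] j)) \<le> 2 * C" for n and N :: nat
    proof -
      define \<Psi> where "\<Psi> = convolution \<phi> (h n)"
      have \<Psi>: "norm (\<Psi> x) \<le> C" if "x \<in> carrier G" for x
        using norm_convolution_le[OF C h1 that] by (simp add: \<Psi>_def)
      have "k n x = \<Psi> x - \<Psi> (inv b \<otimes> x)" if x: "x \<in> carrier G" for x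
      proof -
        have "k n x = convolution (\<lambda>y. \<phi> y - \<phi> (inv b \<otimes> y)) (h n) x"
          unfolding k_def convolution_def using x
          by (intro mean_cong bounded_on_intros bounded_on_kernel \<kappa>(1) bh) (simp_all add: \<kappa>_eq)
        then show ?thesis
          unfolding \<Psi>_def using x b bh \<phi>
          by (simp add: convolution_diff_kernel convolution_translate_kernel bounded_on_translate)
      qed
      then have eq: "k n (b [^] j) = \<Psi> (b [^] j) - \<Psi> (inv b \<otimes> b [^] j)" for j :: nat using b by simp
      define g where "g = (\<lambda>j::nat. \<Psi> (inv b \<otimes> b [^] j))"
      have "inv b \<otimes> b [^] Suc j = b [^] j" for j :: nat
        using b by (simp add: m_comm[of _ b] m_assoc[symmetric])
      then have "k n (b [^] j) = g (Suc j) - g j" for j :: nat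
        using eq by (simp add: g_def del: nat_pow_Suc)
      then have "(\<Sum>j<N. k n (b [^] j)) = g N - g 0" by (simp add: sum_lessThan_telescope)
      also have "norm \<dots> \<le> norm (g N) + norm (g 0)" by (rule norm_triangle_ineq4)
      also have "\<dots> \<le> C + C" unfolding g_def using b by (intro add_mono \<Psi>) auto
      finally show ?thesis by simp
    qed
    have "N * norm (K \<one>) \<le> 2 * C" for N :: nat
    proof -
      have "norm (\<Sum>j<N. K (b [^] j)) \<le> 2 * C"
      proof (rule tendsto_upperbound[OF _ _ U(2)])
        show "((\<lambda>n. norm (\<Sum>j<N. k n (b [^] j))) \<longlongrightarrow> norm (\<Sum>j<N. K (b [^] j))) U"
          using b by (intro tendsto_norm tendsto_sum K) auto
      qed (simp add: sum_le)
      then show ?thesis by (simp add: Kb norm_mult)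
    qed
    moreover obtain N :: nat where "N * norm (K \<one>) > 2 * C"
      using K1 reals_Archimedean3[of "norm (K \<one>)"] by auto
    ultimately show False by (meson linorder_not_less)
  qed
  with char cont show thesis by (rule that)
qed

text \<open>The kernel is the coefficient of g = v - v(b^-1 .) for a Urysohn function
  \<open>v\<close>. Expanding only the first of the two factors in the coefficient shows that
  \<kappa> is itself a difference \<phi> - \<phi>(b^-1 .), as \<open>character_from_kernel\<close>
  asks.\<close>

theorem characters_separate_points:
  assumes b: "b \<in> carrier G" "b \<noteq> \<one>"
  obtains \<psi> where "character G \<psi>" "continuous_map T euclidean \<psi>" "\<psi> b \<noteq> 1"
proof -
  have "normal_space T" using compact Hausdorff compact_Hausdorff_or_regular_imp_normal_space by blast
  moreover have "closedin T {\<one>}" "closedin T {inv b}"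
    using b Hausdorff by (auto simp: closedin_Hausdorff_sing_eq topspace_eq_carrier)
  moreover have "disjnt {\<one>} {inv b}" using b by (auto simp: disjnt_def)
  \<comment> \<open>These two values give g the value 1 at \<open>\<one>\<close>, so that
    \<open>g\<close> has positive energy.\<close>
  ultimately obtain u where u: "continuous_map T (top_of_set {0..1::real}) u" "u \<one> = 1" "u (inv b) = 0"
    using Urysohn_lemma[of T "{inv b}" "{\<one>}" 0 1] by (auto simp: disjnt_sym)
  have u_cont: "continuous_map T euclidean u" and u01: "u x \<in> {0..1}" if "x \<in> carrier G" for x
    using u(1) that by (auto simp: continuous_map_in_subtopology topspace_eq_carrier)
  define v where "v = (\<lambda>x. complex_of_real (u x))"
  define g where "g = (\<lambda>x. v x - v (inv b \<otimes> x))"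
  have v1: "norm (v x) \<le> 1" if "x \<in> carrier G" for x
    using u01[OF that] by (auto simp: v_def)
  have bv: "bdd_fun v" using v1 by (rule bounded_onI)
  have g1: "norm (g x) \<le> 1" if "x \<in> carrier G" for x
    using u01[OF that] u01[of "inv b \<otimes> x"] b that by (auto simp: g_def v_def abs_le_iff simp flip: of_real_diff)
  have bg: "bdd_fun g" using g1 by (rule bounded_onI)
  have "continuous_map T euclidean v"
    using continuous_map_compose[OF u_cont[OF one_closed], of euclidean complex_of_real]
    by (simp add: v_def o_def continuous_on_of_real)
  then have "continuous_map T euclidean g"
    unfolding g_def using continuous_map_compose[OF continuous_translate[OF inv_closed[OF b(1)]], of euclidean v]
    by (intro continuous_map_diff) (auto simp: o_def)
  then have g_ucont: "uniformly_continuous g" using compact by (rule continuous_map_imp_uniformly_continuous[rotated])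
  define \<kappa> where "\<kappa> = coefficient g"
  define \<phi> where "\<phi> = (\<lambda>x. M (\<lambda>z. v (x \<otimes> z) * cnj (g z)))"
  have b\<kappa>: "bdd_fun \<kappa>" unfolding \<kappa>_def by (rule bounded_on_coefficient[OF bg])
  have b\<phi>: "bdd_fun \<phi>"
  proof (rule bounded_onI)
    fix x assume "x \<in> carrier G"
    then show "norm (\<phi> x) \<le> 1 * 1"
      unfolding \<phi>_def by (intro norm_mean_le) (unfold norm_mult complex_mod_cnj, intro mult_mono v1 g1, auto)
  qed
  have \<kappa>_eq: "\<kappa> x = \<phi> x - \<phi> (inv b \<otimes> x)" if x: "x \<in> carrier G" for x
  proof -
    have "\<kappa> x = M (\<lambda>z. v (x \<otimes> z) * cnj (g z) - v (inv b \<otimes> x \<otimes> z) * cnj (g z))"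
      unfolding \<kappa>_def coefficient_def using x b
      by (intro mean_cong bounded_on_intros bounded_on_translate bg) (auto simp: g_def m_assoc algebra_simps)
    then show ?thesis
      unfolding \<phi>_def using x b
      by (simp add: mean_diff bounded_on_intros bounded_on_translate bg bv)
  qed
  have \<kappa>_ucont: "uniformly_continuous \<kappa>"
    unfolding uniformly_continuous_def
  proof (intro allI impI)
    fix e :: real assume "e > 0"
    with g_ucont obtain V where V: "openin T V" "\<one> \<in> V" "V \<subseteq> carrier G"
        "\<And>x v. x \<in> carrier G \<Longrightarrow> v \<in> V \<Longrightarrow> norm (g (v \<otimes> x) - g x) \<le> e"
      by (rule uniformly_continuousE) blast
    have "norm (\<kappa> (w \<otimes> x) - \<kappa> x) \<le> e" if w: "w \<in> V" and x: "x \<in> carrier G" for w x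
    proof -
      have wc: "w \<in> carrier G" using w V(3) by blast
      have "\<kappa> (w \<otimes> x) - \<kappa> x = M (\<lambda>z. g (w \<otimes> x \<otimes> z) * cnj (g z) - g (x \<otimes> z) * cnj (g z))"
        unfolding \<kappa>_def coefficient_def using x wc
        by (intro mean_diff[symmetric] bounded_on_intros bounded_on_translate bg) auto
      also have "norm \<dots> \<le> e * 1"
      proof (rule norm_mean_le)
        fix z assume z: "z \<in> carrier G"
        have "g (w \<otimes> x \<otimes> z) * cnj (g z) - g (x \<otimes> z) * cnj (g z)
            = (g (w \<otimes> (x \<otimes> z)) - g (x \<otimes> z)) * cnj (g z)"
          using wc x z by (simp add: m_assoc algebra_simps)
        also have "norm \<dots> \<le> e * 1"
          unfolding norm_mult using V(4)[of "x \<otimes> z" w] w x z g1[OF z] \<open>e > 0\<close> by (intro mult_mono) auto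
        finally show "norm (g (w \<otimes> x \<otimes> z) * cnj (g z) - g (x \<otimes> z) * cnj (g z)) \<le> e * 1" .
      qed
      finally show ?thesis by simp
    qed
    then show "\<exists>V. openin T V \<and> \<one> \<in> V \<and> (\<forall>x\<in>carrier G. \<forall>v\<in>V. norm (\<kappa> (v \<otimes> x) - \<kappa> x) \<le> e)"
      using V by blast
  qed
  define m where "m = energy g"
  have m: "m > 0"
    unfolding m_def using bg g_ucont one_closed
    by (rule energy_pos) (use u b in \<open>simp add: g_def v_def\<close>)
  \<comment> \<open>The normalised \<open>g\<close> is the test vector showing
    \<open>max_energy \<kappa>\<close> > 0: its coefficient is \<kappa> / m, and as \<kappa> is
    Hermitian, the convolution takes at \<open>\<one>\<close> the value
    \<open>energy \<kappa>\<close> / m.\<close>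
  define F where "F = (\<lambda>z. of_real (1 / sqrt m) * g z)"
  have bF: "bdd_fun F" unfolding F_def by (intro bounded_on_intros bg)
  have nm: "(norm (complex_of_real (1 / sqrt m)))\<^sup>2 = 1 / m" using m by (simp add: norm_divide power_divide)
  have eF: "energy F = 1"
    unfolding F_def energy_scale[OF bg] nm using m by (simp add: m_def)
  have "convolution \<kappa> (coefficient F) \<one> = of_real (1 / m) * of_real (energy \<kappa>)"
  proof -
    have "convolution \<kappa> (coefficient F) \<one> = M (\<lambda>y. of_real (1 / m) * of_real ((norm (\<kappa> y))\<^sup>2))"
      unfolding convolution_def
    proof (rule mean_cong)
      fix y assume y: "y \<in> carrier G"
      have "\<kappa> (inv y) = cnj (\<kappa> y)" unfolding \<kappa>_def using bg y by (rule coefficient_inv)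
      moreover have "coefficient F y = of_real (1 / m) * \<kappa> y"
        unfolding F_def \<kappa>_def using coefficient_scale[OF bg y, of "of_real (1 / sqrt m)"] by (simp only: nm)
      ultimately show "\<kappa> (\<one> \<otimes> inv y) * coefficient F y = of_real (1 / m) * of_real ((norm (\<kappa> y))\<^sup>2)"
        using y unfolding complex_norm_square by (simp add: mult_ac)
    qed (intro bounded_on_intros bounded_on_kernel bounded_on_coefficient bF b\<kappa> one_closed)
    also have "\<dots> = of_real (1 / m) * M (\<lambda>y. of_real ((norm (\<kappa> y))\<^sup>2))"
      by (intro mean_scale bounded_on_intros b\<kappa>)
    also have "M (\<lambda>y. of_real ((norm (\<kappa> y))\<^sup>2)) = of_real (energy \<kappa>)"
      unfolding energy_def by (intro mean_of_real bounded_on_intros b\<kappa>)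
    finally show ?thesis .
  qed
  moreover have "energy \<kappa> > 0"
    using b\<kappa> \<kappa>_ucont one_closed
    by (rule energy_pos) (use m in \<open>simp add: \<kappa>_def coefficient_at_one[OF bg] m_def\<close>)
  ultimately have nz: "convolution \<kappa> (coefficient F) \<one> \<noteq> 0" using m by simp
  have "uniformly_continuous (convolution \<kappa> (coefficient F))"
    unfolding uniformly_continuous_def
  proof (intro allI impI)
    fix e :: real assume "e > 0"
    with \<kappa>_ucont obtain V where V: "openin T V" "\<one> \<in> V" "V \<subseteq> carrier G"
        "\<And>x v. x \<in> carrier G \<Longrightarrow> v \<in> V \<Longrightarrow> norm (\<kappa> (v \<otimes> x) - \<kappa> x) \<le> e"
      by (rule uniformly_continuousE) blast
    have "norm (coefficient F y) \<le> 1" if "y \<in> carrier G" for y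
      using norm_coefficient_le[OF bF that] eF by simp
    then have "norm (convolution \<kappa> (coefficient F) (w \<otimes> x) - convolution \<kappa> (coefficient F) x) \<le> e"
      if "w \<in> V" "x \<in> carrier G" for w x
      using V that by (intro convolution_equicontinuous b\<kappa>) auto
    then show "\<exists>V. openin T V \<and> \<one> \<in> V \<and> (\<forall>x\<in>carrier G. \<forall>v\<in>V.
        norm (convolution \<kappa> (coefficient F) (v \<otimes> x) - convolution \<kappa> (coefficient F) x) \<le> e)"
      using V by blast
  qed
  then have "0 < energy (convolution \<kappa> (coefficient F))"
    using one_closed nz by (rule energy_pos[rotated]) (intro bounded_on_convolution b\<kappa> bounded_on_coefficient bF)
  also have "\<dots> \<le> max_energy \<kappa>" using b\<kappa> bF eF by (rule energy_le_max)
  finally show thesis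
    using character_from_kernel[OF b\<kappa> \<kappa>_ucont _ b(1) b\<phi> \<kappa>_eq] that by blast
qed

end

section \<open>Homomorphisms to the real numbers\<close>

definition real_hom :: "('a, 'm) monoid_scheme \<Rightarrow> ('a \<Rightarrow> real) \<Rightarrow> bool" where
  "real_hom G \<alpha> \<longleftrightarrow> (\<forall>x\<in>carrier G. \<forall>y\<in>carrier G. \<alpha> (x \<otimes>\<^bsub>G\<^esub> y) = \<alpha> x + \<alpha> y)"

context comm_group
begin

text \<open>The graph of a homomorphism from a subgroup to \<real>; as a set of pairs it can be
  enlarged and united along chains. Single-valuedness is reduced to the fibre over
  \<open>\<one>\<close>.\<close>

definition partial_real_hom :: "('a \<times> real) set \<Rightarrow> bool" where
  "partial_real_hom P \<longleftrightarrow> P \<subseteq> carrier G \<times> UNIV \<and> (\<one>, 0) \<in> P \<and>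
    (\<forall>x s y t. (x, s) \<in> P \<longrightarrow> (y, t) \<in> P \<longrightarrow> (x \<otimes> y, s + t) \<in> P) \<and>
    (\<forall>x s. (x, s) \<in> P \<longrightarrow> (inv x, - s) \<in> P) \<and> (\<forall>s. (\<one>, s) \<in> P \<longrightarrow> s = 0)"

lemma partial_real_hom_int_pow:
  assumes P: "partial_real_hom P" and x: "(x, s) \<in> P"
  shows "(x [^] (i::int), of_int i * s) \<in> P"
proof -
  have xc: "x \<in> carrier G" using P x by (auto simp: partial_real_hom_def)
  have nat: "(x [^] n, real n * s) \<in> P" for n :: nat
  proof (induction n)
    case (Suc n)
    then have "(x [^] n \<otimes> x, real n * s + s) \<in> P" using P x unfolding partial_real_hom_def by blast
    then show ?case by (simp add: algebra_simps)
  qed (use P in \<open>simp add: partial_real_hom_def\<close>)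
  show ?thesis
  proof (cases i rule: int_cases2)
    case (nonneg n)
    then show ?thesis using nat[of n] by (simp add: int_pow_int)
  next
    case (nonpos n)
    have "(inv (x [^] n), - (real n * s)) \<in> P" using nat[of n] P unfolding partial_real_hom_def by blast
    then show ?thesis using nonpos xc by (simp add: int_pow_neg_int)
  qed
qed

text \<open>Divisibility of \<real>: if a positive power x^n is in the domain with value r, then t =
  r / n is forced; otherwise any \<open>t\<close> will do, and 0 is taken.\<close>

lemma partial_real_hom_extend:
  assumes P: "partial_real_hom P" and x: "x \<in> carrier G"
  obtains t P' where "partial_real_hom P'" "P \<subseteq> P'" "(x, t) \<in> P'"
proof -
  have Pc: "y \<in> carrier G" if "(y, s) \<in> P" for y s using P that by (auto simp: partial_real_hom_def)
  have Pmult: "(y \<otimes> z, s + r) \<in> P" if "(y, s) \<in> P" "(z, r) \<in> P" for y z s r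
    using P that unfolding partial_real_hom_def by blast
  have Pinv: "(inv y, - s) \<in> P" if "(y, s) \<in> P" for y s
    using P that unfolding partial_real_hom_def by blast
  have Pone: "s = 0" if "(\<one>, s) \<in> P" for s
    using P that unfolding partial_real_hom_def by blast
  obtain t where t: "n > 0 \<Longrightarrow> (x [^] n, r) \<in> P \<Longrightarrow> r = real n * t" for n :: nat and r
  proof (cases "\<exists>n r. n > 0 \<and> (x [^] (n::nat), r) \<in> P")
    case True
    then obtain n r where n: "n > 0" "(x [^] (n::nat), r) \<in> P" by blast
    \<comment> \<open>Independence of the chosen power: the value at x^(n m) is computed from x^m
      and from x^n.\<close>
    have "r' = real m * (r / real n)" if m: "m > 0" "(x [^] m, r') \<in> P" for m :: nat and r'
    proof -
      have "((x [^] m) [^] int n, of_int (int n) * r') \<in> P" "((x [^] n) [^] (- int m), of_int (- int m) * r) \<in> P"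
        by (rule partial_real_hom_int_pow[OF P m(2)], rule partial_real_hom_int_pow[OF P n(2)])
      note Pmult[OF this]
      moreover have "(x [^] m) [^] int n = x [^] (n * m)" "(x [^] n) [^] (- int m) = inv (x [^] (n * m))"
        using x by (simp_all add: int_pow_int int_pow_neg_int nat_pow_pow mult.commute)
      ultimately have "(\<one>, of_int (int n) * r' + of_int (- int m) * r) \<in> P" using x by simp
      from Pone[OF this] show ?thesis using n(1) by (simp add: field_simps)
    qed
    then show thesis by (rule that)
  next
    case False
    then show thesis by (intro that[of 0]) blast
  qed
  have t': "of_int i * t = r" if i: "(x [^] (i::int), r) \<in> P" for i r
  proof (cases i rule: int_cases3)
    case zero
    then show ?thesis using Pone i by simp
  next
    case (pos n)
    then show ?thesis using t[of n r] i by (simp add: int_pow_int)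
  next
    case (neg n)
    have "(inv (x [^] i), - r) \<in> P" using Pinv[OF i] .
    moreover have "inv (x [^] i) = x [^] n" using x neg by (simp add: int_pow_neg_int)
    ultimately have "- r = real n * t" using t neg by simp
    then show ?thesis using neg by simp
  qed
  define P' where "P' = {(x [^] (i::int) \<otimes> y, of_int i * t + s) | i y s. (y, s) \<in> P}"
  show thesis
  proof
    show "P \<subseteq> P'"
    proof
      fix p assume p: "p \<in> P"
      then have "p = (x [^] (0::int) \<otimes> fst p, of_int 0 * t + snd p)" using Pc[of "fst p" "snd p"] by simp
      then show "p \<in> P'" unfolding P'_def using p by (metis (mono_tags, lifting) mem_Collect_eq prod.collapse)
    qed
    have one: "(\<one>, 0) \<in> P" using P by (simp add: partial_real_hom_def)
    have "(x, t) = (x [^] (1::int) \<otimes> \<one>, of_int 1 * t + 0)" using x by simp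
    then show "(x, t) \<in> P'" unfolding P'_def using one by blast
    show "partial_real_hom P'"
      unfolding partial_real_hom_def
    proof (intro conjI allI impI)
      show "P' \<subseteq> carrier G \<times> UNIV" using x Pc by (auto simp: P'_def)
      show "(\<one>, 0) \<in> P'" using \<open>P \<subseteq> P'\<close> one by blast
      fix a s assume "(a, s) \<in> P'"
      then obtain i y u where y: "a = x [^] (i::int) \<otimes> y" "s = of_int i * t + u" "(y, u) \<in> P"
        by (auto simp: P'_def)
      have "(inv a, - s) = (x [^] (- i) \<otimes> inv y, of_int (- i) * t + - u)"
        using y x Pc by (simp add: inv_mult int_pow_neg)
      then show "(inv a, - s) \<in> P'" unfolding P'_def using Pinv[OF y(3)] by blast
      fix b r assume "(b, r) \<in> P'"
      then obtain j z v where z: "b = x [^] (j::int) \<otimes> z" "r = of_int j * t + v" "(z, v) \<in> P"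
        by (auto simp: P'_def)
      have "(a \<otimes> b, s + r) = (x [^] (i + j) \<otimes> (y \<otimes> z), of_int (i + j) * t + (u + v))"
        using y z x Pc by (simp add: int_pow_mult m_ac algebra_simps)
      then show "(a \<otimes> b, s + r) \<in> P'" unfolding P'_def using Pmult[OF y(3) z(3)] by blast
    next
      fix s assume "(\<one>, s) \<in> P'"
      then obtain i y u where y: "\<one> = x [^] (i::int) \<otimes> y" "s = of_int i * t + u" "(y, u) \<in> P"
        by (auto simp: P'_def)
      have "x [^] i = inv y" using y(1) x Pc[OF y(3)] by (metis int_pow_closed inv_equality)
      then show "s = 0" using t'[of i "- u"] Pinv[OF y(3)] y(2) by simp
    qed
  qed
qed

text \<open>Zorn's lemma extends the map a^i \<mapsto> i to the whole group; it is well defined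
  because \<open>a\<close> has infinite order.\<close>

lemma real_hom_nonzero:
  assumes tf: "\<forall>x\<in>carrier G. \<forall>n>0. x [^] (n::nat) = \<one> \<longrightarrow> x = \<one>"
    and a: "a \<in> carrier G" "a \<noteq> \<one>"
  obtains \<alpha> where "real_hom G \<alpha>" "\<alpha> a \<noteq> 0"
proof -
  define \<A> where "\<A> = {P. partial_real_hom P \<and> (a, 1) \<in> P}"
  have "\<A> \<noteq> {}"
  proof -
    define P where "P = {(a [^] (i::int), real_of_int i) | i. True}"
    have "partial_real_hom P"
      unfolding partial_real_hom_def
    proof (intro conjI allI impI)
      show "P \<subseteq> carrier G \<times> UNIV" using a by (auto simp: P_def)
      show "(\<one>, 0) \<in> P" unfolding P_def by (rule CollectI, rule exI[of _ 0]) simp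
      fix x s assume "(x, s) \<in> P"
      then obtain i where i: "x = a [^] (i::int)" "s = of_int i" by (auto simp: P_def)
      have "(inv x, - s) = (a [^] (- i), of_int (- i))" using i a by (simp add: int_pow_neg)
      then show "(inv x, - s) \<in> P" unfolding P_def by blast
      fix y t assume "(y, t) \<in> P"
      then obtain j where j: "y = a [^] (j::int)" "t = of_int j" by (auto simp: P_def)
      have "(x \<otimes> y, s + t) = (a [^] (i + j), of_int (i + j))" using i j a by (simp add: int_pow_mult)
      then show "(x \<otimes> y, s + t) \<in> P" unfolding P_def by blast
    next
      fix s assume "(\<one>, s) \<in> P"
      then obtain i where i: "a [^] (i::int) = \<one>" "s = of_int i" by (auto simp: P_def)
      have "a [^] nat \<bar>i\<bar> = \<one>"
      proof (cases i rule: int_cases2)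
        case (nonneg n) then show ?thesis using i(1) by (simp add: int_pow_int)
      next
        case (nonpos n)
        then have "inv (a [^] n) = \<one>" using i(1) a(1) by (simp add: int_pow_neg_int)
        then show ?thesis using nonpos a(1) by (metis abs_minus_cancel abs_of_nat inv_inv inv_one nat_int nat_pow_closed)
      qed
      then have "\<not> nat \<bar>i\<bar> > 0" using tf a by blast
      then show "s = 0" using i(2) by simp
    qed
    moreover have "(a, 1) \<in> P" unfolding P_def using a by (intro CollectI exI[of _ 1]) simp
    ultimately show ?thesis by (auto simp: \<A>_def)
  qed
  moreover have "\<Union>\<C> \<in> \<A>" if ne: "\<C> \<noteq> {}" and ch: "subset.chain \<A> \<C>" for \<C>
  proof -
    have sub: "partial_real_hom P" "(a, 1) \<in> P" if "P \<in> \<C>" for P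
      using ch that by (auto simp: subset.chain_def \<A>_def)
    have two: "\<exists>R\<in>\<C>. p \<in> R \<and> q \<in> R" if pq: "p \<in> \<Union>\<C>" "q \<in> \<Union>\<C>" for p q
    proof -
      obtain R S where RS: "R \<in> \<C>" "p \<in> R" "S \<in> \<C>" "q \<in> S" using pq by blast
      then have "R \<subseteq> S \<or> S \<subseteq> R" using ch unfolding subset_chain_def by blast
      then show ?thesis using RS by blast
    qed
    obtain P0 where "P0 \<in> \<C>" using ne by blast
    have "partial_real_hom (\<Union>\<C>)"
      unfolding partial_real_hom_def
    proof (intro conjI allI impI)
      show "\<Union>\<C> \<subseteq> carrier G \<times> UNIV" using sub(1) unfolding partial_real_hom_def by blast
      show "(\<one>, 0) \<in> \<Union>\<C>" using sub(1)[OF \<open>P0 \<in> \<C>\<close>] \<open>P0 \<in> \<C>\<close> unfolding partial_real_hom_def by blast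
      fix x s
      show "(inv x, - s) \<in> \<Union>\<C>" if "(x, s) \<in> \<Union>\<C>"
        using that sub(1) unfolding partial_real_hom_def by blast
      show "s = 0" if "(\<one>, s) \<in> \<Union>\<C>"
        using that sub(1) unfolding partial_real_hom_def by blast
      fix y t assume "(x, s) \<in> \<Union>\<C>" "(y, t) \<in> \<Union>\<C>"
      then obtain R where "R \<in> \<C>" "(x, s) \<in> R" "(y, t) \<in> R" using two by blast
      then show "(x \<otimes> y, s + t) \<in> \<Union>\<C>" using sub(1) unfolding partial_real_hom_def by blast
    qed
    then show ?thesis using sub(2)[OF \<open>P0 \<in> \<C>\<close>] \<open>P0 \<in> \<C>\<close> by (auto simp: \<A>_def)
  qed
  ultimately obtain P where P: "P \<in> \<A>" "\<And>X. X \<in> \<A> \<Longrightarrow> P \<subseteq> X \<Longrightarrow> X = P"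
    using subset_Zorn_nonempty[of \<A>] by blast
  then have hom: "partial_real_hom P" and aP: "(a, 1) \<in> P" by (auto simp: \<A>_def)
  have total: "\<exists>s. (x, s) \<in> P" if x: "x \<in> carrier G" for x
  proof -
    obtain t P' where P': "partial_real_hom P'" "P \<subseteq> P'" "(x, t) \<in> P'"
      using partial_real_hom_extend[OF hom x] by blast
    then have "P' = P" using P(2) aP by (auto simp: \<A>_def)
    then show ?thesis using P'(3) by blast
  qed
  have unique: "s = t" if "(x, s) \<in> P" "(x, t) \<in> P" for x s t
  proof -
    have "x \<in> carrier G" using hom that by (auto simp: partial_real_hom_def)
    moreover have "(x \<otimes> inv x, s + - t) \<in> P"
      using hom that unfolding partial_real_hom_def by blast
    ultimately show ?thesis using hom unfolding partial_real_hom_def by auto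
  qed
  define \<alpha> where "\<alpha> = (\<lambda>x. SOME s. (x, s) \<in> P)"
  have \<alpha>: "(x, \<alpha> x) \<in> P" if "x \<in> carrier G" for x
    unfolding \<alpha>_def using total[OF that] by (rule someI_ex)
  show thesis
  proof
    show "real_hom G \<alpha>"
      unfolding real_hom_def
    proof (intro ballI)
      fix x y assume xy: "x \<in> carrier G" "y \<in> carrier G"
      then have "(x \<otimes> y, \<alpha> x + \<alpha> y) \<in> P"
        using hom \<alpha> unfolding partial_real_hom_def by blast
      then show "\<alpha> (x \<otimes> y) = \<alpha> x + \<alpha> y" using unique \<alpha> xy by blast
    qed
    show "\<alpha> a \<noteq> 0" using unique[OF \<alpha>[OF a(1)] aP] by simp
  qed
qed

text \<open>A generic combination \<alpha> + s \<beta> is nonzero at each of finitely many points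
  where \<alpha> or \<beta> is nonzero.\<close>

lemma real_hom_nonzero_on_finite:
  assumes tf: "\<forall>x\<in>carrier G. \<forall>n>0. x [^] (n::nat) = \<one> \<longrightarrow> x = \<one>"
    and F: "finite F" "F \<subseteq> carrier G" "\<one> \<notin> F"
  obtains \<alpha> where "real_hom G \<alpha>" "\<And>x. x \<in> F \<Longrightarrow> \<alpha> x \<noteq> 0"
proof -
  have "\<exists>\<alpha>. real_hom G \<alpha> \<and> (\<forall>x\<in>F. \<alpha> x \<noteq> 0)"
    using F
  proof (induction F)
    case empty
    have "real_hom G (\<lambda>x. 0)" by (simp add: real_hom_def)
    then show ?case by blast
  next
    case (insert a F)
    then obtain \<alpha> where \<alpha>: "real_hom G \<alpha>" "\<forall>x\<in>F. \<alpha> x \<noteq> 0" by auto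
    obtain \<beta> where \<beta>: "real_hom G \<beta>" "\<beta> a \<noteq> 0"
      using real_hom_nonzero[OF tf, where a = a] insert.prems by auto
    \<comment> \<open>The excluded values are the zeros of \<alpha> + s \<beta> as a function of
      \<open>s\<close>. If \<open>\<beta> x\<close> = 0, the quotient is 0 by convention, which
      excludes s = 0 and does no harm; there \<open>\<alpha> x\<close> \<noteq> 0 is used
      instead.\<close>
    obtain s where s: "s \<notin> (\<lambda>x. - \<alpha> x / \<beta> x) ` insert a F"
      using ex_new_if_finite[of "(\<lambda>x. - \<alpha> x / \<beta> x) ` insert a F"] insert.hyps(1) infinite_UNIV_char_0 by blast
    have "real_hom G (\<lambda>x. \<alpha> x + s * \<beta> x)"
      using \<alpha>(1) \<beta>(1) by (simp add: real_hom_def algebra_simps)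
    moreover have "\<alpha> x + s * \<beta> x \<noteq> 0" if x: "x \<in> insert a F" for x
    proof (cases "\<beta> x = 0")
      case True
      then show ?thesis using x \<alpha>(2) \<beta>(2) by auto
    next
      case False
      have "s \<noteq> - \<alpha> x / \<beta> x" using s x by blast
      then show ?thesis using False by (simp add: field_simps)
    qed
    ultimately show ?case by blast
  qed
  then show thesis using that by blast
qed

end

section \<open>One-parameter subgroups of compact connected abelian groups\<close>

lemma real_group_simps [simp]:
  "carrier real_group = UNIV" "x \<otimes>\<^bsub>real_group\<^esub> y = x + y" "\<one>\<^bsub>real_group\<^esub> = 0"
  by (simp_all add: real_group_def)

lemma comm_group_real_group: "comm_group real_group"
proof (rule comm_groupI)
  fix x assume "x \<in> carrier real_group"
  show "\<exists>y\<in>carrier real_group. y \<otimes>\<^bsub>real_group\<^esub> x = \<one>\<^bsub>real_group\<^esub>"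
    by (rule bexI[of _ "- x"]) auto
qed auto

text \<open>Characters are normalised outside the carrier to make \<open>dual_group\<close> a group.\<close>

definition dual :: "('a, 'm) monoid_scheme \<Rightarrow> 'a topology \<Rightarrow> ('a \<Rightarrow> complex) set" where
  "dual G T = {\<psi>. character G \<psi> \<and> continuous_map T euclidean \<psi> \<and> (\<forall>x. x \<notin> carrier G \<longrightarrow> \<psi> x = 1)}"

definition dual_group :: "('a, 'm) monoid_scheme \<Rightarrow> 'a topology \<Rightarrow> ('a \<Rightarrow> complex) monoid" where
  "dual_group G T = \<lparr>carrier = dual G T, mult = (\<lambda>\<phi> \<psi> x. \<phi> x * \<psi> x), one = (\<lambda>x. 1)\<rparr>"

lemma dual_group_simps [simp]:
  "carrier (dual_group G T) = dual G T" "\<phi> \<otimes>\<^bsub>dual_group G T\<^esub> \<psi> = (\<lambda>x. \<phi> x * \<psi> x)"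
  "\<one>\<^bsub>dual_group G T\<^esub> = (\<lambda>x. 1)"
  by (simp_all add: dual_group_def)

lemma continuous_map_complex_mult:
  fixes f g :: "'a \<Rightarrow> complex"
  shows "continuous_map X euclidean f \<Longrightarrow> continuous_map X euclidean g \<Longrightarrow>
    continuous_map X euclidean (\<lambda>x. f x * g x)"
  by (simp add: continuous_map_atin tendsto_mult)

lemma dual_one: "(\<lambda>x. 1) \<in> dual G T"
  by (simp add: dual_def character_one)

lemma dual_times: "\<phi> \<in> dual G T \<Longrightarrow> \<psi> \<in> dual G T \<Longrightarrow> (\<lambda>x. \<phi> x * \<psi> x) \<in> dual G T"
  by (auto simp: dual_def character_times intro: continuous_map_complex_mult)

lemma continuous_map_cnj:
  "continuous_map X euclidean f \<Longrightarrow> continuous_map X euclidean (\<lambda>x. cnj (f x))"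
  using continuous_map_compose[of X euclidean f euclidean cnj] by (simp add: o_def continuous_on_cnj)

lemma dual_cnj: "\<phi> \<in> dual G T \<Longrightarrow> (\<lambda>x. cnj (\<phi> x)) \<in> dual G T"
  by (auto simp: dual_def character_cnj intro: continuous_map_cnj)

lemma dual_power: "\<phi> \<in> dual G T \<Longrightarrow> (\<lambda>x. \<phi> x ^ n) \<in> dual G T"
proof (induction n)
  case (Suc n)
  then show ?case using dual_times[of \<phi> G T "\<lambda>x. \<phi> x ^ n"] by simp
qed (simp add: dual_one)

lemma dual_prod: "(\<And>i. i \<in> I \<Longrightarrow> \<phi> i \<in> dual G T) \<Longrightarrow> (\<lambda>x. \<Prod>i\<in>I. \<phi> i x) \<in> dual G T"
proof (induction I rule: infinite_finite_induct)
  case (insert i I)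
  then show ?case using dual_times[of "\<phi> i" G T "\<lambda>x. \<Prod>i\<in>I. \<phi> i x"] by simp
qed (simp_all add: dual_one)

lemma norm_dual: "\<phi> \<in> dual G T \<Longrightarrow> norm (\<phi> x) = 1"
  by (cases "x \<in> carrier G") (auto simp: dual_def norm_character)

lemma comm_group_dual_group: "comm_group (dual_group G T)"
proof (rule comm_groupI)
  fix \<phi> assume "\<phi> \<in> carrier (dual_group G T)"
  then show "\<exists>\<psi>\<in>carrier (dual_group G T). \<psi> \<otimes>\<^bsub>dual_group G T\<^esub> \<phi> = \<one>\<^bsub>dual_group G T\<^esub>"
    by (intro bexI[of _ "\<lambda>x. cnj (\<phi> x)"]) (auto simp: dual_cnj norm_dual mult_cnj_eq_1 mult.commute[of "cnj _"])
qed (auto simp: dual_one dual_times mult.commute mult.left_commute)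

lemma real_hom_dual:
  assumes \<alpha>: "real_hom (dual_group G T) \<alpha>"
  shows real_hom_dual_one: "\<alpha> (\<lambda>x. 1) = 0"
    and real_hom_dual_times: "\<phi> \<in> dual G T \<Longrightarrow> \<psi> \<in> dual G T \<Longrightarrow> \<alpha> (\<lambda>x. \<phi> x * \<psi> x) = \<alpha> \<phi> + \<alpha> \<psi>"
    and real_hom_dual_cnj: "\<phi> \<in> dual G T \<Longrightarrow> \<alpha> (\<lambda>x. cnj (\<phi> x)) = - \<alpha> \<phi>"
    and real_hom_dual_power: "\<phi> \<in> dual G T \<Longrightarrow> \<alpha> (\<lambda>x. \<phi> x ^ n) = real n * \<alpha> \<phi>"
    and real_hom_dual_prod: "(\<And>i. i \<in> I \<Longrightarrow> \<theta> i \<in> dual G T) \<Longrightarrow> \<alpha> (\<lambda>x. \<Prod>i\<in>I. \<theta> i x) = (\<Sum>i\<in>I. \<alpha> (\<theta> i))"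
proof -
  have times: "\<alpha> (\<lambda>x. \<phi> x * \<psi> x) = \<alpha> \<phi> + \<alpha> \<psi>" if "\<phi> \<in> dual G T" "\<psi> \<in> dual G T" for \<phi> \<psi>
    using \<alpha> that by (simp add: real_hom_def)
  have one: "\<alpha> (\<lambda>x. 1) = 0" using times[OF dual_one dual_one] by simp
  show "\<alpha> (\<lambda>x. 1) = 0" by (fact one)
  show "\<alpha> (\<lambda>x. \<phi> x * \<psi> x) = \<alpha> \<phi> + \<alpha> \<psi>" if "\<phi> \<in> dual G T" "\<psi> \<in> dual G T" using that by (rule times)
  show "\<alpha> (\<lambda>x. cnj (\<phi> x)) = - \<alpha> \<phi>" if "\<phi> \<in> dual G T"
    using times[OF that dual_cnj[OF that]] one that by (simp add: mult_cnj_eq_1 norm_dual)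
  show "\<alpha> (\<lambda>x. \<phi> x ^ n) = real n * \<alpha> \<phi>" if "\<phi> \<in> dual G T"
  proof (induction n)
    case (Suc n)
    then show ?case using times[OF that dual_power[OF that]] by (simp add: algebra_simps)
  qed (simp add: one)
  show "\<alpha> (\<lambda>x. \<Prod>i\<in>I. \<theta> i x) = (\<Sum>i\<in>I. \<alpha> (\<theta> i))" if "\<And>i. i \<in> I \<Longrightarrow> \<theta> i \<in> dual G T"
    using that
  proof (induction I rule: infinite_finite_induct)
    case (insert i I)
    then show ?case using times[OF _ dual_prod, of "\<theta> i" I \<theta>] by simp
  qed (simp_all add: one)
qed

section \<open>Monomials in characters\<close>

lemma cis_sum: "cis (\<Sum>i\<in>I. f i) = (\<Prod>i\<in>I. cis (f i))"
  by (induction I rule: infinite_finite_induct) (simp_all flip: cis_mult)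

text \<open>For \<open>J\<close> in the dual, an element of the subgroup generated by
  \<open>J\<close>. Separate natural exponents for \<phi> and for its inverse match the relations in
  \<open>kronecker_approximation\<close>.\<close>

definition monomial :: "('a \<Rightarrow> complex) set \<Rightarrow> (('a \<Rightarrow> complex) \<Rightarrow> nat) \<Rightarrow> (('a \<Rightarrow> complex) \<Rightarrow> nat) \<Rightarrow> 'a \<Rightarrow> complex" where
  "monomial J k l x = (\<Prod>\<phi>\<in>J. \<phi> x ^ k \<phi> * cnj (\<phi> x) ^ l \<phi>)"

lemma monomial_in_dual: "J \<subseteq> dual G T \<Longrightarrow> monomial J k l \<in> dual G T"
  unfolding monomial_def[abs_def]
  by (intro dual_prod dual_times dual_power dual_cnj) auto

text \<open>For fixed \<open>t\<close> the targets \<open>cis (\<alpha> \<phi> * t)\<close> are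
  multiplicative in \<phi>. So relations between characters pass to the targets; conversely, a
  relation that holds for all \<open>t\<close> says that \<alpha> vanishes on the monomial.\<close>

lemma cis_real_hom_monomial:
  assumes "real_hom (dual_group G T) \<alpha>" "J \<subseteq> dual G T"
  shows "cis (\<alpha> (monomial J k l) * t) = (\<Prod>\<phi>\<in>J. cis (\<alpha> \<phi> * t) ^ k \<phi> * cnj (cis (\<alpha> \<phi> * t)) ^ l \<phi>)"
proof -
  have "\<alpha> (monomial J k l) = (\<Sum>\<phi>\<in>J. \<alpha> (\<lambda>x. \<phi> x ^ k \<phi> * cnj (\<phi> x) ^ l \<phi>))"
    unfolding monomial_def[abs_def] using assms
    by (intro real_hom_dual_prod[OF assms(1)] dual_times dual_power dual_cnj) auto
  also have "\<dots> = (\<Sum>\<phi>\<in>J. real (k \<phi>) * \<alpha> \<phi> - real (l \<phi>) * \<alpha> \<phi>)"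
  proof (rule sum.cong[OF refl])
    fix \<phi> assume "\<phi> \<in> J"
    then have "\<phi> \<in> dual G T" using assms(2) by blast
    then show "\<alpha> (\<lambda>x. \<phi> x ^ k \<phi> * cnj (\<phi> x) ^ l \<phi>) = real (k \<phi>) * \<alpha> \<phi> - real (l \<phi>) * \<alpha> \<phi>"
      using real_hom_dual_times[OF assms(1) dual_power dual_power[OF dual_cnj], of \<phi> \<phi> "k \<phi>" "l \<phi>"]
      by (simp add: real_hom_dual_power[OF assms(1)] real_hom_dual_cnj[OF assms(1)] dual_cnj)
  qed
  finally have "\<alpha> (monomial J k l) * t = (\<Sum>\<phi>\<in>J. real (k \<phi>) * (\<alpha> \<phi> * t) + real (l \<phi>) * - (\<alpha> \<phi> * t))"
    by (simp add: sum_distrib_right left_diff_distrib mult.assoc)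
  then show ?thesis by (simp add: cis_sum Complex.DeMoivre cis_cnj cis_mult)
qed

section \<open>The dual of a compact abelian group and one-parameter subgroups\<close>

context compact_group_mean
begin

lemma dual_separates_points:
  assumes "x \<in> carrier G" "\<And>\<psi>. \<psi> \<in> dual G T \<Longrightarrow> \<psi> x = 1"
  shows "x = \<one>"
proof (rule ccontr)
  assume "x \<noteq> \<one>"
  then obtain \<psi> where \<psi>: "character G \<psi>" "continuous_map T euclidean \<psi>" "\<psi> x \<noteq> 1"
    using characters_separate_points assms(1) by blast
  have "(\<lambda>y. if y \<in> carrier G then \<psi> y else 1) \<in> dual G T"
    unfolding dual_def
  proof (intro CollectI conjI)
    show "character G (\<lambda>y. if y \<in> carrier G then \<psi> y else 1)" using \<psi>(1) by (simp add: character_def)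
    show "continuous_map T euclidean (\<lambda>y. if y \<in> carrier G then \<psi> y else 1)"
      using \<psi>(2) by (rule continuous_map_eq) (simp add: topspace_eq_carrier)
  qed simp
  from assms(2)[OF this] show False using \<psi>(3) assms(1) by simp
qed

text \<open>The finite intersection property: values that can be met approximately for finitely many
  characters at a time can be met exactly for all. This yields both the points
  \<open>\<gamma> t\<close> and the description of neighbourhoods by characters.\<close>

lemma dual_compactness:
  assumes S: "closedin T S"
    and approx: "\<And>J e. finite J \<Longrightarrow> J \<subseteq> dual G T \<Longrightarrow> e > 0 \<Longrightarrow> \<exists>x\<in>S. \<forall>\<psi>\<in>J. norm (\<psi> x - E \<psi>) \<le> e"
  shows "\<exists>x\<in>S. \<forall>\<psi>\<in>dual G T. \<psi> x = E \<psi>"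
proof -
  define A where "A = (\<lambda>(\<psi>, e). {x \<in> topspace T. \<psi> x \<in> cball (E \<psi>) e})"
  have cl: "closedin T (A p)" if "p \<in> dual G T \<times> {0<..}" for p
    using that unfolding A_def case_prod_unfold
    by (intro closedin_continuous_map_preimage[where Y = euclidean]) (auto simp: dual_def)
  have "compactin T S" using compact S by (rule closedin_compact_space)
  then have fip: "S \<inter> \<Inter>\<U> \<noteq> {}"
    if "\<forall>C\<in>\<U>. closedin T C" "\<forall>\<F>. finite \<F> \<and> \<F> \<subseteq> \<U> \<longrightarrow> S \<inter> \<Inter>\<F> \<noteq> {}" for \<U>
    using that unfolding compactin_fip by simp
  have fin: "S \<inter> \<Inter>\<F> \<noteq> {}" if \<F>: "finite \<F>" "\<F> \<subseteq> A ` (dual G T \<times> {0<..})" for \<F>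
  proof -
    obtain P where P: "P \<subseteq> dual G T \<times> {0<..}" "finite P" "\<F> = A ` P"
      using \<F> by (metis finite_subset_image)
    define e where "e = Min (insert 1 (snd ` P))"
    have e: "e > 0" "\<And>p. p \<in> P \<Longrightarrow> e \<le> snd p"
      unfolding e_def using P(1,2) by (auto simp: Min_gr_iff)
    have "fst ` P \<subseteq> dual G T" using P(1) by auto
    then obtain x where x: "x \<in> S" "\<forall>\<psi>\<in>fst ` P. norm (\<psi> x - E \<psi>) \<le> e"
      using approx[of "fst ` P" e] P(2) e(1) by blast
    have "x \<in> A p" if "p \<in> P" for p
      using that x e(2)[OF that] closedin_subset[OF S]
      by (force simp: A_def dist_norm norm_minus_commute case_prod_unfold)
    then show ?thesis using x(1) P(3) by blast
  qed
  have "S \<inter> \<Inter>(A ` (dual G T \<times> {0<..})) \<noteq> {}"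
    by (rule fip) (use cl fin in auto)
  then obtain x where x: "x \<in> S" "\<And>\<psi> e. \<psi> \<in> dual G T \<Longrightarrow> e > 0 \<Longrightarrow> x \<in> A (\<psi>, e)" by auto
  show ?thesis
  proof (intro bexI ballI)
    fix \<psi> assume \<psi>: "\<psi> \<in> dual G T"
    have "dist (E \<psi>) (\<psi> x) \<le> 0"
      by (rule field_le_epsilon) (use x(2)[OF \<psi>] in \<open>auto simp: A_def\<close>)
    then show "\<psi> x = E \<psi>" by simp
  qed (fact x(1))
qed

text \<open>If no finite set of characters sufficed, \<open>dual_compactness\<close> would give a
  point in the complement of \<open>V\<close> at which all characters are 1; as characters separate
  points, it would be \<open>\<one>\<close>.\<close>

lemma dual_neighborhood:
  assumes V: "openin T V" "\<one> \<in> V"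
  obtains J e where "finite J" "J \<subseteq> dual G T" "e > 0"
    "\<And>x. x \<in> carrier G \<Longrightarrow> (\<And>\<psi>. \<psi> \<in> J \<Longrightarrow> norm (\<psi> x - 1) \<le> e) \<Longrightarrow> x \<in> V"
proof -
  have "\<exists>J e. finite J \<and> J \<subseteq> dual G T \<and> e > 0 \<and>
    (\<forall>x\<in>carrier G. (\<forall>\<psi>\<in>J. norm (\<psi> x - 1) \<le> e) \<longrightarrow> x \<in> V)"
  proof (rule ccontr)
    assume contra: "\<not> ?thesis"
    have approx: "\<exists>x\<in>carrier G - V. \<forall>\<psi>\<in>J. norm (\<psi> x - 1) \<le> e"
      if "finite J" "J \<subseteq> dual G T" "e > 0" for J e
      using contra that by blast
    have cl: "closedin T (carrier G - V)"
      using closedin_diff[OF closedin_topspace V(1)] by (simp add: topspace_eq_carrier)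
    from dual_compactness[where E = "\<lambda>_. 1", OF cl approx]
    obtain x where "x \<in> carrier G - V" "\<And>\<psi>. \<psi> \<in> dual G T \<Longrightarrow> \<psi> x = 1" by blast
    then show False using dual_separates_points V(2) by auto
  qed
  then obtain J e where J: "finite J" "J \<subseteq> dual G T" "e > 0"
    "\<forall>x\<in>carrier G. (\<forall>\<psi>\<in>J. norm (\<psi> x - 1) \<le> e) \<longrightarrow> x \<in> V" by blast
  show thesis by (rule that[OF J(1-3)]) (simp add: J(4))
qed

text \<open>The image is connected and lies in the finite set of \<open>n\<close>-th roots of unity,
  so it is a single point.\<close>

lemma dual_torsion_free:
  assumes "connected_space T" and \<psi>: "\<psi> \<in> dual G T" "n > 0" "\<And>x. \<psi> x ^ n = 1"
  shows "\<psi> = (\<lambda>x. 1)"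
proof -
  have "connectedin euclidean (\<psi> ` topspace T)"
    using \<psi>(1) assms(1) by (intro connectedin_continuous_map_image[of T]) (auto simp: dual_def connectedin_topspace)
  then have "connected (\<psi> ` carrier G)" by (simp add: topspace_eq_carrier)
  moreover have "\<psi> ` carrier G \<subseteq> {z. z ^ n = 1}" using \<psi>(3) by auto
  then have "finite (\<psi> ` carrier G)" using \<psi>(2) finite_nth_roots finite_subset by blast
  ultimately obtain a where "\<psi> ` carrier G = {a}"
    using connected_finite_iff_sing by (metis empty_iff image_is_empty one_closed)
  moreover have "\<psi> \<one> = 1" using \<psi>(1) by (simp add: dual_def character_at_one)
  ultimately have "\<psi> x = 1" if "x \<in> carrier G" for x using that by (metis imageI one_closed singletonD)
  then show ?thesis using \<psi>(1) unfolding dual_def by blast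
qed

text \<open>Kronecker's theorem in \<open>G\<close> meets finitely many of the prescribed values
  approximately, and \<open>dual_compactness\<close> then meets all of them exactly. As characters
  determine points and neighbourhoods, additivity and continuity of \<gamma> are inherited from
  \<open>cis\<close>.\<close>

lemma one_parameter_subgroup_of_real_hom:
  assumes \<alpha>: "real_hom (dual_group G T) \<alpha>"
  obtains \<gamma> :: "real \<Rightarrow> 'a" where "continuous_map euclidean T \<gamma>" "\<And>t. \<gamma> t \<in> carrier G"
    "\<And>s t. \<gamma> (s + t) = \<gamma> s \<otimes> \<gamma> t" "\<And>\<psi> t. \<psi> \<in> dual G T \<Longrightarrow> \<psi> (\<gamma> t) = cis (\<alpha> \<psi> * t)"
proof -
  have "\<exists>x. x \<in> carrier G \<and> (\<forall>\<psi>\<in>dual G T. \<psi> x = cis (\<alpha> \<psi> * t))" for t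
  proof -
    have "\<exists>x\<in>carrier G. \<forall>\<psi>\<in>J. norm (\<psi> x - cis (\<alpha> \<psi> * t)) \<le> e"
      if J: "finite J" "J \<subseteq> dual G T" and e: "e > 0" for J e
    proof -
      obtain N :: nat where "N * e\<^sup>2 > 4 * card J" using e reals_Archimedean3[of "e\<^sup>2"] by auto
      moreover from this have "N > 0" by (cases N) auto
      moreover have "(\<Prod>\<psi>\<in>J. cis (\<alpha> \<psi> * t) ^ k \<psi> * cnj (cis (\<alpha> \<psi> * t)) ^ l \<psi>) = 1"
        if "\<forall>x\<in>carrier G. (\<Prod>\<psi>\<in>J. \<psi> x ^ k \<psi> * cnj (\<psi> x) ^ l \<psi>) = 1" for k l
      proof -
        \<comment> \<open>Outside the carrier this uses the normalisation in \<open>dual\<close>.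
          Equality as functions allows \<alpha> to be applied, with value 0.\<close>
        have "monomial J k l = (\<lambda>x. 1)"
        proof
          fix x
          show "monomial J k l x = 1"
            using that monomial_in_dual[OF J(2), of k l]
            by (cases "x \<in> carrier G") (auto simp: monomial_def dual_def)
        qed
        then show ?thesis
          using cis_real_hom_monomial[OF \<alpha> J(2), of k l t] real_hom_dual_one[OF \<alpha>] by simp
      qed
      ultimately have "\<exists>x\<in>carrier G. \<forall>\<psi>\<in>J. norm (\<psi> x - cis (\<alpha> \<psi> * t)) < e"
        using J e by (intro kronecker_approximation[of J "\<lambda>\<psi>. \<psi>" _ N]) (auto simp: dual_def)
      then show ?thesis by (meson less_imp_le)
    qed
    moreover have "closedin T (carrier G)" using closedin_topspace[of T] by (simp add: topspace_eq_carrier)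
    ultimately show ?thesis using dual_compactness[of "carrier G" "\<lambda>\<psi>. cis (\<alpha> \<psi> * t)"] by blast
  qed
  then obtain \<gamma> where \<gamma>: "\<And>t. \<gamma> t \<in> carrier G" "\<And>\<psi> t. \<psi> \<in> dual G T \<Longrightarrow> \<psi> (\<gamma> t) = cis (\<alpha> \<psi> * t)"
    by metis
  have ch: "character G \<psi>" if "\<psi> \<in> dual G T" for \<psi> using that by (simp add: dual_def)
  have hom: "\<gamma> (s + t) = \<gamma> s \<otimes> \<gamma> t" for s t
  proof -
    have "\<gamma> (s + t) \<otimes> inv (\<gamma> s \<otimes> \<gamma> t) = \<one>"
    proof (rule dual_separates_points)
      fix \<psi> assume \<psi>: "\<psi> \<in> dual G T"
      have "\<psi> (\<gamma> (s + t) \<otimes> inv (\<gamma> s \<otimes> \<gamma> t)) = cis (\<alpha> \<psi> * (s + t)) * cnj (cis (\<alpha> \<psi> * s) * cis (\<alpha> \<psi> * t))"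
        using \<gamma> ch[OF \<psi>] \<psi> by (simp add: character_mult[OF ch[OF \<psi>]] character_inv)
      also have "cis (\<alpha> \<psi> * s) * cis (\<alpha> \<psi> * t) = cis (\<alpha> \<psi> * (s + t))"
        by (simp add: cis_mult distrib_left)
      finally show "\<psi> (\<gamma> (s + t) \<otimes> inv (\<gamma> s \<otimes> \<gamma> t)) = 1" by (simp add: mult_cnj_eq_1)
    qed (simp add: \<gamma>)
    then show ?thesis using \<gamma>(1) by (metis inv_closed inv_equality inv_inv m_closed)
  qed
  have "continuous_map euclidean T \<gamma>"
    unfolding continuous_map_def
  proof (intro conjI allI impI)
    show "\<gamma> \<in> topspace euclidean \<rightarrow> topspace T" using \<gamma>(1) by (simp add: topspace_eq_carrier)
    fix U assume U: "openin T U"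
    show "openin euclidean {t \<in> topspace euclidean. \<gamma> t \<in> U}"
    proof (subst openin_subopen, rule ballI)
      fix t assume "t \<in> {t \<in> topspace euclidean. \<gamma> t \<in> U}"
      then have t: "\<gamma> t \<in> U" by simp
      have "openin T {x \<in> carrier G. x \<otimes> \<gamma> t \<in> U}" using U \<gamma>(1) by (rule openin_translate_right)
      moreover have "\<one> \<in> {x \<in> carrier G. x \<otimes> \<gamma> t \<in> U}" using t \<gamma>(1) by simp
      ultimately obtain J e where J: "finite J" "J \<subseteq> dual G T" "e > 0"
        "\<And>x. x \<in> carrier G \<Longrightarrow> (\<And>\<psi>. \<psi> \<in> J \<Longrightarrow> norm (\<psi> x - 1) \<le> e) \<Longrightarrow> x \<in> {x \<in> carrier G. x \<otimes> \<gamma> t \<in> U}"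
        by (rule dual_neighborhood) blast
      define A where "A = (\<Inter>\<psi>\<in>J. {s. norm (cis (\<alpha> \<psi> * (s - t)) - 1) < e})"
      have "open A"
        unfolding A_def by (intro open_INT J(1) ballI open_Collect_less continuous_intros)
      moreover have "t \<in> A" using J(3) by (simp add: A_def)
      moreover have "\<gamma> s \<in> U" if "s \<in> A" for s
      proof -
        have "\<gamma> (s - t) \<in> {x \<in> carrier G. x \<otimes> \<gamma> t \<in> U}"
          using that J(2) \<gamma> by (intro J(4)) (auto simp: A_def subset_iff less_imp_le)
        then show ?thesis using hom[of "s - t" t] by simp
      qed
      ultimately show "\<exists>A. openin euclidean A \<and> t \<in> A \<and> A \<subseteq> {t \<in> topspace euclidean. \<gamma> t \<in> U}"
        by (intro exI[of _ A]) auto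
    qed
  qed
  then show thesis using that \<gamma> hom by blast
qed

text \<open>Kronecker's theorem is applied to the group \<real>, with the characters t \<mapsto> cis
  (\<alpha> \<psi> t) and the targets \<open>\<psi> y\<close>. Their relations with exponents below
  \<open>N\<close> must hold at \<open>y\<close>; this is ensured by an \<alpha> that vanishes on
  none of the finitely many nontrivial monomials with such exponents, which form
  \<open>F\<close>.\<close>

theorem dense_one_parameter_subgroup:
  assumes conn: "connected_space T" and V: "openin T V" "\<one> \<in> V"
  obtains \<gamma> :: "real \<Rightarrow> 'a" where "continuous_map euclidean T \<gamma>" "\<And>t. \<gamma> t \<in> carrier G"
    "\<And>s t. \<gamma> (s + t) = \<gamma> s \<otimes> \<gamma> t" "\<And>y. y \<in> carrier G \<Longrightarrow> \<exists>t. y \<otimes> inv (\<gamma> t) \<in> V"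
proof -
  interpret D: comm_group "dual_group G T" by (rule comm_group_dual_group)
  obtain J e where J: "finite J" "J \<subseteq> dual G T" "e > 0"
    "\<And>x. x \<in> carrier G \<Longrightarrow> (\<And>\<psi>. \<psi> \<in> J \<Longrightarrow> norm (\<psi> x - 1) \<le> e) \<Longrightarrow> x \<in> V"
    using V by (rule dual_neighborhood) blast
  obtain N :: nat where N: "N * e\<^sup>2 > 4 * card J" using J(3) reals_Archimedean3[of "e\<^sup>2"] by auto
  then have "N > 0" by (cases N) auto
  define F where "F = (\<lambda>(k, l). monomial J k l) ` (Pi\<^sub>E J (\<lambda>_. {..<N}) \<times> Pi\<^sub>E J (\<lambda>_. {..<N})) - {\<lambda>x. 1}"
  have pow: "\<psi> [^]\<^bsub>dual_group G T\<^esub> n = (\<lambda>x. \<psi> x ^ n)" for \<psi> :: "'a \<Rightarrow> complex" and n :: nat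
    by (induction n) (auto simp: mult.commute)
  have "finite F" unfolding F_def using J(1) by (intro finite_Diff finite_imageI finite_cartesian_product finite_PiE) auto
  moreover have "F \<subseteq> dual G T" unfolding F_def using monomial_in_dual[OF J(2)] by auto
  moreover have "(\<lambda>x. 1) \<notin> F" by (simp add: F_def)
  moreover have "\<forall>\<psi>\<in>dual G T. \<forall>n>0. \<psi> [^]\<^bsub>dual_group G T\<^esub> (n::nat) = (\<lambda>x. 1) \<longrightarrow> \<psi> = (\<lambda>x. 1)"
    using dual_torsion_free[OF conn] by (auto simp: pow fun_eq_iff)
  ultimately obtain \<alpha> where \<alpha>: "real_hom (dual_group G T) \<alpha>" "\<And>\<psi>. \<psi> \<in> F \<Longrightarrow> \<alpha> \<psi> \<noteq> 0"
    using D.real_hom_nonzero_on_finite[of F] unfolding dual_group_simps by blast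
  obtain \<gamma> :: "real \<Rightarrow> 'a" where \<gamma>: "continuous_map euclidean T \<gamma>" "\<And>t. \<gamma> t \<in> carrier G"
    "\<And>s t. \<gamma> (s + t) = \<gamma> s \<otimes> \<gamma> t" "\<And>\<psi> t. \<psi> \<in> dual G T \<Longrightarrow> \<psi> (\<gamma> t) = cis (\<alpha> \<psi> * t)"
    using one_parameter_subgroup_of_real_hom[OF \<alpha>(1)] by blast
  interpret R: comm_group real_group by (rule comm_group_real_group)
  obtain M' where "invariant_mean real_group M'" by (rule R.invariant_mean_exists)
  then interpret R: invariant_mean real_group M' .
  have "\<exists>t. y \<otimes> inv (\<gamma> t) \<in> V" if y: "y \<in> carrier G" for y
  proof -
    have rel: "(\<Prod>\<psi>\<in>J. \<psi> y ^ k \<psi> * cnj (\<psi> y) ^ l \<psi>) = 1"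
      if k: "k \<in> J \<rightarrow> {..<N}" and l: "l \<in> J \<rightarrow> {..<N}"
        and 1: "\<forall>t\<in>carrier real_group. (\<Prod>\<psi>\<in>J. cis (\<alpha> \<psi> * t) ^ k \<psi> * cnj (cis (\<alpha> \<psi> * t)) ^ l \<psi>) = 1" for k l
    proof -
      have cis1: "cis (\<alpha> (monomial J k l) * t) = 1" for t
        using 1 cis_real_hom_monomial[OF \<alpha>(1) J(2)] by simp
      have "\<alpha> (monomial J k l) = 0"
      proof (rule ccontr)
        assume "\<alpha> (monomial J k l) \<noteq> 0"
        \<comment> \<open>At this time the angle is pi, where \<open>cis\<close> is -1.\<close>
        then show False using cis1[of "pi / \<alpha> (monomial J k l)"] by (simp add: cis_pi)
      qed
      \<comment> \<open>Restricting the exponents to \<open>J\<close> leaves the monomial unchanged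
        and puts them into the finite function sets from which \<open>F\<close> is built.\<close>
      moreover have eq: "monomial J k l = monomial J (restrict k J) (restrict l J)"
        unfolding monomial_def by (intro ext prod.cong) auto
      ultimately have nF: "monomial J (restrict k J) (restrict l J) \<notin> F" using \<alpha>(2) by fastforce
      have "(restrict k J, restrict l J) \<in> Pi\<^sub>E J (\<lambda>_. {..<N}) \<times> Pi\<^sub>E J (\<lambda>_. {..<N})"
        using k l by auto
      then have "monomial J (restrict k J) (restrict l J)
          \<in> (\<lambda>(k, l). monomial J k l) ` (Pi\<^sub>E J (\<lambda>_. {..<N}) \<times> Pi\<^sub>E J (\<lambda>_. {..<N}))"
        by (rule rev_image_eqI) (simp only: prod.case)
      with nF have "monomial J (restrict k J) (restrict l J) = (\<lambda>x. 1)" unfolding F_def by blast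
      with eq have "monomial J k l = (\<lambda>x. 1)" by (rule trans)
      then show ?thesis by (metis monomial_def)
    qed
    have "\<exists>t\<in>carrier real_group. \<forall>\<psi>\<in>J. norm (cis (\<alpha> \<psi> * t) - \<psi> y) < e"
    proof (rule R.kronecker_approximation[OF J(1) _ _ \<open>N > 0\<close> N J(3) rel])
      show "character real_group (\<lambda>t. cis (\<alpha> \<psi> * t))" for \<psi>
        by (simp add: character_def cis_mult distrib_left)
      show "norm (\<psi> y) = 1" if "\<psi> \<in> J" for \<psi> using subsetD[OF J(2) that] by (rule norm_dual)
    qed
    then obtain t where t: "\<And>\<psi>. \<psi> \<in> J \<Longrightarrow> norm (cis (\<alpha> \<psi> * t) - \<psi> y) < e" by auto
    have "y \<otimes> inv (\<gamma> t) \<in> V"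
    proof (rule J(4))
      fix \<psi> assume \<psi>: "\<psi> \<in> J"
      then have d: "\<psi> \<in> dual G T" "character G \<psi>" using J(2) by (auto simp: dual_def)
      have "\<psi> (y \<otimes> inv (\<gamma> t)) = \<psi> y * cnj (cis (\<alpha> \<psi> * t))"
        using y \<gamma>(2) d by (simp add: character_mult[OF d(2)] character_inv \<gamma>(4))
      then have "\<psi> (y \<otimes> inv (\<gamma> t)) - 1 = (\<psi> y - cis (\<alpha> \<psi> * t)) * cnj (cis (\<alpha> \<psi> * t))"
        by (simp add: left_diff_distrib mult_cnj_eq_1 del: cis_cnj)
      then show "norm (\<psi> (y \<otimes> inv (\<gamma> t)) - 1) \<le> e"
        using t[OF \<psi>] by (simp add: norm_mult norm_minus_commute)
    qed (use y \<gamma>(2) in simp)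
    then show ?thesis by blast
  qed
  then show thesis using that \<gamma>(1-3) by blast
qed

end

section \<open>Chabauty approximation by real subgroups\<close>

text \<open>At the subgroup \<open>carrier G\<close> one of the two inclusions is automatic because
  \<open>\<one>\<close> \<in> \<open>W\<close>; only \<open>K \<subseteq> W <#> L\<close> remains.
  The forward direction needs the basic sets to be neighbourhoods, hence local compactness.\<close>

lemma (in topological_group) numerally_approximable_iff:
  assumes lc: "locally_compact_space T" and H: "Hausdorff_space T"
  shows "numerally_approximable G T \<longleftrightarrow>
    (\<forall>K W. compactin T K \<longrightarrow> identity_neighborhood G T W \<longrightarrow>
      (\<exists>L\<in>real_subgroups G T. K \<subseteq> W <#> L))" (is "_ \<longleftrightarrow> ?R")
proof
  have G: "carrier G \<in> closed_subgroups G T"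
    using closedin_topspace[of T] subgroup_self by (simp add: closed_subgroups_def topspace_eq_carrier)
  show ?R if A: "numerally_approximable G T"
  proof (intro allI impI)
    fix K W assume K: "compactin T K" and W: "identity_neighborhood G T W"
    obtain A where "openin (chabauty G T) A" "carrier G \<in> A" "A \<subseteq> chabauty_nbhd G T (carrier G) K W"
      using chabauty_nbhd_is_neighborhood[OF lc H K W G] by blast
    then obtain L where "L \<in> real_subgroups G T" "L \<in> chabauty_nbhd G T (carrier G) K W"
      using A unfolding numerally_approximable_def in_closure_of by blast
    moreover have "K \<subseteq> carrier G" using K compactin_subset_topspace topspace_eq_carrier by blast
    ultimately show "\<exists>L\<in>real_subgroups G T. K \<subseteq> W <#> L" by (auto simp: chabauty_nbhd_def)
  qed
  show "numerally_approximable G T" if R: ?R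
    unfolding numerally_approximable_def in_closure_of
  proof (intro conjI allI impI)
    have "identity_neighborhood G T (carrier G)"
      unfolding identity_neighborhood_def using topspace_eq_carrier by (metis one_closed openin_topspace order_refl)
    then have "openin (chabauty G T) (closed_subgroups G T)"
      unfolding openin_chabauty chabauty_open_def
      by (intro conjI ballI exI[of _ "{}"] exI[of _ "carrier G"]) (auto simp: chabauty_nbhd_def)
    then show "carrier G \<in> topspace (chabauty G T)" using G openin_subset by blast
    fix A assume "carrier G \<in> A \<and> openin (chabauty G T) A"
    then obtain K W where KW: "compactin T K" "identity_neighborhood G T W"
        "chabauty_nbhd G T (carrier G) K W \<subseteq> A"
      unfolding openin_chabauty chabauty_open_def by blast
    then obtain L where L: "L \<in> real_subgroups G T" "K \<subseteq> W <#> L" using R by blast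
    have "l \<in> W <#> carrier G" if "l \<in> L" for l
    proof -
      have "l \<in> carrier G" using that L(1) by (auto simp: real_subgroups_def closed_subgroups_def dest: subgroup.subset)
      then have "l = \<one> \<otimes> l" by simp
      moreover have "\<one> \<in> W" using KW(2) by (auto simp: identity_neighborhood_def)
      ultimately show ?thesis using \<open>l \<in> carrier G\<close> unfolding set_mult_def by blast
    qed
    then have "L \<in> chabauty_nbhd G T (carrier G) K W"
      using L by (auto simp: chabauty_nbhd_def real_subgroups_def)
    then show "\<exists>L. L \<in> real_subgroups G T \<and> L \<in> A" using L(1) KW(3) by blast
  qed
qed

lemma (in group) additive_at_zero:
  fixes \<delta> :: "real \<Rightarrow> 'a"
  assumes "\<And>s t. \<delta> (s + t) = \<delta> s \<otimes> \<delta> t" "\<And>t. \<delta> t \<in> carrier G"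
  shows "\<delta> 0 = \<one>"
  using assms(1)[of 0 0] assms(2)[of 0] by (metis add.right_neutral r_cancel_one)

text \<open>The continuous left inverse \<open>p\<close> does the work: the range is the set on
  which \<open>\<delta> \<circ> p\<close> and the identity agree, hence closed, and on it
  \<open>p\<close> is the isomorphism to \<real>.\<close>

lemma (in topological_group) range_in_real_subgroups:
  fixes \<delta> :: "real \<Rightarrow> 'a"
  assumes \<delta>: "continuous_map euclidean T \<delta>" and hom: "\<And>s t. \<delta> (s + t) = \<delta> s \<otimes> \<delta> t"
    and p: "continuous_map T euclidean p" "\<And>t. p (\<delta> t) = t" and H: "Hausdorff_space T"
  shows "range \<delta> \<in> real_subgroups G T"
proof -
  have \<delta>c: "\<delta> t \<in> carrier G" for t
    using continuous_map_image_subset_topspace[OF \<delta>] by (auto simp: topspace_eq_carrier)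
  have \<delta>0: "\<delta> 0 = \<one>" using hom \<delta>c by (rule additive_at_zero)
  have range_eq: "range \<delta> = {x \<in> topspace T. (\<delta> \<circ> p) x = id x}"
    using p(2) \<delta>c by (auto simp: topspace_eq_carrier) (metis rangeI)
  have closed: "closedin T (range \<delta>)"
    unfolding range_eq using p(1) \<delta> by (intro closedin_continuous_maps_eq[OF H] continuous_map_compose) auto
  have inv: "inv (\<delta> t) = \<delta> (- t)" for t
    using hom[of "- t" t] \<delta>0 \<delta>c by (intro inv_equality) auto
  have "subgroup (range \<delta>) G"
  proof (rule subgroupI)
    fix a b assume "a \<in> range \<delta>" "b \<in> range \<delta>"
    then show "a \<otimes> b \<in> range \<delta>" by (auto simp flip: hom)
  qed (use \<delta>c inv in auto)
  moreover have "p \<in> iso (G\<lparr>carrier := range \<delta>\<rparr>) real_group"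
  proof (rule isoI)
    show "p \<in> hom (G\<lparr>carrier := range \<delta>\<rparr>) real_group" using p(2) by (auto simp: hom_def simp flip: hom)
    show "bij_betw p (carrier (G\<lparr>carrier := range \<delta>\<rparr>)) (carrier real_group)"
      by (rule bij_betwI[of _ _ _ \<delta>]) (auto simp: p(2))
  qed
  moreover have "homeomorphic_maps (subtopology T (range \<delta>)) euclidean p \<delta>"
    unfolding homeomorphic_maps_def using p \<delta>
    by (auto simp: continuous_map_in_subtopology continuous_map_from_subtopology)
  ultimately show ?thesis
    using closed homeomorphic_map_maps unfolding real_subgroups_def closed_subgroups_def topological_group_isomorphic_def
    by blast
qed

text \<open>The approximating subgroups are the graphs of fast windings \<open>t \<mapsto> \<gamma> (s t)\<close> of a
  one-parameter subgroup that is almost dense in the compact factor.\<close>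

theorem numerally_approximable_if_isomorphic:
  fixes G :: "('a, 'm) monoid_scheme" and C :: "('c, 'n) monoid_scheme"
  assumes G: "topological_group G T" "locally_compact_space T" "Hausdorff_space T"
    and C: "compact_connected_abelian_group C S"
    and iso: "topological_group_isomorphic G T (real_group \<times>\<times> C) (prod_topology euclidean S)"
  shows "numerally_approximable G T"
proof -
  interpret G: topological_group G T by fact
  interpret C: topological_group C S using C by (simp add: compact_connected_abelian_group_def)
  interpret C: comm_group C using C by (simp add: compact_connected_abelian_group_def)
  have conn: "connected_space S" and HS: "Hausdorff_space S" and cpt: "compact_space S"
    using C by (simp_all add: compact_connected_abelian_group_def)
  obtain M where "invariant_mean C M" by (rule C.invariant_mean_exists)
  then interpret C: invariant_mean C M .
  interpret C: compact_group_mean C S M by unfold_locales (fact cpt HS)+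
  obtain f where f: "f \<in> iso G (real_group \<times>\<times> C)" "homeomorphic_map T (prod_topology euclidean S) f"
    using iso by (auto simp: topological_group_isomorphic_def)
  obtain g where fg: "homeomorphic_maps T (prod_topology euclidean S) f g"
    using f(2) homeomorphic_map_maps by blast
  have cont_f: "continuous_map T (prod_topology euclidean S) f"
    and cont_g: "continuous_map (prod_topology euclidean S) T g"
    and gf: "\<And>x. x \<in> carrier G \<Longrightarrow> g (f x) = x"
    and fg: "\<And>t c. c \<in> carrier C \<Longrightarrow> f (g (t, c)) = (t, c)"
    using fg by (auto simp: homeomorphic_maps_def G.topspace_eq_carrier C.topspace_eq_carrier)
  have f_mult: "f (x \<otimes>\<^bsub>G\<^esub> y) = f x \<otimes>\<^bsub>real_group \<times>\<times> C\<^esub> f y" if "x \<in> carrier G" "y \<in> carrier G" for x y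
    using f(1) that by (auto simp: iso_def hom_def)
  have f_snd: "snd (f x) \<in> carrier C" if "x \<in> carrier G" for x
    using continuous_map_image_subset_topspace[OF cont_f] that
    by (auto simp: G.topspace_eq_carrier C.topspace_eq_carrier)
  have g_car: "g (t, c) \<in> carrier G" if "c \<in> carrier C" for t c
    using continuous_map_image_subset_topspace[OF cont_g] that
    by (auto simp: G.topspace_eq_carrier C.topspace_eq_carrier)
  have g_mult: "g (s + t, c \<otimes>\<^bsub>C\<^esub> d) = g (s, c) \<otimes>\<^bsub>G\<^esub> g (t, d)"
    if "c \<in> carrier C" "d \<in> carrier C" for s t c d
  proof -
    have "f (g (s, c) \<otimes>\<^bsub>G\<^esub> g (t, d)) = (s + t, c \<otimes>\<^bsub>C\<^esub> d)"
      using that by (simp add: f_mult g_car fg)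
    then show ?thesis using gf[of "g (s, c) \<otimes>\<^bsub>G\<^esub> g (t, d)"] that by (simp add: g_car)
  qed
  have g_one: "g (0, \<one>\<^bsub>C\<^esub>) = \<one>\<^bsub>G\<^esub>"
    using g_mult[of "\<one>\<^bsub>C\<^esub>" "\<one>\<^bsub>C\<^esub>" 0 0] by (metis C.l_one C.one_closed G.r_cancel_one add_0 g_car)
  show ?thesis
    unfolding G.numerally_approximable_iff[OF G(2,3)]
  proof (intro allI impI)
    fix K W assume K: "compactin T K" and "identity_neighborhood G T W"
    then obtain V where V: "openin T V" "\<one>\<^bsub>G\<^esub> \<in> V" "V \<subseteq> W" by (auto simp: identity_neighborhood_def)
    let ?Q = "{p \<in> topspace (prod_topology euclidean S). g p \<in> V}"
    have "openin (prod_topology euclidean S) ?Q"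
      using cont_g V(1) by (rule openin_continuous_map_preimage)
    moreover have "(0, \<one>\<^bsub>C\<^esub>) \<in> ?Q" using g_one V(2) by (simp add: C.topspace_eq_carrier)
    ultimately obtain I U where IU: "open I" "openin S U" "0 \<in> I" "\<one>\<^bsub>C\<^esub> \<in> U" "I \<times> U \<subseteq> ?Q"
      unfolding openin_prod_topology_alt by (meson open_openin)
    obtain e where e: "e > 0" "ball 0 e \<subseteq> I" using IU(1,3) open_contains_ball by blast
    obtain \<gamma> :: "real \<Rightarrow> 'c" where \<gamma>: "continuous_map euclidean S \<gamma>" "\<And>t. \<gamma> t \<in> carrier C"
      "\<And>s t. \<gamma> (s + t) = \<gamma> s \<otimes>\<^bsub>C\<^esub> \<gamma> t" "\<And>y. y \<in> carrier C \<Longrightarrow> \<exists>t. y \<otimes>\<^bsub>C\<^esub> inv\<^bsub>C\<^esub> (\<gamma> t) \<in> U"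
      using C.dense_one_parameter_subgroup[OF conn IU(2,4)] by blast
    define A where "A = (\<lambda>t. {y \<in> carrier C. y \<otimes>\<^bsub>C\<^esub> inv\<^bsub>C\<^esub> (\<gamma> t) \<in> U})"
    have "openin S (A t)" for t
      unfolding A_def using IU(2) \<gamma>(2) by (intro C.openin_translate_right) auto
    moreover have "topspace S \<subseteq> \<Union>(range A)" using \<gamma>(4) by (auto simp: A_def C.topspace_eq_carrier)
    ultimately obtain \<F> where "finite \<F>" "\<F> \<subseteq> range A" "topspace S \<subseteq> \<Union>\<F>"
      using cpt unfolding compact_space_def compactin_def by (metis (no_types, lifting) imageE)
    \<comment> \<open>By compactness finitely many times suffice: every element of \<open>C\<close>
      lies in U \<gamma>(\<tau>) for some \<tau> in \<open>P\<close>.\<close>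
    then obtain P where P: "finite P" "topspace S \<subseteq> \<Union>(A ` P)" by (metis finite_subset_image)
    define R where "R = Max (insert 1 (abs ` P))"
    have R: "R \<ge> 1" "\<And>t. t \<in> P \<Longrightarrow> \<bar>t\<bar> \<le> R" unfolding R_def using P(1) by auto
    \<comment> \<open>At this speed the winding passes through all times of \<gamma> up to
      \<open>R\<close> within R / s = e / 2, a shift small enough for \<open>I\<close>.\<close>
    define s where "s = 2 * R / e"
    have s: "s > 0" "R / s < e" using R(1) e(1) by (simp_all add: s_def field_simps)
    define \<delta> where "\<delta> = (\<lambda>t. g (t, \<gamma> (s * t)))"
    have "range \<delta> \<in> real_subgroups G T"
    proof (rule G.range_in_real_subgroups[where p = "\<lambda>x. fst (f x)"])
      have "continuous_map euclidean S (\<lambda>t. \<gamma> (s * t))"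
        using continuous_map_compose[OF _ \<gamma>(1), of euclidean "\<lambda>t. s * t"]
        by (simp add: o_def continuous_intros)
      then have "continuous_map euclidean (prod_topology euclidean S) (\<lambda>t. (t, \<gamma> (s * t)))"
        by (intro continuous_map_pairedI) auto
      from continuous_map_compose[OF this cont_g] show "continuous_map euclidean T \<delta>"
        by (simp add: o_def \<delta>_def)
      show "\<delta> (t + u) = \<delta> t \<otimes>\<^bsub>G\<^esub> \<delta> u" for t u
        by (simp add: \<delta>_def distrib_left \<gamma>(2,3) g_mult)
      show "continuous_map T euclidean (\<lambda>x. fst (f x))"
        using continuous_map_compose[OF cont_f continuous_map_fst] by (simp add: o_def)
      show "fst (f (\<delta> t)) = t" for t by (simp add: \<delta>_def fg \<gamma>(2))
    qed (fact G(3))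
    moreover have "K \<subseteq> W <#>\<^bsub>G\<^esub> range \<delta>"
    proof
      fix x assume "x \<in> K"
      then have x: "x \<in> carrier G"
        using K compactin_subset_topspace G.topspace_eq_carrier by blast
      obtain t c where tc: "f x = (t, c)" by force
      then have c: "c \<in> carrier C" using f_snd[OF x] by simp
      \<comment> \<open>Over \<open>t\<close> the graph misses \<open>c\<close> by
        \<open>c'\<close>. Moving on by \<tau> / s corrects the error up to an element
        \<open>d\<close> of \<open>U\<close>, and the first coordinate of
        \<open>(- (\<tau> / s), d)\<close> undoes the shift.\<close>
      define c' where "c' = c \<otimes>\<^bsub>C\<^esub> inv\<^bsub>C\<^esub> (\<gamma> (s * t))"
      have c': "c' \<in> carrier C" using c \<gamma>(2) by (simp add: c'_def)
      then obtain \<tau> where \<tau>: "\<tau> \<in> P" "c' \<otimes>\<^bsub>C\<^esub> inv\<^bsub>C\<^esub> (\<gamma> \<tau>) \<in> U"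
        using P(2) by (auto simp: A_def C.topspace_eq_carrier)
      define d where "d = c' \<otimes>\<^bsub>C\<^esub> inv\<^bsub>C\<^esub> (\<gamma> \<tau>)"
      have dc: "d \<in> carrier C" using c' \<gamma>(2) by (simp add: d_def)
      have "\<bar>\<tau> / s\<bar> \<le> R / s" using R(2)[OF \<tau>(1)] s(1) by (simp add: abs_div divide_right_mono)
      then have "(- (\<tau> / s), d) \<in> I \<times> U" using s(2) e(2) \<tau>(2) by (auto simp: d_def subset_iff)
      then have w: "g (- (\<tau> / s), d) \<in> W" using IU(5) V(3) by auto
      have "d \<otimes>\<^bsub>C\<^esub> \<gamma> (s * (t + \<tau> / s)) = c"
      proof -
        have "s * (t + \<tau> / s) = \<tau> + s * t" using s(1) by (simp add: field_simps)
        then show ?thesis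
          using c \<gamma>(2) by (simp add: d_def c'_def \<gamma>(3) C.m_assoc C.inv_solve_right' flip: C.m_assoc)
            (simp add: C.m_assoc)
      qed
      then have "g (- (\<tau> / s), d) \<otimes>\<^bsub>G\<^esub> \<delta> (t + \<tau> / s) = g (t, c)"
        unfolding \<delta>_def using dc \<gamma>(2) by (simp flip: g_mult)
      also have "\<dots> = x" using gf[OF x] tc by simp
      finally show "x \<in> W <#>\<^bsub>G\<^esub> range \<delta>" using w unfolding set_mult_def by blast
    qed
    ultimately show "\<exists>L\<in>real_subgroups G T. K \<subseteq> W <#>\<^bsub>G\<^esub> L" by blast
  qed
qed

section \<open>Structure of numerally approximable groups\<close>

context topological_group
begin

lemma real_subgroup_parametrization:
  assumes "L \<in> real_subgroups G T"
  obtains \<delta> :: "real \<Rightarrow> 'a" and p where "continuous_map euclidean T \<delta>" "\<And>s t. \<delta> (s + t) = \<delta> s \<otimes> \<delta> t"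
    "range \<delta> = L" "\<And>t. p (\<delta> t) = t" "continuous_map (subtopology T L) euclidean p"
proof -
  have L: "subgroup L G" "closedin T L" using assms by (auto simp: real_subgroups_def closed_subgroups_def)
  obtain p where p: "p \<in> iso (G\<lparr>carrier := L\<rparr>) real_group" "homeomorphic_map (subtopology T L) euclidean p"
    using assms by (auto simp: real_subgroups_def topological_group_isomorphic_def)
  obtain \<delta> where \<delta>: "homeomorphic_maps (subtopology T L) euclidean p \<delta>"
    using p(2) homeomorphic_map_maps by blast
  have top: "topspace (subtopology T L) = L" using L(2) closedin_subset by auto
  have cont: "continuous_map euclidean T \<delta>" and \<delta>L: "\<And>t. \<delta> t \<in> L"
    using \<delta> by (auto simp: homeomorphic_maps_def continuous_map_in_subtopology)
  have p\<delta>: "p (\<delta> t) = t" for t using \<delta> by (simp add: homeomorphic_maps_def)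
  have \<delta>p: "\<delta> (p x) = x" if "x \<in> L" for x using \<delta> that top by (simp add: homeomorphic_maps_def)
  have hom: "\<delta> (s + t) = \<delta> s \<otimes> \<delta> t" for s t
  proof -
    have "p (\<delta> s \<otimes> \<delta> t) = s + t" using p(1) \<delta>L by (auto simp: iso_def hom_def p\<delta>)
    then show ?thesis using \<delta>p[of "\<delta> s \<otimes> \<delta> t"] \<delta>L subgroup.m_closed[OF L(1)] by metis
  qed
  show thesis
  proof
    show "range \<delta> = L" using \<delta>L \<delta>p by (auto intro: range_eqI[OF sym])
    show "continuous_map (subtopology T L) euclidean p" using \<delta> by (simp add: homeomorphic_maps_def)
  qed (fact cont hom p\<delta>)+
qed

lemma openin_left_quotient:
  assumes "openin T X" "x \<in> carrier G"
  shows "openin T {w \<in> carrier G. inv w \<otimes> x \<in> X}"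
proof -
  have "continuous_map T T (\<lambda>w. inv w \<otimes> x)"
    using continuous_map_compose[OF continuous_inv continuous_translate_right[OF assms(2)]] by (simp add: o_def)
  from openin_continuous_map_preimage[OF this assms(1)] show ?thesis by (simp add: topspace_eq_carrier)
qed

end

locale approximable_group = topological_group G T for G (structure) and T +
  assumes locally_compact: "locally_compact_space T" and Hausdorff: "Hausdorff_space T"
    and approximable: "numerally_approximable G T"
begin

lemma approximating_subgroup:
  assumes "compactin T K" "identity_neighborhood G T W"
  obtains L where "L \<in> real_subgroups G T" "K \<subseteq> W <#> L"
  using approximable numerally_approximable_iff[OF locally_compact Hausdorff] assms by blast

text \<open>It suffices to approximate the compact set {x, y}: if x = w l with \<open>w\<close>
  close to \<open>\<one>\<close>, then l = w^-1 x still lies in \<open>X\<close>. Properties of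
  \<real> that can be tested on two open sets thus pass to \<open>G\<close>.\<close>

lemma real_subgroup_meeting:
  assumes "openin T X" "X \<noteq> {}" "openin T Y" "Y \<noteq> {}"
  obtains L where "L \<in> real_subgroups G T" "L \<inter> X \<noteq> {}" "L \<inter> Y \<noteq> {}"
proof -
  obtain x y where xy: "x \<in> X" "y \<in> Y" using assms by blast
  then have c: "x \<in> carrier G" "y \<in> carrier G"
    using assms openin_subset topspace_eq_carrier by blast+
  define W where "W = {w \<in> carrier G. inv w \<otimes> x \<in> X} \<inter> {w \<in> carrier G. inv w \<otimes> y \<in> Y}"
  have "openin T W" "\<one> \<in> W"
    using openin_left_quotient assms c xy by (auto simp: W_def)
  then have "identity_neighborhood G T W"
    unfolding identity_neighborhood_def using openin_subset by blast
  moreover have "compactin T {x, y}" using c by (simp add: finite_imp_compactin topspace_eq_carrier)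
  ultimately obtain L where L: "L \<in> real_subgroups G T" "{x, y} \<subseteq> W <#> L"
    using approximating_subgroup by blast
  have Lc: "L \<subseteq> carrier G" using L(1) by (auto simp: real_subgroups_def closed_subgroups_def dest: subgroup.subset)
  have step: "inv w \<otimes> (w \<otimes> l) = l" if "w \<in> W" "l \<in> L" for w l
    using that Lc by (auto simp: W_def subset_iff m_assoc[symmetric])
  obtain w l where "w \<in> W" "l \<in> L" "x = w \<otimes> l" using L(2) unfolding set_mult_def by blast
  then have "l \<in> L \<inter> X" using step[of w l] by (simp add: W_def)
  then have "L \<inter> X \<noteq> {}" by blast
  moreover obtain w l where "w \<in> W" "l \<in> L" "y = w \<otimes> l" using L(2) unfolding set_mult_def by blast
  then have "l \<in> L \<inter> Y" using step[of w l] by (simp add: W_def)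
  then have "L \<inter> Y \<noteq> {}" by blast
  ultimately show thesis using that L(1) by blast
qed

text \<open>The non-commuting pairs form an open set by the Hausdorff property; if it were nonempty,
  it would contain a pair from a subgroup isomorphic to \<real>.\<close>

lemma approximable_commutative:
  assumes "x \<in> carrier G" "y \<in> carrier G"
  shows "x \<otimes> y = y \<otimes> x"
proof (rule ccontr)
  assume ne: "x \<otimes> y \<noteq> y \<otimes> x"
  have "continuous_map (prod_topology T T) T (\<lambda>p. snd p \<otimes> fst p)"
    using continuous_map_compose[OF continuous_map_pairedI[OF continuous_map_snd continuous_map_fst] continuous_mult]
    by (simp add: o_def)
  then have "closedin (prod_topology T T) {p \<in> topspace (prod_topology T T). (\<lambda>(x, y). x \<otimes> y) p = snd p \<otimes> fst p}"
    using continuous_mult by (intro closedin_continuous_maps_eq[OF Hausdorff])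
  then have "openin (prod_topology T T) (topspace (prod_topology T T) -
      {p \<in> topspace (prod_topology T T). (\<lambda>(x, y). x \<otimes> y) p = snd p \<otimes> fst p})"
    by (rule openin_diff[OF openin_topspace])
  moreover have "(x, y) \<in> topspace (prod_topology T T) -
      {p \<in> topspace (prod_topology T T). (\<lambda>(x, y). x \<otimes> y) p = snd p \<otimes> fst p}"
    using assms ne by (simp add: topspace_eq_carrier)
  ultimately obtain X Y where XY: "openin T X" "openin T Y" "x \<in> X" "y \<in> Y"
      "X \<times> Y \<subseteq> topspace (prod_topology T T) -
        {p \<in> topspace (prod_topology T T). (\<lambda>(x, y). x \<otimes> y) p = snd p \<otimes> fst p}"
    unfolding openin_prod_topology_alt by meson
  obtain L where L: "L \<in> real_subgroups G T" "L \<inter> X \<noteq> {}" "L \<inter> Y \<noteq> {}"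
    using real_subgroup_meeting[OF XY(1) _ XY(2)] XY(3,4) by blast
  obtain \<delta> :: "real \<Rightarrow> 'a" and p where \<delta>: "\<And>s t. \<delta> (s + t) = \<delta> s \<otimes> \<delta> t" "range \<delta> = L"
    by (rule real_subgroup_parametrization[OF L(1)]) blast
  obtain s t where st: "\<delta> s \<in> X" "\<delta> t \<in> Y" using L(2,3) \<delta>(2) by blast
  then have "(\<delta> s, \<delta> t) \<in> X \<times> Y" by blast
  then have "\<delta> s \<otimes> \<delta> t \<noteq> \<delta> t \<otimes> \<delta> s" using XY(5) by auto
  moreover have "\<delta> s \<otimes> \<delta> t = \<delta> t \<otimes> \<delta> s" using \<delta>(1)[of s t] \<delta>(1)[of t s] by (simp add: add.commute)
  ultimately show False by blast
qed

text \<open>A separation of \<open>G\<close> would separate some subgroup isomorphic to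
  \<real>.\<close>

lemma connected: "connected_space T"
  unfolding connected_space_def
proof (intro notI, elim exE conjE)
  fix A B assume AB: "openin T A" "openin T B" "topspace T \<subseteq> A \<union> B" "A \<inter> B = {}" "A \<noteq> {}" "B \<noteq> {}"
  obtain L where L: "L \<in> real_subgroups G T" "L \<inter> A \<noteq> {}" "L \<inter> B \<noteq> {}"
    using real_subgroup_meeting AB(1,2,5,6) by metis
  obtain \<delta> :: "real \<Rightarrow> 'a" and p where \<delta>: "continuous_map euclidean T \<delta>" "range \<delta> = L"
    by (rule real_subgroup_parametrization[OF L(1)]) blast
  have "connectedin T L"
    using connectedin_continuous_map_image[OF \<delta>(1), of UNIV] \<delta>(2) by simp
  then show False
    using AB L(2,3) connectedin_subset_topspace[of T L] unfolding connectedin by blast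
qed

text \<open>A compact neighbourhood \<open>V\<close> satisfies \<open>V\<^sup>2 \<subseteq> V L\<close> for some \<open>L\<close>, which gives
  \<open>V\<^sup>n \<subseteq> V L\<close> for all \<open>n\<close>, and the powers of \<open>V\<close> exhaust the group.\<close>

lemma cocompact_real_subgroup:
  obtains V L where "compactin T V" "identity_neighborhood G T V" "L \<in> real_subgroups G T"
    "carrier G = V <#> L"
proof -
  have "identity_neighborhood G T (carrier G)"
    unfolding identity_neighborhood_def using topspace_eq_carrier by (metis one_closed openin_topspace order_refl)
  \<comment> \<open>Applied to the whole group, this yields a compact identity
    neighbourhood.\<close>
  then obtain V where V: "compactin T V" "identity_neighborhood G T V"
    by (rule compact_square_root_neighborhood[OF locally_compact Hausdorff]) blast
  have Vc: "V \<subseteq> carrier G" using V(1) compactin_subset_topspace topspace_eq_carrier by blast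
  have "compactin T ((\<lambda>(x, y). x \<otimes> y) ` (V \<times> V))"
    using continuous_mult V(1) by (intro image_compactin) (auto simp: compactin_Times)
  then obtain L where L: "L \<in> real_subgroups G T" "(\<lambda>(x, y). x \<otimes> y) ` (V \<times> V) \<subseteq> V <#> L"
    using V(2) by (rule approximating_subgroup)
  have sub: "subgroup L G" using L(1) by (simp add: real_subgroups_def closed_subgroups_def)
  have Lc: "L \<subseteq> carrier G" using sub by (rule subgroup.subset)
  \<comment> \<open>V (V L) = (V V) L \<subseteq> (V L) L = V L.\<close>
  have absorb: "v \<otimes> x \<in> V <#> L" if v: "v \<in> V" and x: "x \<in> V <#> L" for v x
  proof -
    obtain u l where ul: "u \<in> V" "l \<in> L" "x = u \<otimes> l" using x unfolding set_mult_def by blast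
    have "v \<otimes> u \<in> V <#> L" using L(2) v ul(1) by auto
    then obtain u' l' where u': "u' \<in> V" "l' \<in> L" "v \<otimes> u = u' \<otimes> l'" unfolding set_mult_def by blast
    have "v \<otimes> x = (v \<otimes> u) \<otimes> l" using v ul Vc Lc by (simp add: m_assoc subset_iff)
    also have "\<dots> = u' \<otimes> (l' \<otimes> l)" unfolding u'(3) using u' ul Vc Lc by (simp add: m_assoc subset_iff)
    finally have "v \<otimes> x = u' \<otimes> (l' \<otimes> l)" .
    moreover have "l' \<otimes> l \<in> L" using u'(2) ul(2) by (rule subgroup.m_closed[OF sub])
    ultimately show ?thesis using u'(1) unfolding set_mult_def by blast
  qed
  have oneV: "\<one> \<in> V" using V(2) by (auto simp: identity_neighborhood_def)
  have one: "\<one> \<in> V <#> L"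
    using oneV subgroup.one_closed[OF sub] unfolding set_mult_def by force
  have "x \<in> V <#> L" if x: "x \<in> carrier G" for x
  proof -
    \<comment> \<open>Another real subgroup \<open>L'\<close> is chosen for this \<open>x\<close>.
      Its elements have roots arbitrarily close to \<open>\<one>\<close>, so \<open>x\<close> is a
      product of finitely many elements of \<open>V\<close>, which \<open>absorb\<close>
      collects.\<close>
    have "compactin T {x}" using x by (simp add: topspace_eq_carrier)
    then obtain L' where L': "L' \<in> real_subgroups G T" "{x} \<subseteq> V <#> L'"
      using V(2) by (rule approximating_subgroup)
    obtain \<delta> :: "real \<Rightarrow> 'a" and p where \<delta>: "continuous_map euclidean T \<delta>"
      "\<And>s t. \<delta> (s + t) = \<delta> s \<otimes> \<delta> t" "range \<delta> = L'"
      by (rule real_subgroup_parametrization[OF L'(1)]) blast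
    have \<delta>c: "\<delta> t \<in> carrier G" for t
      using \<delta>(3) L'(1) by (auto simp: real_subgroups_def closed_subgroups_def dest: subgroup.subset)
    have \<delta>0: "\<delta> 0 = \<one>" using \<delta>(2) \<delta>c by (rule additive_at_zero)
    obtain v t where vt: "v \<in> V" "x = v \<otimes> \<delta> t" using L'(2) \<delta>(3) unfolding set_mult_def by blast
    obtain O' where O': "openin T O'" "\<one> \<in> O'" "O' \<subseteq> V" using V(2) by (auto simp: identity_neighborhood_def)
    have "open {s. \<delta> s \<in> O'}"
      using openin_continuous_map_preimage[OF \<delta>(1) O'(1)] by simp
    moreover have "(0::real) \<in> {s. \<delta> s \<in> O'}" using \<delta>0 O'(2) by simp
    ultimately obtain e where e: "e > 0" "\<And>s. \<bar>s\<bar> < e \<Longrightarrow> \<delta> s \<in> O'"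
      unfolding open_dist by (auto simp: dist_real_def)
    obtain n :: nat where n: "\<bar>t\<bar> < n * e" using e(1) reals_Archimedean3 by blast
    then have n0: "n > 0" by (cases n) auto
    have "\<bar>t / n\<bar> < e" using n n0 by (simp add: field_simps)
    then have small: "\<delta> (t / n) \<in> V" using e(2) O'(3) by blast
    have "\<delta> (k * (t / n)) \<in> V <#> L" for k :: nat
    proof (induction k)
      case (Suc k)
      have "\<delta> (Suc k * (t / n)) = \<delta> (t / n) \<otimes> \<delta> (k * (t / n))"
        unfolding \<delta>(2)[symmetric] by (simp add: distrib_right add_divide_distrib)
      then show ?case using absorb[OF small Suc] by (simp only:)
    qed (simp add: \<delta>0 one)
    from this[of n] show ?thesis using absorb[OF vt(1)] vt(2) n0 by simp
  qed
  moreover have "V <#> L \<subseteq> carrier G" using Vc Lc unfolding set_mult_def by auto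
  ultimately show thesis using that V L(1) by blast
qed

text \<open>The \<open>L\<close>-coordinate \<open>h\<close> with respect to \<open>G = V L\<close> is a homomorphism up to a bounded
  error, and averaging over all its translates makes it exact.\<close>

lemma real_projection:
  obtains \<delta> :: "real \<Rightarrow> 'a" and f :: "'a \<Rightarrow> real" and V D where
    "continuous_map euclidean T \<delta>" "\<And>t. \<delta> t \<in> carrier G" "\<And>s t. \<delta> (s + t) = \<delta> s \<otimes> \<delta> t"
    "continuous_map T euclidean f" "\<And>x y. x \<in> carrier G \<Longrightarrow> y \<in> carrier G \<Longrightarrow> f (x \<otimes> y) = f x + f y"
    "\<And>t. f (\<delta> t) = t" "compactin T V"
    "\<And>x. x \<in> carrier G \<Longrightarrow> f x = 0 \<Longrightarrow> \<exists>v\<in>V. \<exists>t. \<bar>t\<bar> \<le> D \<and> x = v \<otimes> \<delta> t"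
proof -
  interpret comm_group G
    by unfold_locales (rule approximable_commutative)
  obtain M where "invariant_mean G M" by (rule invariant_mean_exists)
  then interpret invariant_mean G M .
  obtain V L where V: "compactin T V" "identity_neighborhood G T V" and L: "L \<in> real_subgroups G T"
    and VL: "carrier G = V <#> L" by (rule cocompact_real_subgroup)
  have Vc: "V \<subseteq> carrier G" using V(1) compactin_subset_topspace topspace_eq_carrier by blast
  obtain \<delta> :: "real \<Rightarrow> 'a" and p where \<delta>: "continuous_map euclidean T \<delta>"
      "\<And>s t. \<delta> (s + t) = \<delta> s \<otimes> \<delta> t" "range \<delta> = L"
    and p: "\<And>t. p (\<delta> t) = t" "continuous_map (subtopology T L) euclidean p"
    by (rule real_subgroup_parametrization[OF L]) (rule that)
  have Lcl: "closedin T L" using L by (simp add: real_subgroups_def closed_subgroups_def)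
  have \<delta>c: "\<delta> t \<in> carrier G" for t
    using \<delta>(3) L by (auto simp: real_subgroups_def closed_subgroups_def dest: subgroup.subset)
  have \<delta>0: "\<delta> 0 = \<one>" using \<delta>(2) \<delta>c by (rule additive_at_zero)
  have \<delta>minus: "\<delta> (- t) = inv (\<delta> t)" for t
    using \<delta>(2)[of "- t" t] \<delta>0 \<delta>c inv_equality[of "\<delta> (- t)" "\<delta> t"] by simp
  \<comment> \<open>\<open>Q\<close> contains all discrepancies v(x y)^-1 v(x) v(y). Its
    intersection with the closed \<open>L\<close> is compact, so \<open>p\<close> is bounded on it,
    by \<open>D\<close>. Since \<open>\<one>\<close> \<in> \<open>V\<close>, shorter products are
    covered as well.\<close>
  define Q where "Q = (\<lambda>(a, b, c). inv a \<otimes> (b \<otimes> c)) ` (V \<times> V \<times> V)"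
  have "compactin T Q"
  proof -
    have "continuous_map (prod_topology T (prod_topology T T)) T
        ((\<lambda>(x, y). x \<otimes> y) \<circ> (\<lambda>q. (inv (fst q), (\<lambda>(x, y). x \<otimes> y) (snd q))))"
      by (intro continuous_map_compose[OF _ continuous_mult] continuous_map_pairedI
        continuous_map_compose[OF continuous_map_fst continuous_inv, unfolded o_def]
        continuous_map_compose[OF continuous_map_snd continuous_mult, unfolded o_def])
    then show ?thesis
      unfolding Q_def using V(1)
      by (intro image_compactin) (auto simp: compactin_Times o_def case_prod_unfold)
  qed
  then have "compactin (subtopology T L) (Q \<inter> L)"
    using Lcl by (simp add: compactin_subtopology compact_Int_closedin)
  then have "compactin euclidean (p ` (Q \<inter> L))" using p(2) by (rule image_compactin)
  then have "bounded (p ` (Q \<inter> L))" by (simp add: compactin_euclidean_iff compact_imp_bounded)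
  then obtain D where D: "\<And>x. x \<in> Q \<inter> L \<Longrightarrow> \<bar>p x\<bar> \<le> D" by (auto simp: bounded_iff)
  have bound: "\<bar>t\<bar> \<le> D" if "\<delta> t = inv a \<otimes> (b \<otimes> c)" "a \<in> V" "b \<in> V" "c \<in> V" for t a b c
  proof -
    have "\<delta> t \<in> Q" unfolding Q_def using that by force
    then show ?thesis using D[of "\<delta> t"] \<delta>(3) p(1) by auto
  qed
  have oneV: "\<one> \<in> V" using V(2) by (auto simp: identity_neighborhood_def)
  have "\<exists>h. \<exists>v\<in>V. x = v \<otimes> \<delta> h" if "x \<in> carrier G" for x
    using that \<delta>(3) VL unfolding set_mult_def by blast
  \<comment> \<open>A mere choice, with no continuity in \<open>x\<close>; all control comes from
    \<open>D\<close>.\<close>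
  then obtain h v where hv: "\<And>x. x \<in> carrier G \<Longrightarrow> v x \<in> V" "\<And>x. x \<in> carrier G \<Longrightarrow> x = v x \<otimes> \<delta> (h x)"
    by metis
  have vc: "v x \<in> carrier G" if "x \<in> carrier G" for x using hv(1)[OF that] Vc by blast
  have h_eq: "\<delta> (h x) = inv (v x) \<otimes> x" if "x \<in> carrier G" for x
    using hv(2)[OF that] vc[OF that] \<delta>c that by (metis inv_solve_left)
  have quasi: "\<bar>h (x \<otimes> y) - h x - h y\<bar> \<le> D" if x: "x \<in> carrier G" and y: "y \<in> carrier G" for x y
  proof (rule bound[of _ "v (x \<otimes> y)" "v x" "v y"])
    have xy: "x \<otimes> y = (v x \<otimes> v y) \<otimes> (\<delta> (h x) \<otimes> \<delta> (h y))"
      using hv(2)[OF x] hv(2)[OF y] vc[OF x] vc[OF y] \<delta>c[of "h x"] \<delta>c[of "h y"]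
      by (metis m_assoc m_closed m_comm)
    have "\<delta> (h (x \<otimes> y)) = inv (v (x \<otimes> y)) \<otimes> ((v x \<otimes> v y) \<otimes> \<delta> (h x + h y))"
      using trans[OF h_eq[OF m_closed[OF x y]] arg_cong[OF xy, of "(\<otimes>) (inv (v (x \<otimes> y)))"]]
      by (simp only: \<delta>(2))
    then have "\<delta> (h (x \<otimes> y)) \<otimes> \<delta> (- (h x + h y))
        = inv (v (x \<otimes> y)) \<otimes> (v x \<otimes> v y) \<otimes> (\<delta> (h x + h y) \<otimes> \<delta> (- (h x + h y)))"
      using x y vc \<delta>c by (simp add: m_assoc)
    also have "\<delta> (h x + h y) \<otimes> \<delta> (- (h x + h y)) = \<one>"
      unfolding \<delta>minus by (rule r_inv[OF \<delta>c])
    finally show "\<delta> (h (x \<otimes> y) - h x - h y) = inv (v (x \<otimes> y)) \<otimes> (v x \<otimes> v y)"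
      using \<delta>(2)[of "h (x \<otimes> y)" "- (h x + h y)"] x y vc by (simp add: algebra_simps)
  qed (use x y hv in auto)
  \<comment> \<open>\<open>h\<close> may be unbounded, but by \<open>quasi\<close> its increments
    under translation by a fixed \<open>x\<close> are bounded and have a mean. Invariance under
    translation by \<open>y\<close> makes these means add up exactly.\<close>
  define f where "f = (\<lambda>x. rmean (\<lambda>y. h (x \<otimes> y) - h y))"
  have D0: "D \<ge> 0" using quasi[OF one_closed one_closed] by linarith
  have bd: "bdd_fun (\<lambda>y. h (x \<otimes> y) - h y)" if x: "x \<in> carrier G" for x
  proof (rule bounded_onI)
    fix y assume "y \<in> carrier G"
    from quasi[OF x this] show "norm (h (x \<otimes> y) - h y) \<le> D + \<bar>h x\<bar>" by (auto simp: abs_le_iff)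
  qed
  have f_near: "\<bar>f x - h x\<bar> \<le> D" if x: "x \<in> carrier G" for x
  proof -
    have "f x \<le> rmean (\<lambda>y. h x + D)" unfolding f_def
      using quasi[OF x] by (intro rmean_mono bd x bounded_on_intros) (auto simp: abs_le_iff algebra_simps)
    moreover have "f x \<ge> rmean (\<lambda>y. h x - D)" unfolding f_def
    proof (intro rmean_mono bd x bounded_on_intros)
      fix y assume "y \<in> carrier G"
      from quasi[OF x this] show "h x - D \<le> h (x \<otimes> y) - h y" by linarith
    qed
    ultimately show ?thesis by (simp add: rmean_const)
  qed
  have f_mult: "f (x \<otimes> y) = f x + f y" if x: "x \<in> carrier G" and y: "y \<in> carrier G" for x y
  proof -
    have "f x = rmean (\<lambda>z. h (x \<otimes> (y \<otimes> z)) - h (y \<otimes> z))"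
      unfolding f_def using y bd[OF x] by (rule rmean_translate[symmetric])
    then have "f x + f y = rmean (\<lambda>z. (h (x \<otimes> (y \<otimes> z)) - h (y \<otimes> z)) + (h (y \<otimes> z) - h z))"
      unfolding f_def
      using rmean_add[OF bounded_on_translate[OF bd[OF x] y] bd[OF y]] by simp
    also have "\<dots> = f (x \<otimes> y)"
      unfolding f_def
    proof (rule rmean_cong)
      show "bdd_fun (\<lambda>z. (h (x \<otimes> (y \<otimes> z)) - h (y \<otimes> z)) + (h (y \<otimes> z) - h z))"
        by (intro bounded_on_add bounded_on_translate[OF bd[OF x] y] bd[OF y])
    qed (use x y in \<open>simp add: m_assoc\<close>)
    finally show ?thesis by simp
  qed
  have f_pow: "f (x [^] n) = n * f x" if "x \<in> carrier G" for x and n :: nat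
  proof (induction n)
    case 0
    then show ?case using f_mult[OF one_closed one_closed] by simp
  qed (use that in \<open>simp add: f_mult algebra_simps\<close>)
  \<comment> \<open>\<open>f \<circ> \<delta>\<close> stays within 2 D of the identity. Replacing
    \<open>t\<close> by its \<open>n\<close>-fold multiplies the difference by \<open>n\<close>, so
    it is 0.\<close>
  have f_\<delta>: "f (\<delta> t) = t" for t
  proof -
    have near: "\<bar>f (\<delta> s) - s\<bar> \<le> 2 * D" for s
    proof -
      have "\<delta> (s - h (\<delta> s)) = \<delta> s \<otimes> \<delta> (- h (\<delta> s))" using \<delta>(2)[of s "- h (\<delta> s)"] by simp
      also have "\<dots> = v (\<delta> s)"
        using hv(2)[OF \<delta>c] vc[OF \<delta>c] \<delta>c by (metis \<delta>minus inv_solve_right)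
      finally have "\<delta> (s - h (\<delta> s)) = inv \<one> \<otimes> (\<one> \<otimes> v (\<delta> s))" using vc[OF \<delta>c] by simp
      then have "\<bar>s - h (\<delta> s)\<bar> \<le> D" using oneV hv(1)[OF \<delta>c] by (intro bound)
      then show ?thesis using f_near[OF \<delta>c, of s] by linarith
    qed
    have \<delta>pow: "\<delta> (n * t) = \<delta> t [^] n" for n :: nat
      by (induction n) (simp_all add: \<delta>0 \<delta>(2) distrib_right add.commute[of t] )
    have "n * \<bar>f (\<delta> t) - t\<bar> \<le> 2 * D" for n :: nat
      using near[of "n * t"] f_pow[OF \<delta>c, of t n]
      by (simp add: \<delta>pow abs_mult flip: right_diff_distrib)
    then have "\<bar>f (\<delta> t) - t\<bar> = 0"
      using reals_Archimedean3[of "\<bar>f (\<delta> t) - t\<bar>"] by (metis abs_ge_zero less_eq_real_def linorder_not_less)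
    then show ?thesis by simp
  qed
  have fV: "\<bar>f x\<bar> \<le> 2 * D" if x: "x \<in> V" for x
  proof -
    have xc: "x \<in> carrier G" using x Vc by blast
    have "\<delta> (h x) = inv (v x) \<otimes> (x \<otimes> \<one>)" using h_eq xc by simp
    then have "\<bar>h x\<bar> \<le> D" using hv(1)[OF xc] x oneV by (rule bound)
    then show ?thesis using f_near[OF xc] by linarith
  qed
  \<comment> \<open>A homomorphism bounded by 2 D on \<open>V\<close> is bounded by 2 D / n at every
    \<open>w\<close> whose \<open>n\<close>-th power lies in \<open>V\<close>.\<close>
  have "uniformly_continuous f"
    unfolding uniformly_continuous_def
  proof (intro allI impI)
    fix e :: real assume e: "e > 0"
    obtain n :: nat where n: "2 * D < n * e" using e reals_Archimedean3 by blast
    then have n0: "n > 0" using D0 by (cases n) auto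
    obtain O' where O': "openin T O'" "\<one> \<in> O'" "O' \<subseteq> V" using V(2) by (auto simp: identity_neighborhood_def)
    have "continuous_map T T (\<lambda>x. x [^] n)" for n :: nat
    proof (induction n)
      case 0
      then show ?case by (simp add: topspace_eq_carrier)
    next
      case (Suc n)
      then show ?case
        using continuous_map_compose[OF continuous_map_pairedI[OF Suc continuous_map_id[unfolded id_def]] continuous_mult]
        by (simp add: o_def)
    qed
    from openin_continuous_map_preimage[OF this O'(1), of n]
    have "openin T {x \<in> carrier G. x [^] n \<in> O'}" by (simp add: topspace_eq_carrier)
    moreover have "\<one> \<in> {x \<in> carrier G. x [^] n \<in> O'}" using O'(2) by simp
    moreover have "norm (f (w \<otimes> x) - f x) \<le> e"
      if x: "x \<in> carrier G" and w: "w \<in> {x \<in> carrier G. x [^] n \<in> O'}" for x w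
    proof -
      have "\<bar>n * f w\<bar> \<le> 2 * D" using fV[of "w [^] n"] f_pow[of w n] w O'(3) by auto
      then have "n * \<bar>f w\<bar> \<le> n * e" using n by (simp add: abs_mult)
      then have "\<bar>f w\<bar> \<le> e" using n0 by simp
      then show ?thesis using x w by (simp add: f_mult)
    qed
    ultimately show "\<exists>V. openin T V \<and> \<one> \<in> V \<and> (\<forall>x\<in>carrier G. \<forall>v\<in>V. norm (f (v \<otimes> x) - f x) \<le> e)" by blast
  qed
  then have "continuous_map T euclidean f" by (rule uniformly_continuous_imp_continuous_map)
  moreover have "\<exists>v\<in>V. \<exists>t. \<bar>t\<bar> \<le> D \<and> x = v \<otimes> \<delta> t" if "x \<in> carrier G" "f x = 0" for x
    using hv[OF that(1)] f_near[OF that(1)] that(2) by auto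
  ultimately show thesis using that[OF \<delta>(1) \<delta>c \<delta>(2) _ f_mult f_\<delta> V(1)] by blast
qed

text \<open>Since \<open>f\<close> has the section \<delta>, the map \<open>\<pi>\<close> is a
  retraction onto the kernel \<open>N\<close>, and a homomorphism because \<open>G\<close> is
  abelian. \<open>N\<close> is compact as a closed subset of V \<delta>[-D, D], and connected as an
  image of \<open>G\<close>.\<close>

theorem isomorphic_to_product:
  obtains C :: "'a monoid" and S :: "'a topology" where "compact_connected_abelian_group C S"
    "topological_group_isomorphic G T (real_group \<times>\<times> C) (prod_topology euclidean S)"
proof -
  interpret comm_group G
    by unfold_locales (rule approximable_commutative)
  obtain \<delta> :: "real \<Rightarrow> 'a" and f :: "'a \<Rightarrow> real" and V D where
    \<delta>: "continuous_map euclidean T \<delta>" "\<And>t. \<delta> t \<in> carrier G" "\<And>s t. \<delta> (s + t) = \<delta> s \<otimes> \<delta> t"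
    and f: "continuous_map T euclidean f" "\<And>x y. x \<in> carrier G \<Longrightarrow> y \<in> carrier G \<Longrightarrow> f (x \<otimes> y) = f x + f y"
    and f\<delta>: "\<And>t. f (\<delta> t) = t" and V: "compactin T V"
    and bound: "\<And>x. x \<in> carrier G \<Longrightarrow> f x = 0 \<Longrightarrow> \<exists>v\<in>V. \<exists>t. \<bar>t\<bar> \<le> D \<and> x = v \<otimes> \<delta> t"
    by (rule real_projection) (rule that)
  define N where "N = {x \<in> carrier G. f x = 0}"
  define C where "C = \<lparr>carrier = N, mult = (\<otimes>), one = \<one>\<rparr>"
  define S where "S = subtopology T N"
  define \<pi> where "\<pi> = (\<lambda>x. x \<otimes> \<delta> (- f x))"
  have Nc: "N \<subseteq> carrier G" by (auto simp: N_def)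
  have f1: "f \<one> = 0" using f(2)[OF one_closed one_closed] by simp
  have finv: "f (inv x) = - f x" if "x \<in> carrier G" for x
    using f(2)[of "inv x" x] that f1 by simp
  have topS: "topspace S = N" using Nc by (auto simp: S_def topspace_eq_carrier)
  have \<pi>N: "\<pi> x \<in> N" if "x \<in> carrier G" for x
    using that \<delta>(2) by (simp add: \<pi>_def N_def f(2) f\<delta>)
  have cont_\<pi>: "continuous_map T S \<pi>"
  proof -
    have "continuous_map T euclidean (\<lambda>x. - f x)" using f(1) by (rule continuous_map_minus)
    from continuous_map_compose[OF this \<delta>(1)]
    have "continuous_map T T ((\<lambda>(x, y). x \<otimes> y) \<circ> (\<lambda>x. (x, \<delta> (- f x))))"
      by (intro continuous_map_compose[OF _ continuous_mult] continuous_map_pairedI)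
        (auto simp: o_def continuous_map_id[unfolded id_def])
    then show ?thesis
      unfolding S_def continuous_map_in_subtopology using \<pi>N by (auto simp: \<pi>_def o_def topspace_eq_carrier)
  qed
  have "compactin T N"
  proof -
    have "compactin T ((\<lambda>(x, y). x \<otimes> y) ` (V \<times> \<delta> ` {- D..D}))"
      using V image_compactin[OF _ \<delta>(1), of "{- D..D}"]
      by (intro image_compactin[OF _ continuous_mult]) (auto simp: compactin_Times compactin_euclidean_iff)
    moreover have "N \<subseteq> (\<lambda>(x, y). x \<otimes> y) ` (V \<times> \<delta> ` {- D..D})"
    proof
      fix x assume "x \<in> N"
      then obtain v t where "v \<in> V" "\<bar>t\<bar> \<le> D" "x = v \<otimes> \<delta> t" using bound[of x] unfolding N_def by blast
      then show "x \<in> (\<lambda>(x, y). x \<otimes> y) ` (V \<times> \<delta> ` {- D..D})"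
        by (intro image_eqI[of _ _ "(v, \<delta> t)"]) (auto simp: abs_le_iff)
    qed
    moreover have "closedin T N"
      using closedin_continuous_map_preimage[OF f(1), of "{0}"] by (simp add: N_def topspace_eq_carrier)
    ultimately show ?thesis by (rule closed_compactin)
  qed
  then have compS: "compact_space S" unfolding S_def by (rule compact_space_subtopology)
  have HS: "Hausdorff_space S" unfolding S_def using Hausdorff by (rule Hausdorff_space_subtopology)
  have "\<pi> ` topspace T = topspace S"
  proof
    show "topspace S \<subseteq> \<pi> ` topspace T"
    proof
      fix x assume "x \<in> topspace S"
      then have x: "x \<in> carrier G" "f x = 0" by (auto simp: topS N_def)
      have "\<delta> 0 = \<one>" using \<delta>(3,2) by (rule additive_at_zero)
      then have "x = \<pi> x" using x by (simp add: \<pi>_def)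
      then show "x \<in> \<pi> ` topspace T" using x(1) by (simp add: topspace_eq_carrier)
    qed
  qed (use \<pi>N in \<open>auto simp: topS topspace_eq_carrier\<close>)
  moreover have "connectedin S (\<pi> ` topspace T)"
    using cont_\<pi> connected by (intro connectedin_continuous_map_image[of T]) (auto simp: connectedin_topspace)
  ultimately have connS: "connected_space S" by (simp add: connectedin_topspace)
  have commC: "comm_group C"
  proof (rule comm_groupI)
    fix x assume "x \<in> carrier C"
    then show "\<exists>y\<in>carrier C. y \<otimes>\<^bsub>C\<^esub> x = \<one>\<^bsub>C\<^esub>"
      by (intro bexI[of _ "inv x"]) (auto simp: C_def N_def finv)
  qed (auto simp: C_def N_def f(2) f1 m_ac)
  have invC: "inv\<^bsub>C\<^esub> x = inv x" if "x \<in> N" for x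
  proof -
    interpret C: comm_group C by (fact commC)
    show ?thesis
      using that by (intro C.inv_equality) (auto simp: C_def N_def finv)
  qed
  have "topological_group C S"
  proof -
    interpret C: comm_group C by (fact commC)
    show ?thesis
    proof
      show "topspace S = carrier C" by (simp add: topS C_def)
      have "continuous_map (subtopology (prod_topology T T) (N \<times> N)) S (\<lambda>(x, y). x \<otimes> y)"
        unfolding S_def continuous_map_in_subtopology
        using continuous_map_from_subtopology[OF continuous_mult]
        by (auto simp: N_def f(2))
      then show "continuous_map (prod_topology S S) S (\<lambda>(x, y). x \<otimes>\<^bsub>C\<^esub> y)"
        by (simp add: S_def subtopology_Times C_def)
      have "continuous_map S S (\<lambda>x. inv x)"
        unfolding S_def continuous_map_in_subtopology
        using continuous_map_from_subtopology[OF continuous_inv]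
        by (auto simp: N_def finv)
      then show "continuous_map S S (\<lambda>x. inv\<^bsub>C\<^esub> x)"
        by (rule continuous_map_eq) (simp add: topS invC)
    qed
  qed
  then have CS: "compact_connected_abelian_group C S"
    using commC compS connS HS by (simp add: compact_connected_abelian_group_def)
  define F where "F = (\<lambda>x. (f x, \<pi> x))"
  define H where "H = (\<lambda>(t, c). \<delta> t \<otimes> c)"
  have HF: "H (F x) = x" if x: "x \<in> carrier G" for x
  proof -
    have "\<delta> (f x) \<otimes> (x \<otimes> \<delta> (- f x)) = x \<otimes> \<delta> (f x + - f x)"
      unfolding \<delta>(3) using x \<delta>(2) by (simp add: m_lcomm)
    also have "\<delta> (f x + - f x) = \<one>" using additive_at_zero[OF \<delta>(3,2)] by simp
    finally show ?thesis using x by (simp add: H_def F_def \<pi>_def)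
  qed
  have FH: "F (H (t, c)) = (t, c)" if c: "c \<in> N" for t c
  proof -
    have "f (\<delta> t \<otimes> c) = t" using c \<delta>(2) by (simp add: N_def f(2) f\<delta>)
    moreover have "\<delta> t \<otimes> c \<otimes> \<delta> (- t) = c \<otimes> \<delta> (t + - t)"
      unfolding \<delta>(3) using c \<delta>(2) Nc by (simp add: subset_iff m_ac)
    moreover have "\<delta> (t + - t) = \<one>" using additive_at_zero[OF \<delta>(3,2)] by simp
    ultimately show ?thesis using c Nc by (auto simp: F_def H_def \<pi>_def)
  qed
  have "F \<in> iso G (real_group \<times>\<times> C)"
  proof (rule isoI)
    have "\<pi> (x \<otimes> y) = \<pi> x \<otimes> \<pi> y" if x: "x \<in> carrier G" and y: "y \<in> carrier G" for x y
    proof -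
      have "\<delta> (- f (x \<otimes> y)) = \<delta> (- f x) \<otimes> \<delta> (- f y)" using x y by (simp add: f(2) flip: \<delta>(3))
      then show ?thesis using x y \<delta>(2) by (simp add: \<pi>_def m_ac)
    qed
    then show "F \<in> hom G (real_group \<times>\<times> C)"
      using \<pi>N by (auto simp: hom_def F_def C_def f(2))
    show "bij_betw F (carrier G) (carrier (real_group \<times>\<times> C))"
      by (rule bij_betwI[of _ _ _ H])
        (use \<pi>N HF FH \<delta>(2) Nc in \<open>auto simp: C_def F_def H_def\<close>)
  qed
  moreover have "homeomorphic_maps T (prod_topology euclidean S) F H"
    unfolding homeomorphic_maps_def
  proof (intro conjI ballI)
    show "continuous_map T (prod_topology euclidean S) F"
      unfolding F_def using f(1) cont_\<pi> by (rule continuous_map_pairedI)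
    have "continuous_map (prod_topology euclidean S) T snd"
      using continuous_map_snd[of euclidean S] by (auto simp: S_def continuous_map_in_subtopology)
    moreover have "continuous_map (prod_topology euclidean S) T (\<lambda>q. \<delta> (fst q))"
      using continuous_map_compose[OF continuous_map_fst \<delta>(1)] by (simp add: o_def)
    ultimately have "continuous_map (prod_topology euclidean S) T ((\<lambda>(x, y). x \<otimes> y) \<circ> (\<lambda>q. (\<delta> (fst q), snd q)))"
      by (intro continuous_map_compose[OF _ continuous_mult] continuous_map_pairedI)
    then show "continuous_map (prod_topology euclidean S) T H"
      by (simp add: H_def o_def case_prod_unfold)
  qed (use HF FH in \<open>auto simp: topS topspace_eq_carrier\<close>)
  ultimately show thesis
    using that[OF CS] homeomorphic_map_maps unfolding topological_group_isomorphic_def by blast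
qed

end

text \<open>An existential quantifier ranges over one fixed type. The compact factor that is found
  is a subgroup of \<open>G\<close>, so the type of \<open>G\<close> suffices in the equivalence;
  the second conjunct gives the converse for factors on any other type.\<close>

theorem theoremB:
  fixes G :: "('a, 'm) monoid_scheme" and T :: "'a topology"
  assumes "topological_group G T"
    and "locally_compact_space T"
    and "Hausdorff_space T"
  shows "(numerally_approximable G T \<longleftrightarrow>
      (\<exists>(C :: 'a monoid) (S :: 'a topology).
         compact_connected_abelian_group C S \<and>
         topological_group_isomorphic G T (real_group \<times>\<times> C) (prod_topology euclidean S)))
    \<and> (\<forall>(C :: ('c, 'n) monoid_scheme) (S :: 'c topology).
         compact_connected_abelian_group C S \<and>
         topological_group_isomorphic G T (real_group \<times>\<times> C) (prod_topology euclidean S)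
         \<longrightarrow> numerally_approximable G T)"
proof (intro conjI iffI allI impI)
  assume "numerally_approximable G T"
  with assms have "approximable_group G T"
    by (simp add: approximable_group_def approximable_group_axioms_def)
  then show "\<exists>(C :: 'a monoid) (S :: 'a topology). compact_connected_abelian_group C S \<and>
      topological_group_isomorphic G T (real_group \<times>\<times> C) (prod_topology euclidean S)"
    using approximable_group.isomorphic_to_product by metis
qed (use numerally_approximable_if_isomorphic[OF assms] in blast)+

end
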